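(* For each $n$, the graded ring $\mathscr G_n(q)$ satisfies $$K_{\boldsymbol\lambda}(n)K_{\boldsymbol\mu}(n)=\sum_{\|\boldsymbol\nu\|=\|\boldsymbol\lambda\|+\|\boldsymbol\mu\|}a^{\boldsymbol\nu}_{\boldsymbol\lambda\boldsymbol\mu}K_{\boldsymbol\nu}(n)$$ for all $\boldsymbol\lambda,\boldsymbol\mu\in\mathcal{P}(\Phi)$. Moreover, for each $n$ the $\mathbb Z$-linear map $\mathscr G(q)\to\mathscr G_n(q)$ sending $K_{\boldsymbol\lambda}$ to $K_{\boldsymbol\lambda}(n)$ for all $\boldsymbol\lambda\in\mathcal{P}(\Phi)$ is a surjective algebra homomorphism.
   Context: Let $q$ be a prime power, $G_n=GL_n(\mathbb F_q)$, with $G_m\subset G_n$ via $g\mapsto\mathrm{diag}(g,I_{n-m})$. Let $\Phi$ be the set of monic irreducible polynomials in $\mathbb F_q[t]$ other than $t$, $d(f)$ the degree of $f$, and $\mathcal{P}(\Phi)$ the set of finitely supported maps $\boldsymbol\lambda$ from $\Phi$ to partitions; $\|\boldsymbol\lambda\|=\sum_f d(f)|\boldsymbol\lambda(f)|$, $\boldsymbol\lambda^e=\boldsymbol\lambda(t-1)$, $\ell$ = number of nonzero parts. The type of $g\in G_n$ is the $\boldsymbol\lambda$ with $\mathbb F_q^n\cong\bigoplus_{f,i}\mathbb F_q[t]/(f^{\boldsymbol\lambda_i(f)})$ as $\mathbb F_q[t]$-modules ($t$ acting by $g$); its modified type $\mathring{\boldsymbol\lambda}$ agrees with $\boldsymbol\lambda$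 off $t-1$ and has $\mathring{\boldsymbol\lambda}(t-1)=(\boldsymbol\lambda^e_1-1,\dots,\boldsymbol\lambda^e_r-1)$ (zero parts discarded), $r=\ell(\boldsymbol\lambda^e)$. $K_{\boldsymbol\mu}(n)\in\mathbb Z[G_n]$ is the sum of the elements of $G_n$ of modified type $\boldsymbol\mu$ (zero if none, which happens iff $\|\boldsymbol\mu\|+\ell(\boldsymbol\mu^e)>n$); the nonzero ones form a $\mathbb Z$-basis of the center $\mathscr Z_n(q)$ of $\mathbb Z[G_n]$, with structure constants $K_{\boldsymbol\lambda}(n)K_{\boldsymbol\mu}(n)=\sum_{\boldsymbol\nu}a^{\boldsymbol\nu}_{\boldsymbol\lambda\boldsymbol\mu}(n)K_{\boldsymbol\nu}(n)$. When $\|\boldsymbol\nu\|=\|\boldsymbol\lambda\|+\|\boldsymbol\mu\|$, $a^{\boldsymbol\nu}_{\boldsymbol\lambda\boldsymbol\mu}(n)$ is independent of $n\ge\|\boldsymbol\nu\|+\ell(\boldsymbol\nu^e)$ and is denoted $a^{\boldsymbol\nu}_{\boldsymbol\lambda\boldsymbol\mu}$. Let $\mathcal K_m\subset\mathscr Z_n(q)$ be the span of the $K_{\boldsymbol\lambda}(n)$ with $\|\boldsymbol\lambda\|\le m$ ($\mathcal K_{-1}=0$); this is a ring filtration, and $\mathscr G_n(q)=\bigoplus_{i\ge0}\mathcal K_i/\mathcal K_{i-1}$ is the associated graded ring, in which $K_{\boldsymbol\lambda}(n)$ denotes the image of $K_{\boldsymbol\lambda}(n)$ in degree $\|\boldsymbol\lambda\|$.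 Let $\mathscr G(q)$ be the free $\mathbb Z$-module with basis symbols $K_{\boldsymbol\lambda}$, $\boldsymbol\lambda\in\mathcal{P}(\Phi)$, graded by $\|\boldsymbol\lambda\|$, with multiplication $K_{\boldsymbol\lambda}K_{\boldsymbol\mu}=\sum_{\|\boldsymbol\nu\|=\|\boldsymbol\lambda\|+\|\boldsymbol\mu\|}a^{\boldsymbol\nu}_{\boldsymbol\lambda\boldsymbol\mu}K_{\boldsymbol\nu}$. *)

theory Defs
  imports "HOL-Computational_Algebra.Computational_Algebra" "Jordan_Normal_Form.Matrix"
begin

text \<open>Throughout, the finite field F_q is modelled by a type 'a of class {field, finite};
q = CARD('a).  Elements of G_n = GL_n(F_q) are n x n invertible matrices.\<close>

definition GL :: "nat \<Rightarrow> ('a::{field,finite}) mat set" where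
  "GL n = {A. A \<in> carrier_mat n n \<and> invertible_mat A}"

definition Phi :: "('a::{field,finite}) poly set" where
  "Phi = {f. lead_coeff f = 1 \<and> irreducible f \<and> f \<noteq> [:0, 1:]}"

definition is_partition :: "nat list \<Rightarrow> bool" where
  "is_partition xs \<longleftrightarrow> sorted_wrt (\<ge>) xs \<and> (\<forall>k\<in>set xs. 0 < k)"

definition supp_p :: "('a::{field,finite} poly \<Rightarrow> nat list) \<Rightarrow> 'a poly set" where
  "supp_p lam = {f. lam f \<noteq> []}"

definition PPhi :: "('a::{field,finite} poly \<Rightarrow> nat list) set" where
  "PPhi = {lam. supp_p lam \<subseteq> Phi \<and> finite (supp_p lam) \<and> (\<forall>f. is_partition (lam f))}"

definition pnorm :: "('a::{field,finite} poly \<Rightarrow> nat list) \<Rightarrow> nat" where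
  "pnorm lam = (\<Sum>f\<in>supp_p lam. degree f * sum_list (lam f))"

definition tm1 :: "'a::{field,finite} poly" where
  "tm1 = [:-1, 1:]"

definition epart :: "('a::{field,finite} poly \<Rightarrow> nat list) \<Rightarrow> nat list" where
  "epart lam = lam tm1"

definition modtype :: "('a::{field,finite} poly \<Rightarrow> nat list) \<Rightarrow> ('a poly \<Rightarrow> nat list)" where
  "modtype lam = lam(tm1 := filter (\<lambda>k. 0 < k) (map (\<lambda>k. k - 1) (lam tm1)))"

text \<open>Companion matrix of a monic polynomial p: the matrix of multiplication by t on
F_q[t]/(p) in the basis 1, t, ..., t^(d-1).\<close>
definition companion :: "'a::{field,finite} poly \<Rightarrow> 'a mat" where
  "companion p = (let d = degree p in
     mat d d (\<lambda>(i, j). if j = d - 1 then - coeff p i else if i = j + 1 then 1 else 0))"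

fun blockdiag :: "'a::{field,finite} mat list \<Rightarrow> 'a mat" where
  "blockdiag [] = 0\<^sub>m 0 0"
| "blockdiag (A # As) =
     four_block_mat A (0\<^sub>m (dim_row A) (dim_col (blockdiag As)))
                      (0\<^sub>m (dim_row (blockdiag As)) (dim_col A)) (blockdiag As)"

definition blocks :: "('a::{field,finite} poly \<Rightarrow> nat list) \<Rightarrow> ('a poly \<times> nat) multiset" where
  "blocks lam = (\<Sum>f\<in>supp_p lam. mset (map (\<lambda>k. (f, k)) (lam f)))"

text \<open>g has type lam: F_q^n (t acting by g) is isomorphic as an F_q[t]-module to
the direct sum of F_q[t]/(f^(lam_i f)), i.e. g is similar to the block diagonal sum of
the companion matrices of the f^(lam_i f) (in some order).\<close>
definition has_type :: "'a::{field,finite} mat \<Rightarrow> ('a poly \<Rightarrow> nat list) \<Rightarrow> bool" where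
  "has_type g lam \<longleftrightarrow> lam \<in> PPhi \<and>
     (\<exists>L. mset L = blocks lam \<and>
          similar_mat g (blockdiag (map (\<lambda>(f, k). companion (f ^ k)) L)))"

definition has_modtype :: "'a::{field,finite} mat \<Rightarrow> ('a poly \<Rightarrow> nat list) \<Rightarrow> bool" where
  "has_modtype g mu \<longleftrightarrow> (\<exists>lam. has_type g lam \<and> modtype lam = mu)"

text \<open>Elements of the group ring Z[G_n] are functions G_n -> int (zero outside G_n).\<close>
type_synonym 'a grpring = "'a mat \<Rightarrow> int"

definition conv :: "nat \<Rightarrow> ('a::{field,finite}) grpring \<Rightarrow> 'a grpring \<Rightarrow> 'a grpring" where
  "conv n x y = (\<lambda>g. if g \<in> GL n then
      (\<Sum>p\<in>{(h, k). h \<in> GL n \<and> k \<in> GL n \<and> h * k = g}. x (fst p) * y (snd p)) else 0)"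

definition Ksum :: "nat \<Rightarrow> ('a::{field,finite} poly \<Rightarrow> nat list) \<Rightarrow> 'a grpring" where
  "Ksum n mu = (\<lambda>g. if g \<in> GL n \<and> has_modtype g mu then 1 else 0)"

text \<open>Structure constants a^nu_{lam mu}(n): coefficient of K_nu(n) in K_lam(n) K_mu(n),
read off at any element of modified type nu (0 if K_nu(n) = 0).\<close>
definition strc :: "nat \<Rightarrow> ('a::{field,finite} poly \<Rightarrow> nat list) \<Rightarrow> ('a poly \<Rightarrow> nat list)
     \<Rightarrow> ('a poly \<Rightarrow> nat list) \<Rightarrow> int" where
  "strc n nu lam mu = (if \<exists>g\<in>GL n. has_modtype g nu
     then conv n (Ksum n lam) (Ksum n mu) (SOME g. g \<in> GL n \<and> has_modtype g nu) else 0)"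

text \<open>Stable structure constant a^nu_{lam mu} (for ||nu|| = ||lam|| + ||mu||), taken at
n = ||nu|| + l(nu^e) (the paper asserts independence of n beyond this).\<close>
definition astab :: "('a::{field,finite} poly \<Rightarrow> nat list) \<Rightarrow> ('a poly \<Rightarrow> nat list)
     \<Rightarrow> ('a poly \<Rightarrow> nat list) \<Rightarrow> int" where
  "astab nu lam mu = strc (pnorm nu + length (epart nu)) nu lam mu"

definition Kfilt :: "nat \<Rightarrow> int \<Rightarrow> ('a::{field,finite}) grpring set" where
  "Kfilt n i = {x. \<exists>c. x = (\<lambda>g. \<Sum>lam\<in>{lam\<in>PPhi. int (pnorm lam) \<le> i}. c lam * Ksum n lam g)}"

text \<open>The associated graded ring G_n(q) = (+)_i K_i/K_(i-1): an element is represented by a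
family r with r i \<in> K_i, two families representing the same element iff
r i - s i \<in> K_(i-1) for all i.\<close>
definition gr_elem :: "nat \<Rightarrow> (nat \<Rightarrow> ('a::{field,finite}) grpring) \<Rightarrow> bool" where
  "gr_elem n r \<longleftrightarrow> (\<forall>i. r i \<in> Kfilt n (int i))"

definition gr_eq :: "nat \<Rightarrow> (nat \<Rightarrow> ('a::{field,finite}) grpring) \<Rightarrow> (nat \<Rightarrow> 'a grpring) \<Rightarrow> bool" where
  "gr_eq n r s \<longleftrightarrow> (\<forall>i. (\<lambda>g. r i g - s i g) \<in> Kfilt n (int i - 1))"

definition gr_add :: "(nat \<Rightarrow> ('a::{field,finite}) grpring) \<Rightarrow> (nat \<Rightarrow> 'a grpring) \<Rightarrow> (nat \<Rightarrow> 'a grpring)" where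
  "gr_add r s = (\<lambda>i g. r i g + s i g)"

definition gr_mul :: "nat \<Rightarrow> (nat \<Rightarrow> ('a::{field,finite}) grpring) \<Rightarrow> (nat \<Rightarrow> 'a grpring) \<Rightarrow> (nat \<Rightarrow> 'a grpring)" where
  "gr_mul n r s = (\<lambda>k g. \<Sum>i\<le>k. conv n (r i) (s (k - i)) g)"

definition emptyp :: "'a::{field,finite} poly \<Rightarrow> nat list" where
  "emptyp = (\<lambda>_. [])"

definition gr_one :: "nat \<Rightarrow> (nat \<Rightarrow> ('a::{field,finite}) grpring)" where
  "gr_one n = (\<lambda>k. if k = 0 then Ksum n emptyp else (\<lambda>_. 0))"

text \<open>The ring G(q): free Z-module on symbols K_lam, lam \<in> P(Phi); an element is a finitely
supported coefficient function.\<close>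
definition Gq :: "(('a::{field,finite} poly \<Rightarrow> nat list) \<Rightarrow> int) set" where
  "Gq = {x. finite {lam. x lam \<noteq> 0} \<and> (\<forall>lam. x lam \<noteq> 0 \<longrightarrow> lam \<in> PPhi)}"

definition Gq_add :: "(('a::{field,finite} poly \<Rightarrow> nat list) \<Rightarrow> int) \<Rightarrow> (('a poly \<Rightarrow> nat list) \<Rightarrow> int)
     \<Rightarrow> (('a poly \<Rightarrow> nat list) \<Rightarrow> int)" where
  "Gq_add x y = (\<lambda>lam. x lam + y lam)"

definition Gq_mul :: "(('a::{field,finite} poly \<Rightarrow> nat list) \<Rightarrow> int) \<Rightarrow> (('a poly \<Rightarrow> nat list) \<Rightarrow> int)
     \<Rightarrow> (('a poly \<Rightarrow> nat list) \<Rightarrow> int)" where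
  "Gq_mul x y = (\<lambda>nu. if nu \<in> PPhi then
      (\<Sum>lam\<in>{lam. x lam \<noteq> 0}. \<Sum>mu\<in>{mu. y mu \<noteq> 0}.
         if pnorm nu = pnorm lam + pnorm mu then x lam * y mu * astab nu lam mu else 0)
      else 0)"

definition Gq_one :: "('a::{field,finite} poly \<Rightarrow> nat list) \<Rightarrow> int" where
  "Gq_one = (\<lambda>lam. if lam = emptyp then 1 else 0)"

definition grmap :: "nat \<Rightarrow> (('a::{field,finite} poly \<Rightarrow> nat list) \<Rightarrow> int) \<Rightarrow> (nat \<Rightarrow> 'a grpring)" where
  "grmap n x = (\<lambda>i g. \<Sum>lam\<in>{lam\<in>PPhi. pnorm lam = i}. x lam * Ksum n lam g)"

end

theory Submission
  imports Defs "HOL-Library.Function_Algebras" "HOL-Library.Product_Plus"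
    "HOL-Library.Cardinality" "Jordan_Normal_Form.Determinant"
begin

text \<open>The norm of a modified type is the reflection length: an element \<open>g\<close> of modified type \<open>\<mu>\<close>
  satisfies \<open>\<parallel>\<mu>\<parallel> = rank (g - 1)\<close>, because \<open>\<parallel>\<mu>\<parallel> = n - \<ell>(\<lambda>\<^sup>e)\<close> for the type \<open>\<lambda>\<close> of \<open>g\<close>. Reflection
  length is subadditive. If it is additive on a product \<open>h k\<close>, comparing dimensions forces
  \<open>ker (h k - 1) = ker (h - 1) \<inter> ker (k - 1)\<close> and \<open>im (h k - 1) = im (h - 1) \<oplus> im (k - 1)\<close>. So when
  \<open>h k = K \<oplus> 1\<close>, both factors have the form \<open>h\<^sub>0 \<oplus> 1\<close>, \<open>k\<^sub>0 \<oplus> 1\<close>, and the top structure constants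
  do not depend on \<open>n\<close>.

  That every \<open>g\<close> has exactly one type is the primary rational canonical form. Since \<open>F_q\<close> is finite,
  dimensions are replaced throughout by cardinalities: in a finite \<open>F_q[t]\<close>-module killed by
  \<open>f^(k+1)\<close>, a vector \<open>v\<close> with \<open>f^k v \<noteq> 0\<close> and a linear form \<open>\<phi>\<close> with \<open>\<phi> (f^k v) = 1\<close> yield the
  invariant complement \<open>{w. \<forall>p. \<phi> (p w) = 0}\<close> of the cyclic module of \<open>v\<close>; and the type of \<open>g\<close> is
  recovered from the cardinalities of the kernels of the \<open>f(g)^j\<close>.\<close>

section \<open>Polynomials over a field and finite additive groups\<close>

text \<open>Both halves of the canonical form are indispensable. Existence gives every factor of a
  product a modified type, hence a norm; uniqueness makes the \<open>Ksum n mu\<close> indicator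
  functions of disjoint sets, so that a coefficient can be read off at a single element. A third
  fact is needed because \<open>strc\<close> and \<open>astab\<close> read it at an arbitrarily
  chosen element: for fixed \<open>n\<close> the elements of one modified type are all conjugate.
  The number \<open>pnorm nu + length (epart nu)\<close> is the size of the matrix whose parts at t
  - 1 are those of \<open>epart nu\<close> raised by one, without any part 1. In larger size the
  only freedom is the number of parts 1, and each of them is a 1 x 1 identity block; hence the shape
  K \<oplus> 1 of the representatives.

  The filtration enters pointwise: an element of step i is a function on G_n that depends only on
  the modified type and vanishes for norm above i. Coefficients of excessive norm vanish by
  subadditivity, those of top norm are stable, and the rest are absorbed by step i - 1. Surjectivity
  is a matter of finite support, settled by the fact that norms on G_n are at most n.\<close>

lemma poly_ideal_principal:
  fixes I :: "'a::field poly set"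
  assumes add: "\<And>p q. p \<in> I \<Longrightarrow> q \<in> I \<Longrightarrow> p + q \<in> I"
    and mult: "\<And>p q. q \<in> I \<Longrightarrow> p * q \<in> I"
    and ne: "\<exists>p\<in>I. p \<noteq> 0"
  shows "\<exists>d\<in>I. d \<noteq> 0 \<and> (\<forall>p\<in>I. d dvd p)"
proof -
  define P where "P d \<longleftrightarrow> d \<in> I \<and> d \<noteq> 0" for d
  obtain d where d: "P d" "\<And>p. P p \<Longrightarrow> degree d \<le> degree p"
    using ne ex_has_least_nat[of P _ degree] unfolding P_def by blast
  have "d dvd p" if "p \<in> I" for p
  proof (rule ccontr)
    assume "\<not> d dvd p"
    then have nz: "p mod d \<noteq> 0" by (simp add: dvd_eq_mod_eq_0)
    have "p mod d = p + (- (p div d)) * d"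
      by (simp add: minus_div_mult_eq_mod [symmetric])
    then have "p mod d \<in> I" using d(1) that add mult unfolding P_def by metis
    then have "degree d \<le> degree (p mod d)" using d(2) nz unfolding P_def by blast
    moreover have "degree (p mod d) < degree d"
      using degree_mod_less[of d p] d(1) nz unfolding P_def by auto
    ultimately show False by simp
  qed
  then show ?thesis using d(1) unfolding P_def by blast
qed

lemma irreducible_poly_bezout:
  fixes f p :: "'a::field poly"
  assumes f: "irreducible f" and nd: "\<not> f dvd p"
  shows "\<exists>a b. a * f + b * p = 1"
proof -
  define I where "I = {a * f + b * p | a b. True}"
  have "\<exists>d\<in>I. d \<noteq> 0 \<and> (\<forall>p\<in>I. d dvd p)"
  proof (rule poly_ideal_principal)
    fix u v assume "u \<in> I" "v \<in> I"
    then obtain a b c e where "u = a * f + b * p" "v = c * f + e * p" unfolding I_def by blast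
    then have "u + v = (a + c) * f + (b + e) * p" by (simp add: algebra_simps)
    then show "u + v \<in> I" unfolding I_def by blast
  next
    fix w v assume "v \<in> I"
    then obtain a b where "v = a * f + b * p" unfolding I_def by blast
    then have "w * v = (w * a) * f + (w * b) * p" by (simp add: algebra_simps)
    then show "w * v \<in> I" unfolding I_def by blast
  next
    have "f = 1 * f + 0 * p" by simp
    then have "f \<in> I" unfolding I_def by blast
    moreover have "f \<noteq> 0" using f by auto
    ultimately show "\<exists>p\<in>I. p \<noteq> 0" by blast
  qed
  then obtain d where d: "d \<in> I" "\<And>u. u \<in> I \<Longrightarrow> d dvd u" by blast
  have "f = 1 * f + 0 * p" "p = 0 * f + 1 * p" by simp_all
  then have df: "d dvd f" and dp: "d dvd p" using d(2) unfolding I_def by blast+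
  obtain c where c: "f = d * c" using df by blast
  \<comment> \<open>If \<open>d\<close> were no unit, its cofactor \<open>c\<close> in the
    irreducible \<open>f\<close> would be one, and \<open>f\<close> would divide \<open>d\<close>,
    hence \<open>p\<close>.\<close>
  have "d dvd 1"
  proof (rule ccontr)
    assume nd1: "\<not> d dvd 1"
    then have "c dvd 1" using f c irreducibleD by blast
    then have "f dvd d" using c by (metis dvd_refl mult.right_neutral mult_dvd_mono)
    then show False using dp nd dvd_trans by blast
  qed
  then obtain e where e: "d * e = 1" by (metis dvdE)
  obtain a b where ab: "d = a * f + b * p" using d(1) unfolding I_def by blast
  have "(a * e) * f + (b * e) * p = d * e" unfolding ab by (simp add: algebra_simps)
  then have "(a * e) * f + (b * e) * p = 1" using e by simp
  then show ?thesis by blast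
qed

lemma bezout_power_left:
  fixes f p :: "'a::comm_ring_1"
  assumes "\<exists>a b. a * f + b * p = 1"
  shows "\<exists>a b. a * f ^ k + b * p = 1"
proof (induction k)
  case 0
  have "1 * f ^ 0 + 0 * p = 1" by simp
  then show ?case by blast
next
  case (Suc k)
  then obtain a b where ab: "a * f ^ k + b * p = 1" by blast
  obtain c e where ce: "c * f + e * p = 1" using assms by blast
  have "1 = (c * f + e * p) * (a * f ^ k + b * p)" using ab ce by simp
  also have "\<dots> = (c * a) * f ^ Suc k + (c * f * b + e * (a * f ^ k + b * p)) * p"
    by (simp add: algebra_simps)
  finally show ?case by (intro exI) (rule sym)
qed

lemma bezout_power_both:
  fixes f p :: "'a::comm_ring_1"
  assumes "\<exists>a b. a * f + b * p = 1"
  shows "\<exists>a b. a * f ^ k + b * p ^ l = 1"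
proof -
  have "\<exists>b a. b * p + a * f ^ k = 1"
    using bezout_power_left[OF assms, of k] by (metis add.commute)
  from bezout_power_left[OF this, of l] show ?thesis by (metis add.commute)
qed

text \<open>The ideals of F[t]/(f^(k+1)) form a chain, so every nonzero one contains the class of
  f^k. In the induction step, if the smaller power does not divide \<open>p\<close>, the earlier
  identity is multiplied by \<open>f\<close>; if it does, the cofactor is prime to \<open>f\<close>
  and can be inverted modulo \<open>f\<close>.\<close>

lemma irreducible_power_bezout:
  fixes f p :: "'a::field poly"
  assumes f: "irreducible f" and "\<not> f ^ Suc k dvd p"
  shows "\<exists>a b. b * p = f ^ k + a * f ^ Suc k"
  using assms(2)
proof (induction k)
  case 0
  then obtain a b where "a * f + b * p = 1" using irreducible_poly_bezout[OF f, of p] by auto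
  then have "b * p = f ^ 0 + (- a) * f ^ Suc 0" by (simp add: algebra_simps)
  then show ?case by blast
next
  case (Suc k)
  show ?case
  proof (cases "f ^ Suc k dvd p")
    case False
    then obtain a b where "b * p = f ^ k + a * f ^ Suc k" using Suc.IH by blast
    then have "(f * b) * p = f * (f ^ k + a * f ^ Suc k)" by (simp add: mult.assoc)
    then have "(f * b) * p = f ^ Suc k + a * f ^ Suc (Suc k)"
      by (simp add: algebra_simps)
    then show ?thesis by blast
  next
    case True
    then obtain g where g: "p = f ^ Suc k * g" by blast
    have "\<not> f dvd g"
    proof
      assume "f dvd g"
      then have "f ^ Suc k * f dvd p" unfolding g by (rule mult_dvd_mono[OF dvd_refl])
      then show False using Suc.prems by (simp add: mult.commute mult.assoc)
    qed
    then obtain a b where "a * f + b * g = 1" using irreducible_poly_bezout[OF f] by blast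
    then have bg: "b * g = 1 - a * f" by (simp add: algebra_simps)
    have "b * p = f ^ Suc k * (b * g)" unfolding g by (simp add: ac_simps)
    also have "\<dots> = f ^ Suc k + (- a) * f ^ Suc (Suc k)"
      unfolding bg by (simp add: algebra_simps)
    finally have "b * p = f ^ Suc k + (- a) * f ^ Suc (Suc k)" .
    then show ?thesis by blast
  qed
qed

lemma ex_monic_irreducible_dvd:
  fixes p :: "'a::field poly"
  assumes "degree p > 0"
  shows "\<exists>f. lead_coeff f = 1 \<and> irreducible f \<and> f dvd p"
proof -
  define P where "P d \<longleftrightarrow> d dvd p \<and> degree d > 0" for d
  have "P p" using assms by (simp add: P_def)
  from ex_has_least_nat[of P, OF this, of degree]
  obtain d where d: "P d" "\<And>p. P p \<Longrightarrow> degree d \<le> degree p" by blast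
  have d0: "d \<noteq> 0" "degree d > 0" using d(1) unfolding P_def by auto
  have irr: "irreducible d"
  proof (rule irreducibleI)
    show "d \<noteq> 0" by (fact d0)
    show "\<not> is_unit d" using d0 by (simp add: is_unit_iff_degree)
    fix a b assume ab: "d = a * b"
    then have nz: "a \<noteq> 0" "b \<noteq> 0" using d0 by auto
    then have deg: "degree d = degree a + degree b" using ab by (simp add: degree_mult_eq)
    show "is_unit a \<or> is_unit b"
    proof (rule ccontr)
      assume "\<not> (is_unit a \<or> is_unit b)"
      then have *: "degree a > 0" "degree b > 0" using nz by (auto simp: is_unit_iff_degree)
      have "a dvd p" using ab d(1) unfolding P_def by (metis dvd_mult_left)
      then have "P a" using * unfolding P_def by simp
      then show False using d(2) * deg by fastforce
    qed
  qed
  define c where "c = inverse (lead_coeff d)"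
  have c: "c \<noteq> 0" "c * lead_coeff d = 1" using d0 by (simp_all add: c_def)
  have u: "[:c:] dvd 1" using c(1) by (rule is_unit_triv)
  then have "irreducible ([:c:] * d)" using irr irreducible_mult_unit_left by blast
  moreover have "lead_coeff ([:c:] * d) = 1" using c by simp
  moreover have "[:c:] * d dvd p" using d(1) u unfolding P_def by (simp only: mult_unit_dvd_iff')
  ultimately show ?thesis by blast
qed

lemma poly_extract_power:
  fixes f p :: "'a::field poly"
  assumes "degree f > 0" "p \<noteq> 0"
  shows "\<exists>k g. p = f ^ k * g \<and> \<not> f dvd g"
  using assms(2)
proof (induction "degree p" arbitrary: p rule: less_induct)
  case less
  show ?case
  proof (cases "f dvd p")
    case False
    then have "p = f ^ 0 * p \<and> \<not> f dvd p" by simp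
    then show ?thesis by blast
  next
    case True
    then obtain r where r: "p = f * r" by blast
    then have r0: "r \<noteq> 0" "f \<noteq> 0" using less.prems by auto
    then have "degree r < degree p" using r assms(1) by (simp add: degree_mult_eq)
    then obtain k g where "r = f ^ k * g \<and> \<not> f dvd g" using less.hyps r0 by blast
    then have "p = f ^ Suc k * g \<and> \<not> f dvd g" using r by (simp add: mult.assoc)
    then show ?thesis by blast
  qed
qed

lemma monic_irreducible_dvd_eq:
  fixes f g :: "'a::field poly"
  assumes "irreducible f" "irreducible g" "lead_coeff f = 1" "lead_coeff g = 1" "f dvd g"
  shows "f = g"
proof -
  obtain u where u: "g = f * u" using assms(5) by blast
  have "\<not> is_unit f" using assms(1) irreducible_not_unit by blast
  then have "is_unit u" using u assms(2) irreducibleD by blast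
  then obtain c where c: "u = [:c:]" by (auto simp: is_unit_poly_iff)
  have "lead_coeff g = lead_coeff f * c" unfolding u c by (simp only: lead_coeff_mult) simp
  then have "c = 1" using assms(3,4) by simp
  then show ?thesis using u c by (simp add: one_pCons [symmetric])
qed

text \<open>The bound is put on the coefficients rather than on \<open>degree\<close> so that the
  count is right for \<open>d = 0\<close>, where the set is {0} and not empty.\<close>

lemma card_poly_degree_less:
  "card {p::'a::{zero,finite} poly. \<forall>i\<ge>d. coeff p i = 0} = CARD('a) ^ d"
proof -
  let ?S = "{p::'a poly. \<forall>i\<ge>d. coeff p i = 0}"
  have "bij_betw (\<lambda>p. map (coeff p) [0..<d]) ?S {xs. set xs \<subseteq> (UNIV::'a set) \<and> length xs = d}"
  proof (rule bij_betwI[where g = Poly])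
    show "(\<lambda>p. map (coeff p) [0..<d]) \<in> ?S \<rightarrow> {xs. set xs \<subseteq> UNIV \<and> length xs = d}" by auto
    show "Poly \<in> {xs::'a list. set xs \<subseteq> UNIV \<and> length xs = d} \<rightarrow> ?S"
      by (auto simp: coeff_Poly_eq nth_default_def)
    show "Poly (map (coeff p) [0..<d]) = p" if "p \<in> ?S" for p
      using that by (intro poly_eqI) (auto simp: coeff_Poly_eq nth_default_def)
    show "map (coeff (Poly xs)) [0..<d] = xs"
      if "xs \<in> {xs::'a list. set xs \<subseteq> UNIV \<and> length xs = d}" for xs
      using that by (intro nth_equalityI) (auto simp: coeff_Poly_eq nth_default_def)
  qed
  then have "card ?S = card {xs. set xs \<subseteq> (UNIV::'a set) \<and> length xs = d}"
    by (rule bij_betw_same_card)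
  then show ?thesis using card_lists_length_eq[of "UNIV::'a set" d] by simp
qed

section \<open>Counting in finite additive groups\<close>

definition add_subgroup :: "'v::ab_group_add set \<Rightarrow> bool" where
  "add_subgroup V \<longleftrightarrow> 0 \<in> V \<and> (\<forall>x\<in>V. \<forall>y\<in>V. x - y \<in> V)"

lemma add_subgroup_add: "add_subgroup V \<Longrightarrow> x \<in> V \<Longrightarrow> y \<in> V \<Longrightarrow> x + y \<in> V"
proof -
  assume V: "add_subgroup V" and x: "x \<in> V" and y: "y \<in> V"
  then have "x - (0 - y) \<in> V" unfolding add_subgroup_def by blast
  then show "x + y \<in> V" by simp
qed

text \<open>Rank and nullity in multiplicative form: each fibre of \<open>h\<close> over its image
  is a translate of the kernel.\<close>

lemma card_kernel_image:
  fixes h :: "'v::ab_group_add \<Rightarrow> 'w::ab_group_add"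
  assumes fin: "finite V" and V: "add_subgroup V"
    and h: "\<And>x y. x \<in> V \<Longrightarrow> y \<in> V \<Longrightarrow> h (x - y) = h x - h y"
  shows "card V = card {x\<in>V. h x = 0} * card (h ` V)"
proof -
  have fib: "card {x\<in>V. h x = y} = card {x\<in>V. h x = 0}" if y: "y \<in> h ` V" for y
  proof -
    obtain z where z: "z \<in> V" "y = h z" using y by blast
    have hadd: "h (x + z) = h x + h z" if "x \<in> V" for x
      using h[of "x + z" z] add_subgroup_add[OF V that z(1)] z(1) by (simp add: algebra_simps)
    have "bij_betw (\<lambda>x. x + z) {x\<in>V. h x = 0} {x\<in>V. h x = y}"
    proof (rule bij_betwI[where g = "\<lambda>x. x - z"])
      show "(\<lambda>x. x + z) \<in> {x\<in>V. h x = 0} \<rightarrow> {x\<in>V. h x = y}"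
        using add_subgroup_add[OF V _ z(1)] hadd z by auto
      show "(\<lambda>x. x - z) \<in> {x\<in>V. h x = y} \<rightarrow> {x\<in>V. h x = 0}"
        using V z h unfolding add_subgroup_def by auto
    qed auto
    then show ?thesis by (rule bij_betw_same_card [symmetric])
  qed
  have "V = (\<Union>y\<in>h ` V. {x\<in>V. h x = y})" by auto
  then have "card V = card (\<Union>y\<in>h ` V. {x\<in>V. h x = y})" by (rule arg_cong)
  also have "\<dots> = (\<Sum>y\<in>h ` V. card {x\<in>V. h x = y})"
    by (rule card_UN_disjoint) (use fin in auto)
  also have "\<dots> = card (h ` V) * card {x\<in>V. h x = 0}" using fib by simp
  finally show ?thesis by simp
qed

text \<open>The dimension formula for a sum of two subspaces. It is \<open>card_kernel_image\<close>
  for the addition map on the product, whose kernel consists of the pairs (x, -x) with x in the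
  intersection.\<close>

lemma card_sum_inter:
  fixes U W :: "'v::ab_group_add set"
  assumes "finite U" "finite W" "add_subgroup U" "add_subgroup W"
  shows "card U * card W = card (U \<inter> W) * card {x + y | x y. x \<in> U \<and> y \<in> W}"
proof -
  have "card (U \<times> W) = card {p \<in> U \<times> W. fst p + snd p = 0} * card ((\<lambda>p. fst p + snd p) ` (U \<times> W))"
    by (rule card_kernel_image) (use assms in \<open>auto simp: add_subgroup_def zero_prod_def\<close>)
  moreover have "(\<lambda>p. fst p + snd p) ` (U \<times> W) = {x + y | x y. x \<in> U \<and> y \<in> W}" by force
  moreover have "card {p \<in> U \<times> W. fst p + snd p = 0} = card (U \<inter> W)"
  proof (rule bij_betw_same_card)
    have mU: "- x \<in> U" if "x \<in> U" for x
      using that assms(3) unfolding add_subgroup_def by (metis diff_0)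
    have mW: "- x \<in> W" if "x \<in> W" for x
      using that assms(4) unfolding add_subgroup_def by (metis diff_0)
    show "bij_betw fst {p \<in> U \<times> W. fst p + snd p = 0} (U \<inter> W)"
    proof (rule bij_betwI[where g = "\<lambda>x. (x, - x)"])
      show "fst \<in> {p \<in> U \<times> W. fst p + snd p = 0} \<rightarrow> U \<inter> W"
      proof
        fix p assume p: "p \<in> {p \<in> U \<times> W. fst p + snd p = 0}"
        then have "fst p = - snd p" by (simp add: eq_neg_iff_add_eq_0)
        then show "fst p \<in> U \<inter> W" using p mW[of "snd p"] by auto
      qed
    qed (use mW in \<open>auto simp: eq_neg_iff_add_eq_0 add.commute minus_unique\<close>)
  qed
  ultimately show ?thesis using assms by (simp add: card_cartesian_product)
qed

section \<open>Finite modules over a polynomial ring\<close>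

text \<open>\<open>F_q^n\<close> is modelled by functions vanishing from \<open>n\<close> on, rather than by \<open>'a vec\<close>, so that it sits
  inside one type of class \<open>ab_group_add\<close>, as the library locale for modules requires.\<close>

definition Fn :: "nat \<Rightarrow> (nat \<Rightarrow> 'a::zero) set" where
  "Fn n = {x. \<forall>i\<ge>n. x i = 0}"

lemma finite_Fn: "finite (Fn n :: (nat \<Rightarrow> 'a::{zero,finite}) set)"
  and card_Fn: "card (Fn n :: (nat \<Rightarrow> 'a::{zero,finite}) set) = CARD('a) ^ n"
proof -
  have b: "bij_betw (\<lambda>x. map x [0..<n]) (Fn n) {xs. set xs \<subseteq> (UNIV::'a set) \<and> length xs = n}"
  proof (rule bij_betwI[where g = "\<lambda>xs i. if i < n then xs ! i else 0"])
    show "(\<lambda>x. map x [0..<n]) \<in> Fn n \<rightarrow> {xs. set xs \<subseteq> (UNIV::'a set) \<and> length xs = n}" by auto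
  qed (auto simp: Fn_def fun_eq_iff intro!: nth_equalityI)
  show "finite (Fn n :: (nat \<Rightarrow> 'a) set)"
    using bij_betw_finite[OF b] finite_lists_length_eq[of "UNIV::'a set" n] by simp
  show "card (Fn n :: (nat \<Rightarrow> 'a) set) = CARD('a) ^ n"
    using bij_betw_same_card[OF b] card_lists_length_eq[of "UNIV::'a set" n] by simp
qed

lemma two_le_card_field: "2 \<le> CARD('a::{field,finite})"
proof -
  have "card {0::'a, 1} \<le> CARD('a)" by (intro card_mono) auto
  then show ?thesis by simp
qed

text \<open>The scalars are polynomials, so \<open>subspace\<close> and \<open>span\<close> mean
  F_q[t]-submodule and generated F_q[t]-submodule here. For the module of a matrix these are the
  invariant subspaces.\<close>

locale poly_module = Modules.module sc
  for sc :: "'a::{field,finite} poly \<Rightarrow> 'v::ab_group_add \<Rightarrow> 'v"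
begin

text \<open>The inherited rule fuses nested scalings. Kept apart by \<open>sc_mult\<close>, they
  expose an inner term such as \<open>sc (f ^ k) v\<close> that is known to vanish.\<close>

declare scale_scale [simp del]

lemma sc_mult: "sc (p * q) x = sc p (sc q x)"
  by (simp add: scale_scale)

lemma subspace_kernel: "subspace V \<Longrightarrow> subspace {x\<in>V. sc p x = 0}"
proof -
  assume V: "subspace V"
  have "sc p (sc c x) = 0" if "sc p x = 0" for c x
    using that scale_left_commute[of p c x] by simp
  then show ?thesis
    unfolding subspace_def using subspace_0[OF V] subspace_add[OF V] subspace_scale[OF V]
    by (auto simp: scale_right_distrib)
qed

lemma subspace_imp_add_subgroup: "subspace V \<Longrightarrow> add_subgroup V"
  unfolding add_subgroup_def by (simp add: subspace_0 subspace_diff)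

lemma sc_mod: "sc m v = 0 \<Longrightarrow> sc (p mod m) v = sc p v"
proof -
  assume m: "sc m v = 0"
  have "sc p v = sc (p div m * m + p mod m) v" by simp
  also have "\<dots> = sc (p div m) (sc m v) + sc (p mod m) v"
    by (simp only: scale_left_distrib sc_mult)
  finally show ?thesis using m by simp
qed

text \<open>A finite set has only finitely many self-maps, so two powers of t act alike on
  \<open>V\<close>, and their difference annihilates it.\<close>

lemma ex_annihilator:
  assumes fin: "finite V" and V: "subspace V"
  shows "\<exists>p. p \<noteq> 0 \<and> (\<forall>x\<in>V. sc p x = 0)"
proof -
  let ?h = "\<lambda>i::nat. restrict (sc (monom 1 i)) V"
  have "range ?h \<subseteq> V \<rightarrow>\<^sub>E V" using subspace_scale[OF V] by auto
  moreover have "finite (V \<rightarrow>\<^sub>E V)" using fin by (simp add: finite_PiE)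
  ultimately have "finite (range ?h)" by (rule finite_subset)
  then have "\<not> inj ?h" using finite_imageD infinite_UNIV_nat by blast
  then obtain i j where ij: "i \<noteq> j" "?h i = ?h j" unfolding inj_def by blast
  have "sc (monom 1 i) x = sc (monom 1 j) x" if "x \<in> V" for x
    using fun_cong[OF ij(2), of x] that by simp
  then have "\<forall>x\<in>V. sc (monom 1 i - monom 1 j) x = 0" by (simp add: scale_left_diff_distrib)
  moreover have "monom 1 i - monom (1::'a) j \<noteq> 0"
    using ij(1) by (metis coeff_monom right_minus_eq zero_neq_one)
  ultimately show ?thesis by blast
qed

lemma span_single_image:
  assumes m: "m \<noteq> 0" "sc m v = 0"
  shows "span {v} = (\<lambda>p. sc p v) ` {p. \<forall>i\<ge>degree m. coeff p i = 0}"
proof -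
  have "sc p v \<in> (\<lambda>p. sc p v) ` {p. \<forall>i\<ge>degree m. coeff p i = 0}" for p
  proof (rule image_eqI[where x = "p mod m"])
    show "sc p v = sc (p mod m) v" using sc_mod[OF m(2)] by simp
    have "coeff (p mod m) i = 0" if "i \<ge> degree m" for i
      using degree_mod_less[OF m(1), of p] that by (auto intro: coeff_eq_0)
    then show "p mod m \<in> {p. \<forall>i\<ge>degree m. coeff p i = 0}" by blast
  qed
  then show ?thesis unfolding span_singleton by blast
qed

lemma finite_poly_degree_less: "finite {p::'a poly. \<forall>i\<ge>d. coeff p i = 0}"
  by (rule card_ge_0_finite) (simp add: card_poly_degree_less)

lemma finite_span_single: "m \<noteq> 0 \<Longrightarrow> sc m v = 0 \<Longrightarrow> finite (span {v})"
  by (subst span_single_image) (auto intro: finite_imageI finite_poly_degree_less)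

lemma card_span_single_le:
  assumes m: "m \<noteq> 0" "sc m v = 0"
  shows "card (span {v}) \<le> CARD('a) ^ degree m"
  using card_image_le[OF finite_poly_degree_less[of "degree m"], of "\<lambda>p. sc p v"]
  by (simp add: span_single_image[OF m] card_poly_degree_less)

text \<open>In the cyclic module of \<open>v\<close> every nonzero element has f^k v among its
  multiples: the element f^k v generates the smallest nonzero submodule.\<close>

lemma scale_bezout:
  assumes "irreducible f" "sc (f ^ Suc k) v = 0" "sc p v \<noteq> 0"
  shows "\<exists>b. sc (b * p) v = sc (f ^ k) v"
proof -
  have "\<not> f ^ Suc k dvd p"
  proof
    assume "f ^ Suc k dvd p"
    then obtain c where "p = c * f ^ Suc k" by (metis dvdE mult.commute)
    then have "sc p v = sc c (sc (f ^ Suc k) v)" by (simp only: sc_mult)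
    then show False using assms by simp
  qed
  from irreducible_power_bezout[OF assms(1) this]
  obtain a b where ab: "b * p = f ^ k + a * f ^ Suc k" by blast
  have "sc (b * p) v = sc (f ^ k) v + sc a (sc (f ^ Suc k) v)"
    unfolding ab by (simp only: scale_left_distrib sc_mult)
  then have "sc (b * p) v = sc (f ^ k) v" using assms(2) by simp
  then show ?thesis by blast
qed

text \<open>Were two polynomials of small degree to agree on \<open>v\<close>, their difference
  would kill \<open>v\<close>; but some multiple of it is f^k modulo f^(k+1), and f^k v is not
  zero.\<close>

lemma card_cyclic:
  assumes f: "irreducible f" and v: "sc (f ^ Suc k) v = 0" "sc (f ^ k) v \<noteq> 0"
  shows "card (span {v}) = CARD('a) ^ degree (f ^ Suc k)"
proof -
  let ?P = "{p::'a poly. \<forall>i\<ge>degree (f ^ Suc k). coeff p i = 0}"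
  have m0: "f ^ Suc k \<noteq> 0" using f by auto
  have "inj_on (\<lambda>p. sc p v) ?P"
  proof (rule inj_onI, rule ccontr)
    fix p p' assume p: "p \<in> ?P" "p' \<in> ?P" "sc p v = sc p' v" "p \<noteq> p'"
    define r where "r = p - p'"
    have r: "r \<noteq> 0" "sc r v = 0" using p unfolding r_def by (simp_all add: scale_left_diff_distrib)
    have "coeff r (degree r) \<noteq> 0" using r by simp
    then have deg: "degree r < degree (f ^ Suc k)"
      using p unfolding r_def by (metis (mono_tags, lifting) coeff_diff diff_zero leI mem_Collect_eq)
    have "\<not> f ^ Suc k dvd r" using deg r(1) dvd_imp_degree_le by (metis leD)
    from irreducible_power_bezout[OF f this]
    obtain a b where ab: "b * r = f ^ k + a * f ^ Suc k" by blast
    have "sc (b * r) v = sc (f ^ k) v + sc a (sc (f ^ Suc k) v)"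
      unfolding ab by (simp only: scale_left_distrib sc_mult)
    moreover have "sc (b * r) v = sc b (sc r v)" by (rule sc_mult)
    ultimately show False using v r by simp
  qed
  then show ?thesis
    unfolding span_single_image[OF m0 v(1)] by (subst card_image) (simp_all only: card_poly_degree_less)
qed

text \<open>\<open>W\<close> is the largest submodule inside the kernel of \<open>\<phi>\<close>. It
  meets the cyclic module trivially, since by \<open>scale_bezout\<close> every nonzero element
  there has a multiple on which \<open>\<phi>\<close> is 1. It is large enough because deg f^(k+1)
  linear conditions already cut it out; so the sum has at least as many elements as
  \<open>V\<close>.\<close>

lemma cyclic_complement:
  assumes fin: "finite V" and V: "subspace V" and f: "irreducible f"
    and kill: "\<And>x. x \<in> V \<Longrightarrow> sc (f ^ Suc k) x = 0"
    and v: "v \<in> V" "sc (f ^ k) v \<noteq> 0"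
  shows "\<exists>W. subspace W \<and> W \<subseteq> V \<and> span {v} \<inter> W = {0}
           \<and> V = {x + y | x y. x \<in> span {v} \<and> y \<in> W}"
proof -
  let ?m = "f ^ Suc k"
  let ?u = "sc (f ^ k) v"
  have m0: "?m \<noteq> 0" using f by auto
  \<comment> \<open>The same group as a vector space over F_q, through the constant polynomials.
    Linear forms exist there, and one is chosen with value 1 at f^k v.\<close>
  interpret F: vector_space_pair "\<lambda>c. sc [:c:]" "(*) :: 'a \<Rightarrow> 'a \<Rightarrow> 'a"
  proof unfold_locales
    fix a b :: 'a and x y :: 'v
    show "sc [:a:] (x + y) = sc [:a:] x + sc [:a:] y" by (rule scale_right_distrib)
    show "sc [:a + b:] x = sc [:a:] x + sc [:b:] x"
      using scale_left_distrib[of "[:a:]" "[:b:]" x] by simp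
    show "sc [:a:] (sc [:b:] x) = sc [:a * b:] x" by (simp add: scale_scale ac_simps)
    show "sc [:1:] x = x" using scale_one by (simp add: one_pCons)
  qed (simp_all add: algebra_simps)
  have ind: "F.vs1.independent {?u}" using v(2) F.vs1.independent_insert[of ?u "{}"] by simp
  obtain \<phi> where lin: "Vector_Spaces.linear (\<lambda>c. sc [:c:]) (*) \<phi>" and \<phi>u: "\<phi> ?u = 1"
    using F.linear_independent_extend[OF ind, of "\<lambda>_. 1"] by auto
  interpret L: Vector_Spaces.linear "\<lambda>c. sc [:c:]" "(*)" \<phi> by fact
  define W where "W = {w\<in>V. \<forall>p. \<phi> (sc p w) = 0}"
  have W: "subspace W"
    unfolding subspace_def W_def
    using subspace_0[OF V] subspace_add[OF V] subspace_scale[OF V]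
    by (auto simp: scale_right_distrib L.add simp flip: sc_mult)
  have ZV: "span {v} \<subseteq> V" using v V by (simp add: span_minimal)
  have ZW: "span {v} \<inter> W = {0}"
  proof -
    have "z = 0" if z: "z \<in> span {v}" "z \<in> W" for z
    proof (rule ccontr)
      assume "z \<noteq> 0"
      obtain p where p: "z = sc p v" using z(1) unfolding span_singleton by blast
      obtain b where "sc (b * p) v = ?u"
        using scale_bezout[OF f kill[OF v(1)], of p] p \<open>z \<noteq> 0\<close> by blast
      then have "sc b z = ?u" using p by (simp add: sc_mult)
      then have "\<phi> (sc b z) = 1" using \<phi>u by simp
      then show False using z(2) unfolding W_def by simp
    qed
    then show ?thesis using span_zero subspace_0[OF W] by blast
  qed
  let ?d = "degree ?m"
  \<comment> \<open>The values of \<open>\<phi>\<close> at t^i w for i below \<open>?d\<close>.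
    Since f^(k+1) kills \<open>V\<close>, remainders modulo it suffice, so these finitely many
    values decide membership in \<open>W\<close>.\<close>
  define \<Psi> where "\<Psi> w = (\<lambda>i. if i < ?d then \<phi> (sc (monom 1 i) w) else 0)" for w
  have "\<phi> (sc p w) = 0" if w: "w \<in> V" "\<Psi> w = 0" for w p
  proof -
    define r where "r = p mod ?m"
    have "coeff r i * \<phi> (sc (monom 1 i) w) = 0" for i
    proof (cases "i < ?d")
      case True
      then show ?thesis using fun_cong[OF w(2), of i] unfolding \<Psi>_def by simp
    next
      case False
      then have "coeff r i = 0"
        using degree_mod_less[OF m0, of p] unfolding r_def by (auto intro: coeff_eq_0)
      then show ?thesis by simp
    qed
    then have *: "\<phi> (sc (monom (coeff r i) i) w) = 0" for i
    proof -
      have "monom (coeff r i) i = [:coeff r i:] * monom 1 i" by (simp add: smult_monom)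
      then have "sc (monom (coeff r i) i) w = sc [:coeff r i:] (sc (monom 1 i) w)"
        by (simp only: sc_mult)
      then show ?thesis using \<open>coeff r i * \<phi> (sc (monom 1 i) w) = 0\<close> L.scale by simp
    qed
    have "sc p w = sc r w" unfolding r_def using sc_mod[OF kill[OF w(1)]] by simp
    also have "\<dots> = sc (\<Sum>i\<le>degree r. monom (coeff r i) i) w"
      by (simp add: poly_as_sum_of_monoms)
    also have "\<dots> = (\<Sum>i\<le>degree r. sc (monom (coeff r i) i) w)" by (rule scale_sum_left)
    finally show ?thesis using * by (simp add: L.sum)
  qed
  moreover have "\<Psi> w = 0" if "\<And>p. \<phi> (sc p w) = 0" for w
    using that unfolding \<Psi>_def by (simp add: fun_eq_iff)
  ultimately have ker: "{w\<in>V. \<Psi> w = 0} = W" unfolding W_def by blast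
  have "\<Psi> ` V \<subseteq> Fn ?d" unfolding \<Psi>_def Fn_def by auto
  then have im: "card (\<Psi> ` V) \<le> CARD('a) ^ ?d"
    using card_mono[OF finite_Fn] card_Fn by metis
  have "card V = card {w\<in>V. \<Psi> w = 0} * card (\<Psi> ` V)"
  proof (rule card_kernel_image[OF fin subspace_imp_add_subgroup[OF V]])
    show "\<Psi> (x - y) = \<Psi> x - \<Psi> y" for x y
      unfolding \<Psi>_def by (simp add: fun_eq_iff scale_right_diff_distrib L.diff)
  qed
  then have le: "card V \<le> card W * CARD('a) ^ ?d" unfolding ker using im by simp
  let ?S = "{x + y | x y. x \<in> span {v} \<and> y \<in> W}"
  have finW: "finite W" using fin unfolding W_def by simp
  have "card (span {v}) * card W = card (span {v} \<inter> W) * card ?S"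
    by (rule card_sum_inter)
      (use finW finite_subset[OF ZV fin] subspace_imp_add_subgroup W subspace_span in auto)
  then have "card ?S = CARD('a) ^ ?d * card W"
    using card_cyclic[OF f kill[OF v(1)] v(2)] ZW by simp
  then have "card V \<le> card ?S" using le by (simp add: mult.commute)
  moreover have SV: "?S \<subseteq> V" using ZV subspace_add[OF V] unfolding W_def by blast
  ultimately have "?S = V" by (intro card_subset_eq[OF fin SV] le_antisym card_mono[OF fin SV])
  moreover have "W \<subseteq> V" unfolding W_def by blast
  ultimately show ?thesis using W ZW by blast
qed

text \<open>Directness of the sum is recorded by the cardinality alone: the generators span, and
  \<open>V\<close> is as large as the orders f^k allow. The induction on \<open>card V\<close>
  splits off either a coprime factor of the minimal polynomial or, in the primary case, one cyclic
  module with the complement from \<open>cyclic_complement\<close>. The hypothesis on t keeps t out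
  of the list.\<close>

theorem cyclic_decomposition:
  assumes "finite V" "subspace V" "\<And>x. x \<in> V \<Longrightarrow> sc [:0, 1:] x = 0 \<Longrightarrow> x = 0"
  shows "\<exists>L. (\<forall>(v, f, k)\<in>set L. f \<in> Phi \<and> 0 < k \<and> sc (f ^ k) v = 0)
    \<and> span (fst ` set L) = V \<and> card V = CARD('a) ^ (\<Sum>(v, f, k)\<leftarrow>L. degree f * k)"
  using assms
proof (induction "card V" arbitrary: V rule: less_induct)
  case less
  note fin = less.prems(1) and V = less.prems(2) and inj = less.prems(3)
  let ?Q = "\<lambda>V L. (\<forall>(v, f, k)\<in>set L. f \<in> Phi \<and> 0 < k \<and> sc (f ^ k) v = 0)
    \<and> span (fst ` set L) = V \<and> card V = CARD('a) ^ (\<Sum>(v, f, k)\<leftarrow>L. degree f * k)"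
  have combine: "?Q V (L1 @ L2)"
    if Q: "?Q U L1" "?Q W L2" and S: "subspace U" "subspace W" "U \<subseteq> V" "W \<subseteq> V" "U \<inter> W = {0}"
      and eq: "V = {x + y | x y. x \<in> U \<and> y \<in> W}" for U W L1 L2
  proof -
    have "card U * card W = card (U \<inter> W) * card {x + y | x y. x \<in> U \<and> y \<in> W}"
      by (rule card_sum_inter) (use S fin finite_subset subspace_imp_add_subgroup in auto)
    then have c: "card U * card W = card V" using S(5) eq by simp
    have "span (fst ` set (L1 @ L2)) = {x + y | x y. x \<in> U \<and> y \<in> W}"
      using Q by (simp add: image_Un span_Un)
    then have "span (fst ` set (L1 @ L2)) = V" using eq by blast
    moreover have "card V = CARD('a) ^ (\<Sum>(v, f, k)\<leftarrow>L1 @ L2. degree f * k)"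
      using Q c by (simp add: power_add)
    ultimately show ?thesis using Q by (auto simp del: set_append simp add: set_append)
  qed
  show ?case
  proof (cases "V = {0}")
    case True
    then have "?Q V []" by simp
    then show ?thesis by blast
  next
    case False
    then obtain x0 where x0: "x0 \<in> V" "x0 \<noteq> 0" using subspace_0[OF V] by blast
    \<comment> \<open>The generator \<open>d\<close> of the annihilator ideal is the minimal
      polynomial of t on \<open>V\<close>, up to a unit.\<close>
    have "\<exists>d\<in>{p. \<forall>x\<in>V. sc p x = 0}. d \<noteq> 0 \<and> (\<forall>p\<in>{p. \<forall>x\<in>V. sc p x = 0}. d dvd p)"
      using ex_annihilator[OF fin V]
      by (intro poly_ideal_principal) (auto simp: scale_left_distrib simp add: sc_mult)
    then obtain d where d: "d \<noteq> 0" "\<And>x. x \<in> V \<Longrightarrow> sc d x = 0"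
      and dmin: "\<And>p. (\<And>x. x \<in> V \<Longrightarrow> sc p x = 0) \<Longrightarrow> d dvd p" by blast
    have "degree d > 0"
    proof (rule ccontr)
      assume "\<not> degree d > 0"
      then have "d dvd 1" using d(1) is_unit_iff_degree by blast
      then obtain e where "1 = e * d" by (metis dvdE mult.commute)
      then have "x0 = sc e (sc d x0)" by (metis sc_mult scale_one)
      then show False using d(2)[OF x0(1)] x0(2) by simp
    qed
    then obtain f where f: "lead_coeff f = 1" "irreducible f" "f dvd d"
      using ex_monic_irreducible_dvd by blast
    have f0: "f \<noteq> 0" "degree f > 0" using f(2) by (auto simp: irreducible_def is_unit_iff_degree)
    obtain k g where kg: "d = f ^ k * g" "\<not> f dvd g" using poly_extract_power[OF f0(2) d(1)] by blast
    have k0: "k > 0" using kg f(3) by (cases k) auto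
    have g0: "g \<noteq> 0" using kg d by auto
    show ?thesis
    proof (cases "degree g > 0")
      case True
      \<comment> \<open>With coprime factors, \<open>V\<close> is the direct sum of the kernels of
        f^k and \<open>g\<close>. Both are proper, since neither factor alone is divisible by the
        minimal polynomial.\<close>
      define U where "U = {x\<in>V. sc (f ^ k) x = 0}"
      define W where "W = {x\<in>V. sc g x = 0}"
      have SU: "subspace U" and SW: "subspace W"
        unfolding U_def W_def using subspace_kernel[OF V] by blast+
      have sub: "U \<subseteq> V" "W \<subseteq> V" unfolding U_def W_def by auto
      have degd: "degree d = k * degree f + degree g"
        using kg f0 g0 by (simp add: degree_mult_eq degree_power_eq)
      have "U \<noteq> V"
      proof
        assume "U = V"
        then have "d dvd f ^ k" using dmin unfolding U_def by blast
        then have "degree d \<le> degree (f ^ k)" using f0 by (intro dvd_imp_degree_le) auto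
        then show False using degd True f0 by (simp add: degree_power_eq)
      qed
      then have cU: "card U < card V" using sub fin by (intro psubset_card_mono) auto
      have "W \<noteq> V"
      proof
        assume "W = V"
        then have "d dvd g" using dmin unfolding W_def by blast
        then have "degree d \<le> degree g" using g0 by (intro dvd_imp_degree_le) auto
        then show False using degd k0 f0 by simp
      qed
      then have cW: "card W < card V" using sub fin by (intro psubset_card_mono) auto
      obtain a b where ab: "a * f ^ k + b * g = 1"
        using bezout_power_left[OF irreducible_poly_bezout[OF f(2) kg(2)]] by blast
      have split: "x = sc (b * g) x + sc (a * f ^ k) x" for x
        using ab by (metis add.commute scale_left_distrib scale_one)
      have int: "U \<inter> W = {0}"
      proof -
        have "x = 0" if "x \<in> U" "x \<in> W" for x
          using split[of x] that unfolding U_def W_def by (simp add: sc_mult)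
        then show ?thesis using subspace_0 SU SW by blast
      qed
      have eq: "V = {x + y | x y. x \<in> U \<and> y \<in> W}"
      proof (intro equalityI subsetI)
        fix x assume x: "x \<in> V"
        have "sc (f ^ k) (sc (b * g) x) = sc b (sc d x)" unfolding kg(1) by (simp add: scale_scale ac_simps)
        moreover have "sc g (sc (a * f ^ k) x) = sc a (sc d x)" unfolding kg(1) by (simp add: scale_scale ac_simps)
        ultimately have "sc (b * g) x \<in> U" "sc (a * f ^ k) x \<in> W"
          unfolding U_def W_def using x d(2)[OF x] subspace_scale[OF V x] by simp_all
        then show "x \<in> {x + y | x y. x \<in> U \<and> y \<in> W}" using split[of x] by blast
      next
        fix x assume "x \<in> {x + y | x y. x \<in> U \<and> y \<in> W}"
        then show "x \<in> V" using sub subspace_add[OF V] by blast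
      qed
      obtain L1 where L1: "?Q U L1"
        using less.hyps[OF cU finite_subset[OF sub(1) fin] SU] inj sub by blast
      obtain L2 where L2: "?Q W L2"
        using less.hyps[OF cW finite_subset[OF sub(2) fin] SW] inj sub by blast
      from combine[OF L1 L2 SU SW sub int eq] show ?thesis by blast
    next
      case False
      then have "g dvd 1" using g0 is_unit_iff_degree by blast
      then obtain e where e: "1 = g * e" by blast
      \<comment> \<open>Here \<open>d\<close> is f^k up to a unit, so by minimality some
        \<open>v\<close> has the full order f^k and \<open>cyclic_complement\<close> applies to
        it.\<close>
      obtain k' where k': "k = Suc k'" using k0 by (cases k) auto
      have kill: "sc (f ^ Suc k') x = 0" if "x \<in> V" for x
      proof -
        have "f ^ Suc k' = e * d" unfolding kg(1) k' using e
          by (metis mult.assoc mult.commute mult.right_neutral)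
        then have "sc (f ^ Suc k') x = sc e (sc d x)" by (simp only: sc_mult)
        then show ?thesis using d(2)[OF that] by simp
      qed
      have "\<exists>v\<in>V. sc (f ^ k') v \<noteq> 0"
      proof (rule ccontr)
        assume "\<not> ?thesis"
        then have "d dvd f ^ k'" using dmin by blast
        then have "degree d \<le> degree (f ^ k')" using f0 by (intro dvd_imp_degree_le) auto
        then show False using kg f0 g0 k' by (simp add: degree_mult_eq degree_power_eq)
      qed
      then obtain v where v: "v \<in> V" "sc (f ^ k') v \<noteq> 0" by blast
      have ft: "f \<noteq> [:0, 1:]"
      proof
        assume "f = [:0, 1:]"
        then have "sc [:0, 1:] (sc (f ^ k') v) = 0" using kill[OF v(1)] by (metis power_Suc sc_mult)
        then show False using inj[of "sc (f ^ k') v"] subspace_scale[OF V v(1)] v(2) by blast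
      qed
      obtain W where W: "subspace W" "W \<subseteq> V" "span {v} \<inter> W = {0}"
        "V = {x + y | x y. x \<in> span {v} \<and> y \<in> W}"
        using cyclic_complement[OF fin V f(2) kill v] by blast
      have "v \<in> span {v}" by (simp add: span_base)
      moreover have "v \<noteq> 0" using v(2) by auto
      ultimately have "v \<notin> W" using W(3) by blast
      then have cW: "card W < card V" using W(2) v(1) fin by (intro psubset_card_mono) auto
      obtain L2 where L2: "?Q W L2"
        using less.hyps[OF cW finite_subset[OF W(2) fin] W(1)] inj W(2) by blast
      have L1: "?Q (span {v}) [(v, f, Suc k')]"
        using f ft kill[OF v(1)] card_cyclic[OF f(2) kill[OF v(1)] v(2)] f0
        unfolding Phi_def by (simp add: degree_power_eq degree_mult_eq algebra_simps)
      have "span {v} \<subseteq> V" using v V by (simp add: span_minimal)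
      from combine[OF L1 L2 _ W(1) this W(2-4)] show ?thesis by blast
    qed
  qed
qed

text \<open>Modulo g^k the power f^j is invertible by Bezout, so it acts injectively on a module
  killed by g^k.\<close>

lemma kernel_cyclic_other:
  assumes v: "sc (g ^ k) v = 0" and fg: "\<exists>a b. a * f + b * g = 1"
  shows "{x\<in>span {v}. sc (f ^ j) x = 0} = {0}"
proof -
  obtain a b where ab: "a * f ^ j + b * g ^ k = 1" using bezout_power_both[OF fg] by blast
  have "x = 0" if x: "x \<in> span {v}" "sc (f ^ j) x = 0" for x
  proof -
    obtain p where p: "x = sc p v" using x(1) unfolding span_singleton by blast
    have "sc (g ^ k) x = sc p (sc (g ^ k) v)" unfolding p by (rule scale_left_commute)
    then have "sc (g ^ k) x = 0" using v by simp
    moreover have "x = sc a (sc (f ^ j) x) + sc b (sc (g ^ k) x)"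
      using ab by (metis scale_left_distrib scale_one sc_mult)
    ultimately show "x = 0" using x(2) by simp
  qed
  then show ?thesis using span_zero by auto
qed

text \<open>The cardinality hypothesis says that f^k is the exact order of \<open>v\<close>. For j <
  k, the upper bound holds because the kernel lies in the module generated by f^(k-j) v, which f^j
  kills; the lower bound follows from \<open>card_kernel_image\<close>, because the image of f^j is
  cyclic and killed by f^(k-j).\<close>

lemma card_kernel_cyclic_same:
  assumes f: "f \<noteq> 0" and v: "sc (f ^ k) v = 0"
    and c: "card (span {v}) = CARD('a) ^ (degree f * k)"
  shows "card {x\<in>span {v}. sc (f ^ j) x = 0} = CARD('a) ^ (degree f * min k j)"
proof (cases "k \<le> j")
  case True
  have "sc (f ^ j) x = 0" if x: "x \<in> span {v}" for x
  proof -
    obtain p where p: "x = sc p v" using x unfolding span_singleton by blast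
    have "f ^ j = f ^ (j - k) * f ^ k" using True by (simp flip: power_add)
    then have "sc (f ^ j) x = sc p (sc (f ^ (j - k)) (sc (f ^ k) v))"
      unfolding p by (simp add: scale_scale ac_simps)
    then show ?thesis using v by simp
  qed
  then have "{x\<in>span {v}. sc (f ^ j) x = 0} = span {v}" by blast
  then show ?thesis using c True by (simp add: min_absorb1)
next
  case False
  then have jk: "j \<le> k" "f ^ k = f ^ (k - j) * f ^ j" by (simp_all flip: power_add)
  let ?d = "degree f"
  let ?K = "{x\<in>span {v}. sc (f ^ j) x = 0}"
  have fk: "f ^ i \<noteq> 0" "degree (f ^ i) = ?d * i" for i using f by (simp_all add: degree_power_eq)
  have fin: "finite (span {v})" using finite_span_single[OF fk(1) v] .
  have "inj_on (\<lambda>p. sc p v) {p. \<forall>i\<ge>degree (f ^ k). coeff p i = 0}"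
    by (rule eq_card_imp_inj_on[OF finite_poly_degree_less])
      (use c span_single_image[OF fk(1) v] in \<open>simp add: card_poly_degree_less fk(2)\<close>)
  then have dvd: "f ^ k dvd p" if p: "sc p v = 0" for p
  proof -
    have "coeff (p mod f ^ k) i = 0" if "i \<ge> degree (f ^ k)" for i
      using degree_mod_less[OF fk(1), of p k] that by (auto intro: coeff_eq_0)
    moreover have "sc (p mod f ^ k) v = sc 0 v" using sc_mod[OF v] p by simp
    ultimately have "p mod f ^ k = 0"
      using inj_onD[OF \<open>inj_on _ _\<close>, of "p mod f ^ k" 0] by simp
    then show ?thesis by (simp add: dvd_eq_mod_eq_0)
  qed
  have "?K \<subseteq> span {sc (f ^ (k - j)) v}"
  proof
    fix x assume x: "x \<in> ?K"
    then obtain p where p: "x = sc p v" unfolding span_singleton by blast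
    then have "sc (f ^ j * p) v = 0" using x by (simp add: sc_mult)
    then have "f ^ j * f ^ (k - j) dvd f ^ j * p" using dvd jk by (simp add: mult.commute)
    then have "f ^ (k - j) dvd p" using fk(1)[of j] by (metis dvd_mult_cancel_left)
    then obtain r where "p = r * f ^ (k - j)" by (metis dvdE mult.commute)
    then have "x = sc r (sc (f ^ (k - j)) v)" using p by (simp add: sc_mult)
    then show "x \<in> span {sc (f ^ (k - j)) v}" unfolding span_singleton by blast
  qed
  moreover have kill: "sc (f ^ j) (sc (f ^ (k - j)) v) = 0" using v jk by (simp add: scale_scale mult.commute)
  ultimately have "card ?K \<le> CARD('a) ^ (?d * j)"
    using card_span_single_le[OF fk(1) kill, unfolded fk(2)]
      card_mono[OF finite_span_single[OF fk(1) kill], of ?K] by linarith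
  moreover have "CARD('a) ^ (?d * j) \<le> card ?K"
  proof -
    have kill': "sc (f ^ (k - j)) (sc (f ^ j) v) = 0" using v jk by (simp add: scale_scale)
    have "card (span {v}) = card ?K * card (sc (f ^ j) ` span {v})"
      by (rule card_kernel_image[OF fin subspace_imp_add_subgroup[OF subspace_span]])
        (rule scale_right_diff_distrib)
    moreover have "sc (f ^ j) ` span {v} = span {sc (f ^ j) v}"
      unfolding span_singleton by (auto simp: image_iff intro: scale_left_commute)
    then have "card (sc (f ^ j) ` span {v}) \<le> CARD('a) ^ (?d * (k - j))"
      using card_span_single_le[OF fk(1) kill', unfolded fk(2)] by simp
    ultimately have "CARD('a) ^ (?d * k) \<le> card ?K * CARD('a) ^ (?d * (k - j))"
      using c by simp
    moreover have "?d * k = ?d * j + ?d * (k - j)" using jk by (simp flip: distrib_left)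
    ultimately show ?thesis by (simp add: power_add)
  qed
  ultimately show ?thesis using jk by (simp add: min_absorb2)
qed

end

section \<open>The module of a matrix\<close>

definition mact :: "'a::comm_ring_1 mat \<Rightarrow> (nat \<Rightarrow> 'a) \<Rightarrow> nat \<Rightarrow> 'a" where
  "mact A x = (\<lambda>i. if i < dim_row A then \<Sum>j<dim_col A. A $$ (i, j) * x j else 0)"

text \<open>Horner evaluation of \<open>p\<close> at \<open>A\<close>, applied to \<open>x\<close>.
  Constants scale all coordinates, also those beyond the size of \<open>A\<close>, so that the
  module axioms hold on the whole type and not only on \<open>Fn n\<close>.\<close>

definition pact :: "'a::comm_ring_1 mat \<Rightarrow> 'a poly \<Rightarrow> (nat \<Rightarrow> 'a) \<Rightarrow> nat \<Rightarrow> 'a" where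
  "pact A p x = fold_coeffs (\<lambda>a y. (\<lambda>i. a * x i) + mact A y) p 0"

lemma mact_add: "mact A (x + y) = mact A x + mact A y"
  by (simp add: mact_def fun_eq_iff distrib_left sum.distrib)

lemma mact_scale: "mact A (\<lambda>i. a * x i) = (\<lambda>i. a * mact A x i)"
  by (simp add: mact_def fun_eq_iff sum_distrib_left mult.left_commute)

lemma mact_zero [simp]: "mact A 0 = 0"
  by (simp add: mact_def fun_eq_iff)

lemma mact_diff: "mact A (x - y) = mact A x - mact A y"
  by (simp add: mact_def fun_eq_iff right_diff_distrib sum_subtractf)

lemma mact_in_Fn: "A \<in> carrier_mat n m \<Longrightarrow> mact A x \<in> Fn n"
  by (simp add: mact_def Fn_def)

lemma mact_mult:
  assumes "A \<in> carrier_mat n m" "B \<in> carrier_mat m k"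
  shows "mact (A * B) x = mact A (mact B x)"
proof
  fix i
  show "mact (A * B) x i = mact A (mact B x) i"
  proof (cases "i < n")
    case True
    have "(A * B) $$ (i, j) = (\<Sum>l<m. A $$ (i, l) * B $$ (l, j))" if "j < k" for j
      using assms that True by (simp add: scalar_prod_def atLeast0LessThan)
    then have "mact (A * B) x i = (\<Sum>j<k. \<Sum>l<m. A $$ (i, l) * (B $$ (l, j) * x j))"
      using assms True by (simp add: mact_def sum_distrib_right mult.assoc)
    also have "\<dots> = (\<Sum>l<m. \<Sum>j<k. A $$ (i, l) * (B $$ (l, j) * x j))" by (rule sum.swap)
    also have "\<dots> = mact A (mact B x) i"
      using assms True by (simp add: mact_def sum_distrib_left)
    finally show ?thesis .
  qed (use assms in \<open>simp add: mact_def\<close>)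
qed

lemma mact_one: "x \<in> Fn n \<Longrightarrow> mact (1\<^sub>m n) x = x"
proof
  fix i assume x: "x \<in> Fn n"
  have "(\<Sum>j<n. (1\<^sub>m n) $$ (i, j) * x j) = (\<Sum>j<n. if j = i then x j else 0)" if "i < n"
    using that by (intro sum.cong) auto
  then show "mact (1\<^sub>m n) x i = x i" using x by (auto simp: mact_def Fn_def)
qed

definition unit_fun :: "nat \<Rightarrow> nat \<Rightarrow> 'a::zero_neq_one" where
  "unit_fun j = (\<lambda>i. if i = j then 1 else 0)"

lemma mact_unit_fun:
  "A \<in> carrier_mat n m \<Longrightarrow> j < m \<Longrightarrow> mact A (unit_fun j) = (\<lambda>i. if i < n then A $$ (i, j) else 0)"
proof
  fix i assume A: "A \<in> carrier_mat n m" "j < m"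
  have "(\<Sum>l<m. A $$ (i, l) * unit_fun j l) = (\<Sum>l<m. if l = j then A $$ (i, l) else 0)"
    by (intro sum.cong) (auto simp: unit_fun_def)
  then show "mact A (unit_fun j) i = (if i < n then A $$ (i, j) else 0)"
    using A by (simp add: mact_def)
qed

lemma pact_pCons: "pact A (pCons a p) x = (\<lambda>i. a * x i) + mact A (pact A p x)"
proof (cases "a = 0 \<and> p = 0")
  case True
  then show ?thesis by (simp add: pact_def fun_eq_iff)
next
  case False
  then show ?thesis by (auto simp: pact_def fold_coeffs_pCons_coeff_not_0_eq fold_coeffs_pCons_not_0_0_eq)
qed

lemma pact_zero [simp]: "pact A 0 x = 0"
  by (simp add: pact_def)

lemma pact_smult: "pact A (Polynomial.smult a p) x = (\<lambda>i. a * pact A p x i)"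
proof (induction p)
  case (pCons b p)
  then show ?case by (simp add: pact_pCons mact_scale) (simp add: fun_eq_iff algebra_simps)
qed (simp add: fun_eq_iff)

lemma pact_add_left: "pact A (p + q) x = pact A p x + pact A q x"
proof (induction p q rule: poly_induct2)
  case (pCons a p b q)
  have "mact A (pact A (p + q) x) = mact A (pact A p x) + mact A (pact A q x)"
    by (simp only: pCons.IH mact_add)
  then show ?case by (simp only: pact_pCons add_pCons) (simp add: fun_eq_iff algebra_simps)
qed simp

lemma pact_add_right: "pact A p (x + y) = pact A p x + pact A p y"
proof (induction p)
  case (pCons b p)
  have "mact A (pact A p (x + y)) = mact A (pact A p x) + mact A (pact A p y)"
    by (simp only: pCons.IH mact_add)
  then show ?case by (simp only: pact_pCons) (simp add: fun_eq_iff algebra_simps)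
qed simp

lemma pact_mult: "pact A (p * q) x = pact A p (pact A q x)"
proof (induction p)
  case (pCons b p)
  then show ?case by (simp add: mult_pCons_left pact_add_left pact_smult pact_pCons)
qed simp

lemma poly_module_pact: "poly_module (pact (A :: 'a::{field,finite} mat))"
proof unfold_locales
  show "pact A 1 x = x" for x
    by (simp add: one_pCons pact_pCons fun_eq_iff)
qed (simp_all add: pact_add_left pact_add_right pact_mult)

lemma pact_in_Fn:
  assumes "A \<in> carrier_mat n n" "x \<in> Fn n"
  shows "pact A p x \<in> Fn n"
proof (induction p)
  case (pCons b p)
  have "mact A (pact A p x) \<in> Fn n" using assms by (intro mact_in_Fn)
  then show ?case using assms by (simp add: pact_pCons Fn_def)
qed (simp add: Fn_def)

lemma pact_intertwine:
  assumes "\<And>x. mact P (mact B x) = mact A (mact P x)"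
  shows "pact A p (mact P x) = mact P (pact B p x)"
proof (induction p)
  case (pCons b p)
  then show ?case by (simp only: pact_pCons mact_add mact_scale assms)
qed (simp only: pact_zero mact_zero)

lemma subspace_Fn:
  fixes A :: "'a::{field,finite} mat"
  assumes "A \<in> carrier_mat n n"
  shows "Modules.module.subspace (pact A) (Fn n)"
proof -
  interpret poly_module "pact A" by (rule poly_module_pact)
  show ?thesis unfolding subspace_def using pact_in_Fn[OF assms] by (auto simp: Fn_def)
qed

text \<open>The similarity invariant from which \<open>has_type_unique\<close> recovers the
  type.\<close>

definition ker_card :: "'a::comm_ring_1 mat \<Rightarrow> 'a poly \<Rightarrow> nat" where
  "ker_card A p = card {x \<in> Fn (dim_row A). pact A p x = 0}"

lemma similar_mat_intertwiner:
  assumes "similar_mat A B" "A \<in> carrier_mat n n"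
  obtains P Q where "P \<in> carrier_mat n n" "Q \<in> carrier_mat n n" "B \<in> carrier_mat n n"
    "P * Q = 1\<^sub>m n" "Q * P = 1\<^sub>m n" "A * P = P * B" "Q * A = B * Q" "A = P * B * Q"
proof -
  obtain P Q where "similar_mat_wit A B P Q" using assms(1) unfolding similar_mat_def by blast
  from similar_mat_witD2[OF assms(2) this]
  have *: "P * Q = 1\<^sub>m n" "Q * P = 1\<^sub>m n" "A = P * B * Q" "B \<in> carrier_mat n n"
    "P \<in> carrier_mat n n" "Q \<in> carrier_mat n n" by auto
  have "A * P = P * B * (Q * P)" using * by (simp add: assoc_mult_mat[of _ n n _ n _ n])
  then have 1: "A * P = P * B" using * by simp
  have "Q * A = Q * (P * (B * Q))" using * by (simp add: assoc_mult_mat[of _ n n _ n _ n])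
  also have "\<dots> = (Q * P) * (B * Q)"
    by (rule assoc_mult_mat[symmetric, of _ n n _ n _ n]) (use * in auto)
  finally have "Q * A = B * Q" using * by simp
  with 1 * that show ?thesis by blast
qed

lemma ker_card_similar:
  assumes "similar_mat A B"
  shows "ker_card A p = ker_card B p"
proof -
  define n where "n = dim_row A"
  have A: "A \<in> carrier_mat n n" using similar_matD[OF assms] n_def by auto
  obtain P Q where PQ: "P \<in> carrier_mat n n" "Q \<in> carrier_mat n n" "B \<in> carrier_mat n n"
    "P * Q = 1\<^sub>m n" "Q * P = 1\<^sub>m n" "A * P = P * B" "Q * A = B * Q"
    using similar_mat_intertwiner[OF assms A] by metis
  have P: "pact A p (mact P x) = mact P (pact B p x)" for x
    by (rule pact_intertwine) (use PQ A in \<open>simp flip: mact_mult\<close>)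
  have Q: "pact B p (mact Q x) = mact Q (pact A p x)" for x
    by (rule pact_intertwine) (use PQ A in \<open>simp flip: mact_mult\<close>)
  have inv: "mact P (mact Q x) = x" "mact Q (mact P x) = x" if "x \<in> Fn n" for x
    using PQ that by (simp_all flip: mact_mult add: mact_one)
  have "bij_betw (mact Q) {x \<in> Fn n. pact A p x = 0} {x \<in> Fn n. pact B p x = 0}"
    by (rule bij_betwI[where g = "mact P"])
      (use P Q inv PQ mact_in_Fn in auto)
  then show ?thesis
    using A PQ(3) unfolding ker_card_def by (simp add: bij_betw_same_card)
qed

section \<open>Block diagonal sums and their modules\<close>

definition diag_sum :: "'a::zero mat \<Rightarrow> 'a mat \<Rightarrow> 'a mat" where
  "diag_sum A B = four_block_mat A (0\<^sub>m (dim_row A) (dim_col B)) (0\<^sub>m (dim_row B) (dim_col A)) B"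

lemma blockdiag_Cons [simp]: "blockdiag (A # As) = diag_sum A (blockdiag As)"
  by (simp add: diag_sum_def)

declare blockdiag.simps(2) [simp del]

lemma diag_sum_carrier:
  "A \<in> carrier_mat n n \<Longrightarrow> B \<in> carrier_mat m m \<Longrightarrow> diag_sum A B \<in> carrier_mat (n + m) (n + m)"
  by (simp add: diag_sum_def)

lemma diag_sum_index:
  assumes "A \<in> carrier_mat n n" "B \<in> carrier_mat m m" "i < n + m" "j < n + m"
  shows "diag_sum A B $$ (i, j) = (if i < n then if j < n then A $$ (i, j) else 0
    else if j < n then 0 else B $$ (i - n, j - n))"
  using assms by (auto simp: diag_sum_def)

definition join :: "nat \<Rightarrow> (nat \<Rightarrow> 'a) \<Rightarrow> (nat \<Rightarrow> 'a) \<Rightarrow> nat \<Rightarrow> 'a" where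
  "join n x y = (\<lambda>i. if i < n then x i else y (i - n))"

lemma sum_lessThan_add:
  fixes f :: "nat \<Rightarrow> 'b::comm_monoid_add"
  shows "(\<Sum>j<n + m. f j) = (\<Sum>j<n. f j) + (\<Sum>j<m. f (n + j))"
proof -
  have "(\<Sum>j<n + m. f j) = (\<Sum>j<n. f j) + (\<Sum>j=n..<n + m. f j)"
    using sum.atLeastLessThan_concat[of 0 n "n + m" f] by (simp add: atLeast0LessThan)
  also have "(\<Sum>j=n..<n + m. f j) = (\<Sum>j<m. f (n + j))"
    using sum.shift_bounds_nat_ivl[of f 0 n m] by (simp add: atLeast0LessThan add.commute)
  finally show ?thesis .
qed

lemma mact_diag_sum:
  assumes "A \<in> carrier_mat n n" "B \<in> carrier_mat m m"
  shows "mact (diag_sum A B) (join n x y) = join n (mact A x) (mact B y)"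
proof
  fix i
  show "mact (diag_sum A B) (join n x y) i = join n (mact A x) (mact B y) i"
  proof (cases "i < n + m")
    case True
    have "(\<Sum>j<n. diag_sum A B $$ (i, j) * join n x y j) = (\<Sum>j<n. if i < n then A $$ (i, j) * x j else 0)"
      using True by (intro sum.cong) (auto simp: diag_sum_index[OF assms] join_def)
    moreover have "(\<Sum>j<m. diag_sum A B $$ (i, n + j) * join n x y (n + j))
        = (\<Sum>j<m. if i < n then 0 else B $$ (i - n, j) * y j)"
      using True by (intro sum.cong) (auto simp: diag_sum_index[OF assms] join_def)
    ultimately show ?thesis
      using assms True diag_sum_carrier[OF assms]
      by (auto simp: mact_def sum_lessThan_add join_def)
  next
    case False
    then show ?thesis using assms diag_sum_carrier[OF assms] by (auto simp: mact_def join_def)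
  qed
qed

lemma pact_diag_sum:
  assumes "A \<in> carrier_mat n n" "B \<in> carrier_mat m m"
  shows "pact (diag_sum A B) p (join n x y) = join n (pact A p x) (pact B p y)"
proof (induction p)
  case (pCons a p)
  then show ?case by (simp add: pact_pCons mact_diag_sum[OF assms]) (simp add: join_def fun_eq_iff)
qed (simp add: join_def fun_eq_iff)

lemma ker_card_diag_sum:
  assumes "A \<in> carrier_mat n n" "B \<in> carrier_mat m m"
  shows "ker_card (diag_sum A B) p = ker_card A p * ker_card B p"
proof -
  let ?KA = "{x \<in> Fn n. pact A p x = 0}" and ?KB = "{x \<in> Fn m. pact B p x = 0}"
  \<comment> \<open>The restriction on \<open>x\<close> matters: \<open>join\<close> discards its
    entries from \<open>n\<close> on.\<close>
  have jz: "join n x y = 0 \<longleftrightarrow> x = 0 \<and> y = 0" if "x \<in> Fn n" for x y :: "nat \<Rightarrow> 'a"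
  proof
    assume *: "join n x y = 0"
    have "x i = 0" for i using fun_cong[OF *, of i] that by (auto simp: join_def Fn_def split: if_splits)
    moreover have "y i = 0" for i using fun_cong[OF *, of "n + i"] by (simp add: join_def)
    ultimately show "x = 0 \<and> y = 0" by (simp add: fun_eq_iff)
  qed (simp add: join_def fun_eq_iff)
  have "bij_betw (\<lambda>(x, y). join n x y) (?KA \<times> ?KB) {x \<in> Fn (n + m). pact (diag_sum A B) p x = 0}"
  proof (rule bij_betwI[where g = "\<lambda>z. (\<lambda>i. if i < n then z i else 0, \<lambda>i. z (n + i))"])
    have "join n x y \<in> Fn (n + m)" if "y \<in> Fn m" for x y :: "nat \<Rightarrow> 'a"
      using that by (auto simp: join_def Fn_def)
    moreover have "join n 0 0 = (0 :: nat \<Rightarrow> 'a)" by (simp add: join_def fun_eq_iff)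
    ultimately show "(\<lambda>(x, y). join n x y) \<in> ?KA \<times> ?KB \<rightarrow> {x \<in> Fn (n + m). pact (diag_sum A B) p x = 0}"
      by (auto simp: pact_diag_sum[OF assms])
    show "(\<lambda>z. (\<lambda>i. if i < n then z i else 0, \<lambda>i. z (n + i)))
      \<in> {x \<in> Fn (n + m). pact (diag_sum A B) p x = 0} \<rightarrow> ?KA \<times> ?KB"
    proof
      fix z assume z: "z \<in> {x \<in> Fn (n + m). pact (diag_sum A B) p x = 0}"
      define x where "x = (\<lambda>i. if i < n then z i else 0)"
      define y where "y = (\<lambda>i. z (n + i))"
      have "z = join n x y" by (auto simp: x_def y_def join_def)
      moreover have "x \<in> Fn n" "y \<in> Fn m" using z by (auto simp: x_def y_def Fn_def)
      ultimately have "(x, y) \<in> ?KA \<times> ?KB"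
        using z jz[OF pact_in_Fn[OF assms(1)]] by (simp add: pact_diag_sum[OF assms])
      then show "(\<lambda>i. if i < n then z i else 0, \<lambda>i. z (n + i)) \<in> ?KA \<times> ?KB"
        unfolding x_def y_def .
    qed
  qed (auto simp: join_def Fn_def fun_eq_iff)
  then have "card (?KA \<times> ?KB) = card {x \<in> Fn (n + m). pact (diag_sum A B) p x = 0}"
    by (rule bij_betw_same_card)
  then show ?thesis
    using assms diag_sum_carrier[OF assms] by (simp add: ker_card_def card_cartesian_product)
qed

section \<open>Companion matrices as cyclic modules\<close>

lemma companion_carrier: "companion p \<in> carrier_mat (degree p) (degree p)"
  by (simp add: companion_def Let_def)

text \<open>For monic \<open>p\<close> this is multiplication by t on F_q[t]/(p) in coordinates: the
  coefficients move up by one, and the one that overflows is folded back through the relation p =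
  0.\<close>

lemma mact_companion:
  assumes "degree p > 0"
  shows "mact (companion p) y = (\<lambda>i. if i < degree p
    then (if i = 0 then 0 else y (i - 1)) - coeff p i * y (degree p - 1) else 0)"
proof
  fix i
  obtain e where e: "degree p = Suc e" using assms by (cases "degree p") auto
  show "mact (companion p) y i = (if i < degree p
    then (if i = 0 then 0 else y (i - 1)) - coeff p i * y (degree p - 1) else 0)"
  proof (cases "i < degree p")
    case True
    have "mact (companion p) y i = (\<Sum>j<e. (if i = j + 1 then 1 else 0) * y j) - coeff p i * y e"
      using True e by (simp add: mact_def companion_def Let_def)
    also have "(\<Sum>j<e. (if i = j + 1 then 1 else 0) * y j) = (\<Sum>j<e. if j = i - 1 \<and> i \<noteq> 0 then y j else 0)"
      by (intro sum.cong) auto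
    also have "\<dots> = (if i = 0 then 0 else y (i - 1))"
      using True e by (cases i) auto
    finally show ?thesis using True e by simp
  qed (simp add: mact_def companion_def Let_def)
qed

text \<open>The vector \<open>unit_fun 0\<close> is the class of 1, so a polynomial of small degree
  sends it to its own coefficient vector.\<close>

lemma pact_companion_low:
  assumes "degree p > 0" "\<forall>i\<ge>degree p. coeff q i = 0"
  shows "pact (companion p) q (unit_fun 0) = coeff q"
  using assms(2)
proof (induction q)
  case (pCons a q)
  have q: "coeff q i = 0" if "Suc i \<ge> degree p" for i
    using pCons.prems[rule_format, OF that] by simp
  then have "pact (companion p) q (unit_fun 0) = coeff q" using pCons.IH by simp
  then show ?case
    using assms(1) q by (auto simp: pact_pCons mact_companion unit_fun_def fun_eq_iff coeff_pCons
        split: nat.splits)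
qed (simp add: fun_eq_iff)

text \<open>Writing p = a + t q, the polynomial \<open>q\<close> is still of small degree and monic.
  Only the last multiplication by t overflows, and it produces minus the coefficients of
  \<open>p\<close>.\<close>

lemma pact_companion_self:
  assumes "degree p > 0" "lead_coeff p = 1"
  shows "pact (companion p) p (unit_fun 0) = 0"
proof -
  obtain a q where pq: "p = pCons a q" by (cases p)
  then have deg: "degree p = Suc (degree q)" using assms by auto
  have "pact (companion p) q (unit_fun 0) = coeff q"
    by (rule pact_companion_low) (use assms deg in \<open>auto intro: coeff_eq_0\<close>)
  moreover have "coeff q (degree q) = 1" using assms deg pq by simp
  ultimately have "pact (companion p) p (unit_fun 0)
      = (\<lambda>i. a * unit_fun 0 i) + mact (companion p) (coeff q)"
    by (subst (2) pq) (simp add: pact_pCons)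
  also have "\<dots> = 0"
    using assms(1) \<open>coeff q (degree q) = 1\<close> deg
    by (auto simp: mact_companion unit_fun_def fun_eq_iff) (auto simp: pq coeff_pCons split: nat.splits)
  finally show ?thesis .
qed

lemma span_companion:
  fixes p :: "'a::{field,finite} poly"
  assumes "degree p > 0"
  shows "Modules.module.span (pact (companion p)) {unit_fun 0} = Fn (degree p)"
proof -
  interpret poly_module "pact (companion p)" by (rule poly_module_pact)
  show ?thesis
  proof (rule span_subspace)
    show "{unit_fun 0} \<subseteq> Fn (degree p)" using assms by (auto simp: Fn_def unit_fun_def)
    show "subspace (Fn (degree p))" by (rule subspace_Fn[OF companion_carrier])
    show "Fn (degree p) \<subseteq> span {unit_fun 0}"
    proof
      fix x :: "nat \<Rightarrow> 'a" assume x: "x \<in> Fn (degree p)"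
      define q where "q = Poly (map x [0..<degree p])"
      have "coeff q = x" using x by (auto simp: q_def coeff_Poly_eq nth_default_def Fn_def fun_eq_iff)
      then have "pact (companion p) q (unit_fun 0) = x"
        using pact_companion_low[OF assms, of q] x by (simp add: Fn_def)
      then show "x \<in> span {unit_fun 0}" unfolding span_singleton by blast
    qed
  qed
qed

lemma Phi_props:
  assumes "f \<in> Phi"
  shows "irreducible f" "lead_coeff f = 1" "f \<noteq> 0" "degree f > 0" "0 < k \<Longrightarrow> degree (f ^ k) > 0"
    "lead_coeff (f ^ k) = 1" "degree (f ^ k) = degree f * k"
proof -
  show *: "irreducible f" "lead_coeff f = 1" using assms by (simp_all add: Phi_def)
  then show "f \<noteq> 0" by auto
  with * show d: "degree f > 0" by (auto simp: irreducible_def is_unit_iff_degree)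
  show deg: "degree (f ^ k) = degree f * k" using \<open>f \<noteq> 0\<close> by (simp add: degree_power_eq)
  show "0 < k \<Longrightarrow> degree (f ^ k) > 0" using deg d by simp
  show "lead_coeff (f ^ k) = 1" using * by (simp only: lead_coeff_power power_one)
qed

lemma Phi_bezout:
  assumes "f \<in> Phi" "g \<in> Phi" "f \<noteq> g"
  shows "\<exists>a b. a * f + b * g = 1"
proof (rule irreducible_poly_bezout)
  show "irreducible f" by (rule Phi_props(1)[OF assms(1)])
  show "\<not> f dvd g"
    using monic_irreducible_dvd_eq[of f g] Phi_props(1,2)[OF assms(1)] Phi_props(1,2)[OF assms(2)]
      assms(3) by blast
qed

lemma ker_card_companion:
  fixes f g :: "'a::{field,finite} poly"
  assumes f: "f \<in> Phi" and g: "g \<in> Phi" and k: "0 < k"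
  shows "ker_card (companion (g ^ k)) (f ^ j) = CARD('a) ^ (if g = f then degree f * min k j else 0)"
proof -
  let ?C = "companion (g ^ k)"
  note gk = Phi_props[OF g]
  interpret poly_module "pact ?C" by (rule poly_module_pact)
  have v: "pact ?C (g ^ k) (unit_fun 0) = 0" by (rule pact_companion_self[OF gk(5)[OF k] gk(6)])
  have sp: "span {unit_fun 0} = Fn (degree (g ^ k))" by (rule span_companion[OF gk(5)[OF k]])
  have kc: "ker_card ?C (f ^ j) = card {x \<in> span {unit_fun 0}. pact ?C (f ^ j) x = 0}"
    unfolding ker_card_def sp using companion_carrier[of "g ^ k"] by simp
  show ?thesis
  proof (cases "g = f")
    case True
    have "card (span {unit_fun 0 :: nat \<Rightarrow> 'a}) = CARD('a) ^ (degree g * k)"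
      unfolding sp by (simp only: card_Fn gk(7))
    from card_kernel_cyclic_same[OF gk(3) v this, of j] show ?thesis using True kc by simp
  next
    case False
    then show ?thesis using kernel_cyclic_other[OF v Phi_bezout[OF f g], of j] kc by simp
  qed
qed

definition block_matrix :: "('a::{field,finite} poly \<times> nat) list \<Rightarrow> 'a mat" where
  "block_matrix L = blockdiag (map (\<lambda>(f, k). companion (f ^ k)) L)"

lemma block_matrix_simps [simp]:
  "block_matrix [] = 0\<^sub>m 0 0"
  "block_matrix ((f, k) # L) = diag_sum (companion (f ^ k)) (block_matrix L)"
  by (simp_all add: block_matrix_def)

lemma block_matrix_carrier:
  assumes "\<forall>(f, k)\<in>set L. f \<in> Phi \<and> 0 < k"
  shows "block_matrix L \<in> carrier_mat (\<Sum>(f, k)\<leftarrow>L. degree f * k) (\<Sum>(f, k)\<leftarrow>L. degree f * k)"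
  using assms
proof (induction L)
  case (Cons a L)
  obtain f k where a: "a = (f, k)" by (cases a)
  then have C: "companion (f ^ k) \<in> carrier_mat (degree f * k) (degree f * k)"
    using companion_carrier[of "f ^ k"] Cons.prems Phi_props(7)[of f k] by simp
  have "\<forall>(f, k)\<in>set L. f \<in> Phi \<and> 0 < k" using Cons.prems by simp
  from diag_sum_carrier[OF C Cons.IH[OF this]] show ?case unfolding a by simp
qed simp

lemma ker_card_block_matrix:
  fixes f :: "'a::{field,finite} poly"
  assumes "\<forall>(g, k)\<in>set L. g \<in> Phi \<and> 0 < k" "f \<in> Phi"
  shows "ker_card (block_matrix L) (f ^ j)
    = CARD('a) ^ (\<Sum>(g, k)\<leftarrow>L. if g = f then degree f * min k j else 0)"
  using assms(1)
proof (induction L)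
  case Nil
  have "{x \<in> Fn 0. pact (0\<^sub>m 0 0) (f ^ j) x = 0} = {0 :: nat \<Rightarrow> 'a}"
  proof -
    have "pact (0\<^sub>m 0 0) (f ^ j) 0 = 0"
      using pact_in_Fn[of "0\<^sub>m 0 0" 0 0 "f ^ j"] by (auto simp: Fn_def fun_eq_iff)
    then show ?thesis by (auto simp: Fn_def fun_eq_iff)
  qed
  then show ?case by (simp add: ker_card_def)
next
  case (Cons a L)
  obtain g k where a: "a = (g, k)" by (cases a)
  have L: "\<forall>(g, k)\<in>set L. g \<in> Phi \<and> 0 < k" and gk: "g \<in> Phi" "0 < k"
    using Cons.prems a by simp_all
  have "ker_card (block_matrix (a # L)) (f ^ j)
    = ker_card (companion (g ^ k)) (f ^ j) * ker_card (block_matrix L) (f ^ j)"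
    using ker_card_diag_sum[OF companion_carrier block_matrix_carrier[OF L]] a by simp
  also have "\<dots> = CARD('a) ^ (if g = f then degree f * min k j else 0)
      * CARD('a) ^ (\<Sum>(g, k)\<leftarrow>L. if g = f then degree f * min k j else 0)"
    by (simp only: Cons.IH[OF L] ker_card_companion[OF assms(2) gk])
  finally show ?case unfolding a by (simp add: power_add)
qed

section \<open>The primary rational canonical form\<close>

lemma GL_carrier: "A \<in> GL n \<Longrightarrow> A \<in> carrier_mat n n"
  by (simp add: GL_def)

lemma GL_inverse:
  assumes "A \<in> GL n"
  obtains B where "B \<in> carrier_mat n n" "A * B = 1\<^sub>m n" "B * A = 1\<^sub>m n"
proof -
  have A: "A \<in> carrier_mat n n" using assms by (rule GL_carrier)
  obtain B where B: "A * B = 1\<^sub>m (dim_row A)" "B * A = 1\<^sub>m (dim_row B)"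
    using assms unfolding GL_def invertible_mat_def inverts_mat_def by blast
  have "dim_col (A * B) = n" using B(1) A by simp
  then have "dim_col B = n" by simp
  moreover have "dim_col (B * A) = dim_row B" using B(2) by simp
  then have "dim_row B = n" using A by simp
  ultimately have "B \<in> carrier_mat n n" by blast
  then show ?thesis using that B A by simp
qed

lemma GL_intro:
  assumes "A \<in> carrier_mat n n" "B \<in> carrier_mat n n" "A * B = 1\<^sub>m n"
  shows "A \<in> GL n"
proof -
  have "B * A = 1\<^sub>m n" using assms by (rule mat_mult_left_right_inverse)
  then show ?thesis using assms unfolding GL_def invertible_mat_def inverts_mat_def by auto
qed

text \<open>For each generator the chain v, t v, t^2 v, ..., one vector per degree of its order f^k.
  These become the columns of the change of basis.\<close>

fun cyclic_cols :: "'a::{field,finite} mat \<Rightarrow> ((nat \<Rightarrow> 'a) \<times> 'a poly \<times> nat) list \<Rightarrow> (nat \<Rightarrow> 'a) list" where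
  "cyclic_cols A [] = []"
| "cyclic_cols A ((v, f, k) # L) = map (\<lambda>j. pact A (monom 1 j) v) [0..<degree f * k] @ cyclic_cols A L"

lemma length_cyclic_cols: "length (cyclic_cols A L) = (\<Sum>(v, f, k)\<leftarrow>L. degree f * k)"
  by (induction A L rule: cyclic_cols.induct) simp_all

lemma pact_monom_Suc: "pact A (monom 1 (Suc j)) v = mact A (pact A (monom 1 j) v)"
  by (simp add: monom_Suc pact_pCons fun_eq_iff)

lemma pact_low_sum:
  assumes "\<forall>i\<ge>d. coeff q i = 0"
  shows "pact A q v r = (\<Sum>i<d. coeff q i * pact A (monom 1 i) v r)"
proof -
  have sum_apply: "pact A (\<Sum>i<e. monom (c i) i) v r = (\<Sum>i<e. c i * pact A (monom 1 i) v r)" for c e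
  proof (induction e)
    case (Suc e)
    have "monom (c e) e = Polynomial.smult (c e) (monom 1 e)" by (simp add: smult_monom)
    then have "pact A (monom (c e) e) v = (\<lambda>i. c e * pact A (monom 1 e) v i)"
      by (simp only: pact_smult)
    then show ?case using Suc by (simp add: pact_add_left)
  qed simp
  have "q = (\<Sum>i<d. monom (coeff q i) i)"
    using assms by (intro poly_eqI) (simp add: coeff_sum)
  then show ?thesis using sum_apply[of "coeff q" d] by simp
qed

text \<open>\<open>A\<close> moves each vector of a chain to the next, and the relation f^k v = 0
  expresses what follows the last one. These are the columns of the companion blocks; linear
  independence does not enter.\<close>

lemma mact_cyclic_cols:
  assumes "\<forall>(v, f, k)\<in>set L. f \<in> Phi \<and> 0 < k \<and> pact A (f ^ k) v = 0"
    and "j < length (cyclic_cols A L)"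
  shows "mact A (cyclic_cols A L ! j) r
    = (\<Sum>i<length (cyclic_cols A L). block_matrix (map snd L) $$ (i, j) * (cyclic_cols A L ! i) r)"
  using assms
proof (induction L arbitrary: j)
  case (Cons a L)
  obtain v f k where a: "a = (v, f, k)" by (cases a)
  define p where "p = f ^ k"
  define d where "d = degree p"
  define N where "N = length (cyclic_cols A L)"
  have f: "f \<in> Phi" and k: "0 < k" and pv: "pact A p v = 0"
    using Cons.prems(1) a p_def by (simp_all add: zero_fun_def)
  have d: "d = degree f * k" and d0: "d > 0" and lc: "coeff p d = 1"
    using Phi_props(5,7)[OF f, of k] Phi_props(6)[OF f, of k] k unfolding d_def p_def by simp_all
  let ?C = "companion p" and ?B = "block_matrix (map snd L)"
  have L: "\<forall>(v, f, k)\<in>set L. f \<in> Phi \<and> 0 < k \<and> pact A (f ^ k) v = 0" using Cons.prems(1) by (simp add: zero_fun_def)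
  have C: "?C \<in> carrier_mat d d" unfolding d_def by (rule companion_carrier)
  have "(\<Sum>(f, k)\<leftarrow>map snd L. degree f * k) = N"
    unfolding N_def length_cyclic_cols by (simp add: comp_def case_prod_unfold)
  moreover have "\<forall>(f, k)\<in>set (map snd L). f \<in> Phi \<and> 0 < k" using L by fastforce
  ultimately have B: "?B \<in> carrier_mat N N"
    using block_matrix_carrier[of "map snd L"] by simp
  have cols: "cyclic_cols A (a # L) = map (\<lambda>j. pact A (monom 1 j) v) [0..<d] @ cyclic_cols A L"
    using a d by simp
  then have len: "length (cyclic_cols A (a # L)) = d + N" by (simp add: N_def)
  have nth1: "cyclic_cols A (a # L) ! i = pact A (monom 1 i) v" if "i < d" for i
    using that cols by (simp add: nth_append)
  have nth2: "cyclic_cols A (a # L) ! (d + i) = cyclic_cols A L ! i" for i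
    using cols by (simp add: nth_append)
  have bm: "block_matrix (map snd (a # L)) = diag_sum ?C ?B" using a p_def by simp
  have j: "j < d + N" using Cons.prems(2) len by simp
  show ?case
  proof (cases "j < d")
    case True
    have R: "(\<Sum>i<length (cyclic_cols A (a # L)). block_matrix (map snd (a # L)) $$ (i, j) * (cyclic_cols A (a # L) ! i) r)
      = (\<Sum>i<d. ?C $$ (i, j) * pact A (monom 1 i) v r)"
      unfolding len bm sum_lessThan_add using True
      by (simp add: nth1 nth2 diag_sum_index[OF C B])
    show ?thesis
    proof (cases "j = d - 1")
      case False
      have "(\<Sum>i<d. ?C $$ (i, j) * pact A (monom 1 i) v r)
          = (\<Sum>i<d. if i = Suc j then pact A (monom 1 i) v r else 0)"
        using False True by (intro sum.cong) (auto simp: companion_def Let_def d_def)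
      also have "\<dots> = pact A (monom 1 (Suc j)) v r" using False True by simp
      finally show ?thesis unfolding R nth1[OF True] pact_monom_Suc by simp
    next
      \<comment> \<open>The vector t^d v just past the end of the chain. As \<open>p\<close> is
        monic and kills \<open>v\<close>, it is minus the combination of the chain with the lower
        coefficients of \<open>p\<close>.\<close>
      case jd: True
      have "(\<Sum>i<d. ?C $$ (i, j) * pact A (monom 1 i) v r)
          = - (\<Sum>i<d. coeff p i * pact A (monom 1 i) v r)"
        unfolding sum_negf[symmetric]
        using jd True by (intro sum.cong) (auto simp: companion_def Let_def d_def)
      moreover have "pact A p v r = (\<Sum>i<Suc d. coeff p i * pact A (monom 1 i) v r)"
        by (rule pact_low_sum) (auto simp: d_def intro: coeff_eq_0)
      then have "(\<Sum>i<d. coeff p i * pact A (monom 1 i) v r) + pact A (monom 1 d) v r = 0"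
        using lc pv by simp
      then have "pact A (monom 1 d) v r = - (\<Sum>i<d. coeff p i * pact A (monom 1 i) v r)"
        by (simp add: eq_neg_iff_add_eq_0 add.commute)
      moreover have "mact A (cyclic_cols A (a # L) ! j) r = pact A (monom 1 d) v r"
        unfolding nth1[OF True] pact_monom_Suc[symmetric] using jd d0 by simp
      ultimately show ?thesis unfolding R by simp
    qed
  next
    case False
    then obtain j' where j': "j = d + j'" using le_Suc_ex[of d j] by auto
    then have jN: "j' < N" using j by simp
    have "(\<Sum>i<length (cyclic_cols A (a # L)). block_matrix (map snd (a # L)) $$ (i, j) * (cyclic_cols A (a # L) ! i) r)
      = (\<Sum>i<N. ?B $$ (i, j') * (cyclic_cols A L ! i) r)"
      unfolding len bm sum_lessThan_add using j' jN
      by (simp add: nth2 diag_sum_index[OF C B])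
    also have "\<dots> = mact A (cyclic_cols A L ! j') r"
      using Cons.IH[OF L, of j'] jN unfolding N_def by simp
    finally show ?thesis using nth2 j' by simp
  qed
qed simp

text \<open>A coefficient polynomial of \<open>v\<close> may be reduced modulo f^k, which leaves a
  combination of the chain of \<open>v\<close> with scalars from F_q.\<close>

lemma span_cyclic_cols:
  fixes A :: "'a::{field,finite} mat"
  assumes "\<forall>(v, f, k)\<in>set L. f \<in> Phi \<and> 0 < k \<and> pact A (f ^ k) v = 0"
    and "x \<in> Modules.module.span (pact A) (fst ` set L)"
  shows "\<exists>c. x = (\<lambda>r. \<Sum>i<length (cyclic_cols A L). c i * (cyclic_cols A L ! i) r)"
  using assms
proof (induction L arbitrary: x)
  case Nil
  interpret poly_module "pact A" by (rule poly_module_pact)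
  show ?case using Nil by (auto simp: fun_eq_iff)
next
  case (Cons a L)
  interpret poly_module "pact A" by (rule poly_module_pact)
  obtain v f k where a: "a = (v, f, k)" by (cases a)
  define d where "d = degree f * k"
  have f: "f \<in> Phi" and pv: "pact A (f ^ k) v = 0" using Cons.prems(1) a by (simp_all add: zero_fun_def)
  have fk: "f ^ k \<noteq> 0" "degree (f ^ k) = d" using Phi_props[OF f] d_def by simp_all
  have "x \<in> span (insert v (fst ` set L))" using Cons.prems(2) a by simp
  then obtain q0 where "x - pact A q0 v \<in> span (fst ` set L)" unfolding span_insert by blast
  moreover define q where "q = q0 mod f ^ k"
  ultimately have y: "x - pact A q v \<in> span (fst ` set L)" using sc_mod[OF pv, of q0] by simp
  have "\<forall>i\<ge>d. coeff q i = 0"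
    using degree_mod_less[OF fk(1), of q0] fk(2) unfolding q_def by (auto intro: coeff_eq_0)
  note qv = pact_low_sum[OF this, of A v]
  have L: "\<forall>(v, f, k)\<in>set L. f \<in> Phi \<and> 0 < k \<and> pact A (f ^ k) v = 0" using Cons.prems(1) by (simp add: zero_fun_def)
  obtain c where c: "x - pact A q v = (\<lambda>r. \<Sum>i<length (cyclic_cols A L). c i * (cyclic_cols A L ! i) r)"
    using Cons.IH[OF L y] by blast
  define e where "e i = (if i < d then coeff q i else c (i - d))" for i
  have cols: "cyclic_cols A (a # L) = map (\<lambda>j. pact A (monom 1 j) v) [0..<d] @ cyclic_cols A L"
    using a d_def by simp
  have "x r = (\<Sum>i<length (cyclic_cols A (a # L)). e i * (cyclic_cols A (a # L) ! i) r)" for r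
  proof -
    have "x r = pact A q v r + (\<Sum>i<length (cyclic_cols A L). c i * (cyclic_cols A L ! i) r)"
      using fun_cong[OF c, of r] by (simp add: algebra_simps)
    then show ?thesis unfolding cols length_append length_map length_upt
      by (simp add: sum_lessThan_add e_def nth_append qv)
  qed
  then show ?case by blast
qed

text \<open>The columns of \<open>P\<close> are the chains of a cyclic decomposition, whence A P = P
  B. They span, which yields a right inverse \<open>Q\<close>; as \<open>P\<close> is square,
  \<open>Q\<close> is two-sided. Invertibility of \<open>A\<close> supplies the hypothesis of
  \<open>cyclic_decomposition\<close> on t.\<close>

theorem ex_similar_block_matrix:
  fixes A :: "'a::{field,finite} mat"
  assumes "A \<in> GL n"
  shows "\<exists>L. (\<forall>(f, k)\<in>set L. f \<in> Phi \<and> 0 < k) \<and> similar_mat A (block_matrix L)"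
proof -
  have A: "A \<in> carrier_mat n n" using assms by (rule GL_carrier)
  obtain A' where A': "A' \<in> carrier_mat n n" "A' * A = 1\<^sub>m n" using assms by (rule GL_inverse)
  interpret poly_module "pact A" by (rule poly_module_pact)
  have inj: "x = 0" if "x \<in> Fn n" "pact A [:0, 1:] x = 0" for x
  proof -
    have "pact A [:0, 1:] x = mact A x" by (simp add: pact_pCons fun_eq_iff)
    then have "mact A' (mact A x) = mact A' 0" using that(2) by simp
    then have "mact (A' * A) x = 0" using mact_mult[OF A'(1) A] by (simp only: mact_zero)
    then show ?thesis using mact_one[OF that(1)] A'(2) by simp
  qed
  from cyclic_decomposition[OF finite_Fn subspace_Fn[OF A] inj]
  obtain L where L: "\<forall>(v, f, k)\<in>set L. f \<in> Phi \<and> 0 < k \<and> pact A (f ^ k) v = 0"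
    and sp: "span (fst ` set L) = Fn n"
    and card: "card (Fn n :: (nat \<Rightarrow> 'a) set) = CARD('a) ^ (\<Sum>(v, f, k)\<leftarrow>L. degree f * k)" by blast
  let ?B = "block_matrix (map snd L)"
  \<comment> \<open>The two counts of F_q^n give exactly \<open>n\<close> columns, so that
    \<open>P\<close> is square.\<close>
  have "n = (\<Sum>(v, f, k)\<leftarrow>L. degree f * k)"
    using card card_Fn[where 'a = 'a, of n] two_le_card_field[where 'a = 'a]
    by (simp add: power_inject_exp)
  then have len: "length (cyclic_cols A L) = n" by (simp add: length_cyclic_cols)
  have good: "\<forall>(f, k)\<in>set (map snd L). f \<in> Phi \<and> 0 < k" using L by fastforce
  have "(\<Sum>(f, k)\<leftarrow>map snd L. degree f * k) = n"
    unfolding len[symmetric] length_cyclic_cols by (simp add: comp_def case_prod_unfold)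
  then have B: "?B \<in> carrier_mat n n" using block_matrix_carrier[OF good] by simp
  define P where "P = mat n n (\<lambda>(i, j). (cyclic_cols A L ! j) i)"
  have P: "P \<in> carrier_mat n n" by (simp add: P_def)
  have colF: "cyclic_cols A L ! j \<in> Fn n" if "j < n" for j
  proof -
    have "set (cyclic_cols A L) \<subseteq> span (fst ` set L)" for L
    proof (induction L)
      case (Cons a L)
      obtain v f k where a: "a = (v, f, k)" by (cases a)
      have "span (fst ` set L) \<subseteq> span (fst ` set (a # L))" by (rule span_mono) auto
      moreover have "pact A q v \<in> span (fst ` set (a # L))" for q
        using a by (auto intro: span_scale span_base)
      ultimately show ?case using Cons a by auto
    qed simp
    then show ?thesis using that len sp nth_mem by blast
  qed
  have AP: "A * P = P * ?B"
  proof (rule eq_matI)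
    fix i j assume "i < dim_row (P * ?B)" "j < dim_col (P * ?B)"
    then have ij: "i < n" "j < n" using P B by simp_all
    have "(A * P) $$ (i, j) = mact A (cyclic_cols A L ! j) i"
      using ij A by (simp add: P_def mact_def scalar_prod_def atLeast0LessThan)
    also have "\<dots> = (\<Sum>l<n. ?B $$ (l, j) * (cyclic_cols A L ! l) i)"
      using mact_cyclic_cols[OF L, of j i] ij len by simp
    also have "\<dots> = (P * ?B) $$ (i, j)"
      using ij B by (simp add: P_def scalar_prod_def atLeast0LessThan mult.commute)
    finally show "(A * P) $$ (i, j) = (P * ?B) $$ (i, j)" .
  qed (use A P B in auto)
  have "\<exists>c. \<forall>j<n. \<forall>r. unit_fun j r = (\<Sum>i<n. c j i * (cyclic_cols A L ! i) r)"
  proof -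
    have "\<exists>c. \<forall>r. unit_fun j r = (\<Sum>i<n. c i * (cyclic_cols A L ! i) r)" if "j < n" for j
    proof -
      have "(unit_fun j :: nat \<Rightarrow> 'a) \<in> span (fst ` set L)"
        unfolding sp using that by (auto simp: Fn_def unit_fun_def)
      from span_cyclic_cols[OF L this] show ?thesis unfolding len by (auto simp: fun_eq_iff)
    qed
    then show ?thesis by metis
  qed
  then obtain c where c: "\<And>j r. j < n \<Longrightarrow> unit_fun j r = (\<Sum>i<n. c j i * (cyclic_cols A L ! i) r)"
    by blast
  define Q where "Q = mat n n (\<lambda>(i, j). c j i)"
  have Q: "Q \<in> carrier_mat n n" by (simp add: Q_def)
  have PQ: "P * Q = 1\<^sub>m n"
  proof (rule eq_matI)
    fix i j assume "i < dim_row (1\<^sub>m n :: 'a mat)" "j < dim_col (1\<^sub>m n :: 'a mat)"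
    then have ij: "i < n" "j < n" by simp_all
    have "(P * Q) $$ (i, j) = (\<Sum>l<n. c j l * (cyclic_cols A L ! l) i)"
      using ij by (simp add: P_def Q_def scalar_prod_def atLeast0LessThan mult.commute)
    also have "\<dots> = unit_fun j i" using c ij by simp
    finally show "(P * Q) $$ (i, j) = 1\<^sub>m n $$ (i, j)" using ij by (simp add: unit_fun_def)
  qed (use P Q in auto)
  have QP: "Q * P = 1\<^sub>m n" using P Q PQ by (rule mat_mult_left_right_inverse)
  have "A = A * (P * Q)" using A PQ by simp
  also have "\<dots> = P * ?B * Q" using A P Q AP by (simp flip: assoc_mult_mat)
  finally have "similar_mat A ?B" using A B P Q PQ QP by (intro similar_matI[where P = P and Q = Q]) auto
  then show ?thesis using good by blast
qed

section \<open>Types and modified types\<close>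

lemma sum_list_min_Suc:
  "(\<Sum>x\<leftarrow>xs. min x (Suc j)) = (\<Sum>x\<leftarrow>xs. min x j) + length (filter (\<lambda>x. j < x) xs)"
  by (induction xs) auto

lemma count_add_length_filter:
  "count (mset xs) (Suc v) + length (filter (\<lambda>x. Suc v < x) xs) = length (filter (\<lambda>x. v < x) xs)"
  by (induction xs) auto

text \<open>The increment from j to j + 1 counts the parts exceeding j, that is, a part of the
  conjugate partition; differences of these counts are the multiplicities. Positivity settles the
  multiplicity of 0, which the sums cannot see.\<close>

lemma mset_eq_of_sum_min:
  fixes xs ys :: "nat list"
  assumes pos: "\<forall>x\<in>set xs. 0 < x" "\<forall>x\<in>set ys. 0 < x"
    and eq: "\<And>j. (\<Sum>x\<leftarrow>xs. min x j) = (\<Sum>x\<leftarrow>ys. min x j)"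
  shows "mset xs = mset ys"
proof (rule multiset_eqI)
  fix v
  have N: "length (filter (\<lambda>x. j < x) xs) = length (filter (\<lambda>x. j < x) ys)" for j
    using eq[of j] eq[of "Suc j"] unfolding sum_list_min_Suc by simp
  show "count (mset xs) v = count (mset ys) v"
  proof (cases v)
    case 0
    then show ?thesis using pos by (metis count_mset_0_iff less_irrefl)
  next
    case (Suc u)
    then show ?thesis
      using count_add_length_filter[of xs u] count_add_length_filter[of ys u] N[of u] N[of "Suc u"]
      by simp
  qed
qed

lemma partition_eq_of_mset:
  assumes "is_partition xs" "is_partition ys" "mset xs = mset ys"
  shows "xs = ys"
proof -
  have s: "sorted (rev zs)" if "is_partition zs" for zs
    using that unfolding is_partition_def sorted_wrt_rev by simp
  have "sort (rev xs) = rev xs" "sort (rev xs) = rev ys"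
    using s assms by (auto intro!: properties_for_sort)
  then show ?thesis by simp
qed

definition block_parts :: "'b \<Rightarrow> ('b \<times> nat) list \<Rightarrow> nat list" where
  "block_parts f L = map snd (filter (\<lambda>(g, k). g = f) L)"

lemma count_block_parts: "count (mset (block_parts f L)) k = count (mset L) (f, k)"
  by (induction L) (auto simp: block_parts_def)

lemma sum_list_block_parts:
  "(\<Sum>(g, k)\<leftarrow>L. if g = f then h k else (0::nat)) = (\<Sum>k\<leftarrow>block_parts f L. h k)"
  by (induction L) (auto simp: block_parts_def)

lemma count_blocks:
  assumes "finite (supp_p lam)"
  shows "count (blocks lam) (f, k) = count (mset (lam f)) k"
proof -
  have "count (mset (map (\<lambda>k. (g, k)) xs)) (f, k) = (if g = f then count (mset xs) k else 0)"
    for g :: "'a poly" and xs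
    by (induction xs) auto
  then have "count (blocks lam) (f, k) = (\<Sum>g\<in>supp_p lam. if g = f then count (mset (lam g)) k else 0)"
    unfolding blocks_def count_sum by simp
  also have "\<dots> = count (mset (lam f)) k"
    using assms by (simp add: supp_p_def)
  finally show ?thesis .
qed

lemma PPhi_finite: "lam \<in> PPhi \<Longrightarrow> finite (supp_p lam)"
  by (simp add: PPhi_def)

lemma mset_block_parts:
  assumes "lam \<in> PPhi" "mset L = blocks lam"
  shows "mset (block_parts f L) = mset (lam f)"
  by (rule multiset_eqI) (simp add: count_block_parts assms(2) count_blocks[OF PPhi_finite[OF assms(1)]])

lemma blocks_good:
  assumes lam: "lam \<in> PPhi" and L: "mset L = blocks lam"
  shows "\<forall>(f, k)\<in>set L. f \<in> Phi \<and> 0 < k"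
proof clarify
  fix f k assume "(f, k) \<in> set L"
  then have "count (mset L) (f, k) > 0" by simp
  then have "k \<in> set (lam f)" using count_blocks[OF PPhi_finite[OF lam], of f k] L by simp
  moreover from this have "f \<in> supp_p lam" unfolding supp_p_def by auto
  ultimately show "f \<in> Phi \<and> 0 < k" using lam unfolding PPhi_def is_partition_def by blast
qed

lemma ex_type_of_blocks:
  assumes "\<forall>(f, k)\<in>set L. f \<in> Phi \<and> 0 < k"
  shows "\<exists>lam\<in>PPhi. mset L = blocks lam"
proof -
  define lam where "lam f = rev (sort (block_parts f L))" for f
  have supp: "supp_p lam \<subseteq> fst ` set L"
  proof
    fix f assume "f \<in> supp_p lam"
    then have "block_parts f L \<noteq> []" by (auto simp: supp_p_def lam_def)
    then show "f \<in> fst ` set L" by (force simp: block_parts_def filter_empty_conv)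
  qed
  have fin: "finite (supp_p lam)" using supp finite_subset by blast
  moreover have "supp_p lam \<subseteq> Phi" using supp assms by fastforce
  moreover have "is_partition (lam f)" for f
    using assms unfolding is_partition_def lam_def sorted_wrt_rev by (auto simp: block_parts_def)
  ultimately have "lam \<in> PPhi" unfolding PPhi_def by blast
  moreover have "mset L = blocks lam"
  proof (rule multiset_eqI)
    fix x :: "'a poly \<times> nat"
    obtain f k where x: "x = (f, k)" by (cases x)
    show "count (mset L) x = count (blocks lam) x"
      unfolding x count_blocks[OF fin] by (simp add: lam_def count_block_parts)
  qed
  ultimately show ?thesis by blast
qed

lemma has_type_iff:
  "has_type A lam \<longleftrightarrow> lam \<in> PPhi \<and> (\<exists>L. mset L = blocks lam \<and> similar_mat A (block_matrix L))"
  by (simp add: has_type_def block_matrix_def)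

lemma has_type_PPhi: "has_type A lam \<Longrightarrow> lam \<in> PPhi"
  by (simp add: has_type_def)

lemma ex_type: "A \<in> GL n \<Longrightarrow> \<exists>lam. has_type A lam"
  using ex_similar_block_matrix ex_type_of_blocks unfolding has_type_iff by metis

lemma has_type_similar: "similar_mat A B \<Longrightarrow> has_type A lam \<longleftrightarrow> has_type B lam"
  unfolding has_type_iff using similar_mat_trans similar_mat_sym by metis

lemma ker_card_has_type:
  fixes f :: "'a::{field,finite} poly"
  assumes A: "has_type A lam" and f: "f \<in> Phi"
  shows "ker_card A (f ^ j) = CARD('a) ^ (degree f * (\<Sum>k\<leftarrow>lam f. min k j))"
proof -
  obtain L where L: "mset L = blocks lam" "similar_mat A (block_matrix L)"
    using A has_type_iff by blast
  have lam: "lam \<in> PPhi" using A by (rule has_type_PPhi)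
  have "(\<Sum>(g, k)\<leftarrow>L. if g = f then degree f * min k j else 0)
      = (\<Sum>k\<leftarrow>block_parts f L. degree f * min k j)"
    by (rule sum_list_block_parts)
  also have "\<dots> = degree f * (\<Sum>k\<leftarrow>block_parts f L. min k j)" by (simp add: sum_list_const_mult)
  also have "(\<Sum>k\<leftarrow>block_parts f L. min k j) = (\<Sum>k\<leftarrow>lam f. min k j)"
    using mset_block_parts[OF lam L(1), of f] by (metis mset_map sum_mset_sum_list)
  finally show ?thesis
    using ker_card_block_matrix[OF blocks_good[OF lam L(1)] f, of j] ker_card_similar[OF L(2)] by simp
qed

theorem has_type_unique:
  fixes A :: "'a::{field,finite} mat"
  assumes "has_type A lam" "has_type A mu"
  shows "lam = mu"
proof
  fix f
  note P = assms[THEN has_type_PPhi]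
  show "lam f = mu f"
  proof (cases "f \<in> Phi")
    case True
    have "(\<Sum>k\<leftarrow>lam f. min k j) = (\<Sum>k\<leftarrow>mu f. min k j)" for j
    proof -
      have "CARD('a) ^ (degree f * (\<Sum>k\<leftarrow>lam f. min k j)) = CARD('a) ^ (degree f * (\<Sum>k\<leftarrow>mu f. min k j))"
        using assms[THEN ker_card_has_type[OF _ True]] by metis
      then have "degree f * (\<Sum>k\<leftarrow>lam f. min k j) = degree f * (\<Sum>k\<leftarrow>mu f. min k j)"
        using two_le_card_field[where 'a = 'a] by (simp add: power_inject_exp)
      then show ?thesis using Phi_props(4)[OF True] by simp
    qed
    then have "mset (lam f) = mset (mu f)"
      using P by (intro mset_eq_of_sum_min) (auto simp: PPhi_def is_partition_def)
    then show ?thesis using P by (intro partition_eq_of_mset) (auto simp: PPhi_def)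
  next
    case False
    then have "lam f = []" "mu f = []" using P unfolding PPhi_def supp_p_def by blast+
    then show ?thesis by simp
  qed
qed

lemma pnorm_blocks:
  assumes lam: "lam \<in> PPhi" and L: "mset L = blocks lam"
  shows "(\<Sum>(f, k)\<leftarrow>L. degree f * k) = pnorm lam"
proof -
  have *: "sum_mset (image_mset h (sum M S)) = (\<Sum>f\<in>S. sum_mset (image_mset h (M f)))"
    if "finite S" for h :: "'c \<Rightarrow> nat" and M :: "'b \<Rightarrow> 'c multiset" and S
    using that by (induction S) auto
  have "(\<Sum>(f, k)\<leftarrow>L. degree f * k) = sum_mset (image_mset (\<lambda>(f, k). degree f * k) (blocks lam))"
    unfolding L[symmetric] by (simp add: sum_mset_sum_list flip: mset_map)
  also have "\<dots> = (\<Sum>f\<in>supp_p lam. sum_list (map (\<lambda>k. degree f * k) (lam f)))"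
    unfolding blocks_def *[OF PPhi_finite[OF lam]]
    by (simp add: sum_mset_sum_list comp_def flip: mset_map)
  also have "\<dots> = pnorm lam" unfolding pnorm_def by (simp add: sum_list_const_mult)
  finally show ?thesis .
qed

lemma has_type_pnorm:
  assumes "has_type A lam" "A \<in> carrier_mat n n"
  shows "pnorm lam = n"
proof -
  obtain L where L: "mset L = blocks lam" "similar_mat A (block_matrix L)"
    using assms has_type_iff by blast
  have lam: "lam \<in> PPhi" using assms has_type_PPhi by blast
  have "block_matrix L \<in> carrier_mat (pnorm lam) (pnorm lam)"
    using block_matrix_carrier[OF blocks_good[OF lam L(1)]] pnorm_blocks[OF lam L(1)] by simp
  moreover have "dim_row A = dim_row (block_matrix L)" using similar_matD[OF L(2)] by auto
  ultimately show ?thesis using assms(2) by simp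
qed

lemma tm1_Phi: "(tm1 :: 'a::{field,finite} poly) \<in> Phi"
proof -
  have "irreducible (tm1 :: 'a poly)"
  proof (rule irreducibleI)
    show "tm1 \<noteq> (0 :: 'a poly)" "\<not> is_unit (tm1 :: 'a poly)"
      by (simp_all add: tm1_def is_unit_iff_degree)
    fix a b :: "'a poly" assume ab: "tm1 = a * b"
    then have nz: "a \<noteq> 0" "b \<noteq> 0" by (auto simp: tm1_def)
    then have "degree (tm1 :: 'a poly) = degree a + degree b"
      unfolding ab by (rule degree_mult_eq)
    then have "degree a = 0 \<or> degree b = 0" by (auto simp: tm1_def)
    then show "is_unit a \<or> is_unit b" using nz by (simp add: is_unit_iff_degree)
  qed
  then show ?thesis by (simp add: Phi_def tm1_def)
qed

lemma PPhi_partition: "lam \<in> PPhi \<Longrightarrow> is_partition (lam f)"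
  by (simp add: PPhi_def)

lemma pnorm_superset:
  assumes "finite S" "supp_p lam \<subseteq> S"
  shows "pnorm lam = (\<Sum>f\<in>S. degree f * sum_list (lam f))"
  unfolding pnorm_def using assms by (intro sum.mono_neutral_left) (auto simp: supp_p_def)

lemma supp_modtype: "supp_p (modtype lam) \<subseteq> supp_p lam"
  by (auto simp: supp_p_def modtype_def split: if_splits)

lemma modtype_PPhi:
  assumes "lam \<in> PPhi"
  shows "modtype lam \<in> PPhi"
proof -
  have "sorted_wrt (\<ge>) (map (\<lambda>k. k - Suc 0) xs)" if "sorted_wrt (\<ge>) xs" for xs
    using that by (induction xs) (auto intro: diff_le_mono)
  then have "is_partition (modtype lam f)" for f
    using PPhi_partition[OF assms, of f] unfolding is_partition_def modtype_def
    by (auto intro!: sorted_wrt_filter)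
  then show ?thesis
    using assms supp_modtype[of lam] finite_subset[OF supp_modtype[of lam]] unfolding PPhi_def by auto
qed

text \<open>Every part at t - 1 is positive and loses exactly one, and t - 1 has degree 1.\<close>

lemma pnorm_modtype:
  assumes "lam \<in> PPhi"
  shows "pnorm (modtype lam) + length (lam tm1) = pnorm lam"
proof -
  let ?S = "insert tm1 (supp_p lam)"
  have fin: "finite ?S" using PPhi_finite[OF assms] by simp
  have "sum_list (filter (\<lambda>k. 0 < k) (map (\<lambda>k. k - 1) xs)) + length xs = sum_list xs"
    if "\<forall>k\<in>set xs. 0 < k" for xs :: "nat list"
    using that by (induction xs) auto
  from this[of "lam tm1"] PPhi_partition[OF assms, of tm1]
  have *: "sum_list (modtype lam tm1) + length (lam tm1) = sum_list (lam tm1)"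
    by (simp add: modtype_def is_partition_def)
  have deg: "degree (tm1 :: 'a poly) = 1" by (simp add: tm1_def)
  have "pnorm (modtype lam) = sum_list (modtype lam tm1)
      + (\<Sum>f\<in>supp_p lam - {tm1}. degree f * sum_list (modtype lam f))"
    using supp_modtype[of lam] fin deg
    by (subst pnorm_superset[of ?S]) (auto simp: sum.insert_remove)
  also have "(\<Sum>f\<in>supp_p lam - {tm1}. degree f * sum_list (modtype lam f))
      = (\<Sum>f\<in>supp_p lam - {tm1}. degree f * sum_list (lam f))"
    by (intro sum.cong) (auto simp: modtype_def)
  finally have "pnorm (modtype lam) + length (lam tm1) = sum_list (lam tm1)
      + (\<Sum>f\<in>supp_p lam - {tm1}. degree f * sum_list (lam f))" using * by simp
  also have "\<dots> = pnorm lam"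
    using fin deg by (subst pnorm_superset[of ?S lam]) (auto simp: sum.insert_remove)
  finally show ?thesis .
qed

lemma ex_modtype: "A \<in> GL n \<Longrightarrow> \<exists>mu. has_modtype A mu"
  unfolding has_modtype_def using ex_type by blast

lemma has_modtype_unique: "has_modtype A lam \<Longrightarrow> has_modtype A mu \<Longrightarrow> lam = mu"
  unfolding has_modtype_def using has_type_unique by blast

lemma has_modtype_PPhi: "has_modtype A mu \<Longrightarrow> mu \<in> PPhi"
  unfolding has_modtype_def using modtype_PPhi has_type_PPhi by blast

lemma has_modtype_similar: "similar_mat A B \<Longrightarrow> has_modtype A mu \<longleftrightarrow> has_modtype B mu"
  unfolding has_modtype_def using has_type_similar by blast

section \<open>The fixed space and the norm\<close>

definition fix_space :: "'a::comm_ring_1 mat \<Rightarrow> (nat \<Rightarrow> 'a) set" where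
  "fix_space A = {x \<in> Fn (dim_row A). mact A x = x}"

text \<open>The fixed space is the kernel of t - 1, of dimension the number of parts at t - 1, and
  \<open>pnorm_modtype\<close> makes this n minus the norm. The product form avoids subtraction in
  the exponent.\<close>

lemma card_fix_space:
  fixes A :: "'a::{field,finite} mat"
  assumes A: "A \<in> carrier_mat n n" and mu: "has_modtype A mu"
  shows "card (fix_space A) * CARD('a) ^ pnorm mu = CARD('a) ^ n"
proof -
  obtain lam where lam: "has_type A lam" "modtype lam = mu" using mu has_modtype_def by blast
  have P: "lam \<in> PPhi" using lam has_type_PPhi by blast
  have "pact A tm1 x = 0 \<longleftrightarrow> mact A x = x" for x
    by (auto simp: tm1_def pact_pCons fun_eq_iff)
  then have "card (fix_space A) = ker_card A (tm1 ^ 1)"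
    by (simp add: ker_card_def fix_space_def)
  also have "\<dots> = CARD('a) ^ (\<Sum>k\<leftarrow>lam tm1. min k 1)"
    unfolding ker_card_has_type[OF lam(1) tm1_Phi] by (simp add: tm1_def)
  also have "(\<Sum>k\<leftarrow>lam tm1. min k 1) = length (lam tm1)"
  proof -
    have "(\<Sum>k\<leftarrow>xs. min k 1) = length xs" if "\<forall>k\<in>set xs. 0 < k" for xs :: "nat list"
      using that by (induction xs) auto
    then show ?thesis using PPhi_partition[OF P, of tm1] by (simp add: is_partition_def)
  qed
  finally show ?thesis
    using pnorm_modtype[OF P] has_type_pnorm[OF lam(1) A] lam(2)
    by (simp add: add.commute flip: power_add)
qed

section \<open>Stable class representatives\<close>

lemma diag_sum_mult:
  assumes "A \<in> carrier_mat n n" "C \<in> carrier_mat n n" "B \<in> carrier_mat m m" "D \<in> carrier_mat m m"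
  shows "diag_sum A B * diag_sum C D = diag_sum (A * C) (B * D)"
proof -
  have "diag_sum A B * diag_sum C D = four_block_mat
      (A * C + 0\<^sub>m n m * 0\<^sub>m m n) (A * 0\<^sub>m n m + 0\<^sub>m n m * D)
      (0\<^sub>m m n * C + B * 0\<^sub>m m n) (0\<^sub>m m n * 0\<^sub>m n m + B * D)"
    using assms unfolding diag_sum_def by (subst mult_four_block_mat[of _ n n _ m _ m]) auto
  then show ?thesis using assms by (simp add: diag_sum_def)
qed

lemma diag_sum_one: "diag_sum (1\<^sub>m n) (1\<^sub>m m) = 1\<^sub>m (n + m)"
proof -
  have c: "(1\<^sub>m n :: 'a mat) \<in> carrier_mat n n" "(1\<^sub>m m :: 'a mat) \<in> carrier_mat m m" by simp_all
  show ?thesis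
    by (rule eq_matI) (use diag_sum_carrier[OF c] in \<open>auto simp: diag_sum_index[OF c]\<close>)
qed

lemma diag_sum_inj:
  assumes "A \<in> carrier_mat n n" "A' \<in> carrier_mat n n" "B \<in> carrier_mat m m"
    and eq: "diag_sum A B = diag_sum A' B"
  shows "A = A'"
proof (rule eq_matI)
  fix i j assume "i < dim_row A'" "j < dim_col A'"
  then have ij: "i < n" "j < n" using assms by simp_all
  have "diag_sum A B $$ (i, j) = diag_sum A' B $$ (i, j)" using eq by simp
  then show "A $$ (i, j) = A' $$ (i, j)"
    using ij by (simp add: diag_sum_index[OF assms(1,3)] diag_sum_index[OF assms(2,3)])
qed (use assms in auto)

lemma diag_sum_assoc:
  assumes A: "A \<in> carrier_mat n n" and B: "B \<in> carrier_mat m m" and C: "C \<in> carrier_mat l l"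
  shows "diag_sum A (diag_sum B C) = diag_sum (diag_sum A B) C"
proof (rule eq_matI)
  note AB = diag_sum_carrier[OF A B] and BC = diag_sum_carrier[OF B C]
  fix i j assume "i < dim_row (diag_sum (diag_sum A B) C)" "j < dim_col (diag_sum (diag_sum A B) C)"
  then have "i < n + m + l" "j < n + m + l" using diag_sum_carrier[OF AB C] by auto
  then show "diag_sum A (diag_sum B C) $$ (i, j) = diag_sum (diag_sum A B) C $$ (i, j)"
    by (auto simp: diag_sum_index[OF A BC] diag_sum_index[OF B C] diag_sum_index[OF AB C]
        diag_sum_index[OF A B] add.assoc)
qed (simp_all add: diag_sum_def)

lemma similar_diag_sum:
  assumes "similar_mat A A'" "similar_mat B B'" "A \<in> carrier_mat n n" "B \<in> carrier_mat m m"
  shows "similar_mat (diag_sum A B) (diag_sum A' B')"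
proof -
  have "dim_row A' = n" "dim_col A' = n" "dim_row B' = m" "dim_col B' = m"
    using similar_matD[OF assms(1)] similar_matD[OF assms(2)] assms(3,4) by auto
  then show ?thesis
    using similar_mat_four_block_0_0[OF assms] assms(3,4) by (simp add: diag_sum_def)
qed

lemma similar_diag_sum_commute:
  fixes A B :: "'a::field mat"
  assumes A: "A \<in> carrier_mat n n" and B: "B \<in> carrier_mat m m"
  shows "similar_mat (diag_sum A B) (diag_sum B A)"
proof -
  \<comment> \<open>The block permutation matrix that exchanges the two groups of coordinates;
    \<open>Q\<close> undoes it.\<close>
  define P :: "'a mat" where "P = four_block_mat (0\<^sub>m n m) (1\<^sub>m n) (1\<^sub>m m) (0\<^sub>m m n)"
  define Q :: "'a mat" where "Q = four_block_mat (0\<^sub>m m n) (1\<^sub>m m) (1\<^sub>m n) (0\<^sub>m n m)"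
  have P: "P \<in> carrier_mat (n + m) (n + m)" and Q: "Q \<in> carrier_mat (n + m) (n + m)"
    unfolding P_def Q_def carrier_mat_def by simp_all
  have PQ: "P * Q = 1\<^sub>m (n + m)"
    unfolding P_def Q_def
    by (subst mult_four_block_mat[of _ n m _ n _ m _ _ n _ m]) (auto simp: four_block_one_mat)
  have "P * diag_sum B A = four_block_mat (0\<^sub>m n m) A B (0\<^sub>m m n)"
    using A B unfolding P_def diag_sum_def
    by (subst mult_four_block_mat[of _ n m _ n _ m _ _ m _ n]) auto
  then have "P * diag_sum B A * Q = diag_sum A B"
    using A B unfolding Q_def diag_sum_def
    by (simp, subst mult_four_block_mat[of _ n m _ n _ m _ _ n _ m]) auto
  then show ?thesis
    using P Q PQ mat_mult_left_right_inverse[OF P Q PQ] diag_sum_carrier[OF A B]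
      diag_sum_carrier[OF B A]
    by (intro similar_matI[where P = P and Q = Q and n = "n + m"]) (auto simp: add.commute)
qed

lemma block_matrix_append:
  assumes "\<forall>(f, k)\<in>set (L1 @ L2). f \<in> Phi \<and> 0 < k"
  shows "block_matrix (L1 @ L2) = diag_sum (block_matrix L1) (block_matrix L2)"
  using assms
proof (induction L1)
  case Nil
  show ?case by (rule eq_matI) (auto simp: diag_sum_def)
next
  case (Cons a L1)
  obtain f k where a: "a = (f, k)" by (cases a)
  have 1: "\<forall>(f, k)\<in>set L1. f \<in> Phi \<and> 0 < k" and 2: "\<forall>(f, k)\<in>set L2. f \<in> Phi \<and> 0 < k"
    using Cons.prems by auto
  have "block_matrix (L1 @ L2) = diag_sum (block_matrix L1) (block_matrix L2)"
    using Cons.IH Cons.prems by simp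
  then show ?case
    using diag_sum_assoc[OF companion_carrier block_matrix_carrier[OF 1] block_matrix_carrier[OF 2]]
    unfolding a by simp
qed

text \<open>\<open>has_type\<close> only asks for some order of the blocks. Independence of the
  order is what makes two matrices of the same type similar.\<close>

lemma similar_block_matrix_perm:
  assumes "\<forall>(f, k)\<in>set L. f \<in> Phi \<and> 0 < k" "mset L = mset L'"
  shows "similar_mat (block_matrix L) (block_matrix L')"
  using assms
proof (induction L arbitrary: L')
  case Nil
  then show ?case using similar_mat_refl[of "block_matrix []" 0] by simp
next
  case (Cons a L)
  obtain f k where a: "a = (f, k)" by (cases a)
  have good: "\<forall>(f, k)\<in>set L'. f \<in> Phi \<and> 0 < k"
    using Cons.prems mset_eq_setD by metis
  have "a \<in> set L'" using Cons.prems(2) by (metis list.set_intros(1) mset_eq_setD)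
  then obtain ys zs where L': "L' = ys @ a # zs" using split_list by metis
  have gL: "\<forall>(f, k)\<in>set L. f \<in> Phi \<and> 0 < k" using Cons.prems(1) by simp
  have gyz: "\<forall>(f, k)\<in>set (ys @ zs). f \<in> Phi \<and> 0 < k" using good L' by auto
  have gy: "\<forall>(f, k)\<in>set ys. f \<in> Phi \<and> 0 < k" and gz: "\<forall>(f, k)\<in>set zs. f \<in> Phi \<and> 0 < k"
    using gyz by auto
  note cy = block_matrix_carrier[OF gy] and cz = block_matrix_carrier[OF gz]
    and cL = block_matrix_carrier[OF gL]
  let ?C = "companion (f ^ k)"
  note cC = companion_carrier[of "f ^ k"]
  have "mset L = mset (ys @ zs)" using Cons.prems(2) L' by simp
  then have "similar_mat (block_matrix L) (block_matrix (ys @ zs))" by (rule Cons.IH[OF gL])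
  then have "similar_mat (diag_sum ?C (block_matrix L))
      (diag_sum ?C (diag_sum (block_matrix ys) (block_matrix zs)))"
    unfolding block_matrix_append[OF gyz]
    by (intro similar_diag_sum[OF similar_mat_refl[OF cC] _ cC cL])
  also have "diag_sum ?C (diag_sum (block_matrix ys) (block_matrix zs))
      = diag_sum (diag_sum ?C (block_matrix ys)) (block_matrix zs)"
    by (rule diag_sum_assoc[OF cC cy cz])
  finally have 1: "similar_mat (block_matrix (a # L)) (diag_sum (diag_sum ?C (block_matrix ys)) (block_matrix zs))"
    unfolding a by simp
  have 2: "similar_mat (diag_sum (diag_sum ?C (block_matrix ys)) (block_matrix zs))
      (diag_sum (diag_sum (block_matrix ys) ?C) (block_matrix zs))"
    by (rule similar_diag_sum[OF similar_diag_sum_commute[OF cC cy] similar_mat_refl[OF cz]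
        diag_sum_carrier[OF cC cy] cz])
  have "diag_sum (diag_sum (block_matrix ys) ?C) (block_matrix zs) = block_matrix L'"
    using block_matrix_append[of ys "a # zs"] good diag_sum_assoc[OF cy cC cz] unfolding L' a by simp
  then show ?case using similar_mat_trans[OF 1 2] by simp
qed

text \<open>Each part 1 at t - 1 is one fixed coordinate; \<open>modtype\<close> deletes exactly
  these parts.\<close>

lemma block_matrix_replicate_tm1: "block_matrix (replicate r (tm1, 1)) = 1\<^sub>m r"
proof (induction r)
  case (Suc r)
  have "companion (tm1 :: 'a poly) = 1\<^sub>m 1"
    by (rule eq_matI) (auto simp: companion_def tm1_def Let_def)
  then show ?case using Suc diag_sum_one[of 1 r] by simp
qed auto

text \<open>The identity block contributes \<open>r\<close> further parts 1 at t - 1, which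
  \<open>modtype\<close> deletes. Appended at the end they keep the list weakly decreasing, all
  parts being positive.\<close>

lemma has_modtype_diag_sum_one:
  fixes A :: "'a::{field,finite} mat"
  assumes A: "A \<in> carrier_mat m m" and mu: "has_modtype A mu"
  shows "has_modtype (diag_sum A (1\<^sub>m r)) mu"
proof -
  obtain lam where lam: "has_type A lam" "modtype lam = mu" using mu has_modtype_def by blast
  obtain L where L: "mset L = blocks lam" "similar_mat A (block_matrix L)"
    using lam has_type_iff by blast
  have P: "lam \<in> PPhi" using lam has_type_PPhi by blast
  define lam' where "lam' = lam(tm1 := lam tm1 @ replicate r 1)"
  have "supp_p lam' \<subseteq> insert tm1 (supp_p lam)" by (auto simp: supp_p_def lam'_def)
  moreover have "sorted_wrt (\<ge>) (replicate r (1::nat))" by (induction r) auto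
  then have "is_partition (lam' f)" for f
    using PPhi_partition[OF P, of f]
    by (auto simp: lam'_def is_partition_def sorted_wrt_append Suc_le_eq)
  ultimately have P': "lam' \<in> PPhi"
    using P tm1_Phi unfolding PPhi_def by (auto intro: finite_subset)
  let ?L = "L @ replicate r (tm1, 1)"
  have good: "\<forall>(f, k)\<in>set ?L. f \<in> Phi \<and> 0 < k"
    using blocks_good[OF P L(1)] tm1_Phi by auto
  have "mset ?L = blocks lam'"
  proof (rule multiset_eqI)
    fix x :: "'a poly \<times> nat"
    obtain f k where x: "x = (f, k)" by (cases x)
    show "count (mset ?L) x = count (blocks lam') x"
      unfolding x count_blocks[OF PPhi_finite[OF P']]
      by (simp add: L(1) count_blocks[OF PPhi_finite[OF P]] lam'_def)
  qed
  moreover have "similar_mat (diag_sum A (1\<^sub>m r)) (block_matrix ?L)"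
    unfolding block_matrix_append[OF good] block_matrix_replicate_tm1
    by (rule similar_diag_sum[OF L(2) similar_mat_refl A]) auto
  ultimately have "has_type (diag_sum A (1\<^sub>m r)) lam'" using P' has_type_iff by blast
  moreover have "modtype lam' = mu" using lam(2) by (auto simp: modtype_def lam'_def)
  ultimately show ?thesis using has_modtype_def by blast
qed

lemma mset_pred_parts:
  assumes "\<forall>k\<in>set xs. 0 < k"
  shows "mset xs = mset (map Suc (filter (\<lambda>k. 0 < k) (map (\<lambda>k. k - 1) xs)))
      + replicate_mset (length (filter (\<lambda>k. k = 1) xs)) 1"
    and "length xs = length (filter (\<lambda>k. 0 < k) (map (\<lambda>k. k - 1) xs)) + length (filter (\<lambda>k. k = 1) xs)"
  using assms by (induction xs) auto

text \<open>A type with modified type \<open>nu\<close> is determined by its number of parts 1 at t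
  - 1, and in size \<open>n\<close> this number must be n - m. So modified type and size together
  fix the conjugacy class, with a representative that grows only by an identity block.\<close>

lemma stable_representative:
  fixes nu :: "'a::{field,finite} poly \<Rightarrow> nat list"
  assumes nu: "nu \<in> PPhi"
  defines "m \<equiv> pnorm nu + length (epart nu)"
  obtains K where "K \<in> carrier_mat m m" "has_modtype K nu"
    "\<And>n g. g \<in> GL n \<Longrightarrow> has_modtype g nu \<Longrightarrow> m \<le> n \<and> similar_mat g (diag_sum K (1\<^sub>m (n - m)))"
proof -
  \<comment> \<open>The type of least size over \<open>nu\<close>: every part at t - 1 is raised by
    one and no part 1 is added.\<close>
  define lam0 where "lam0 = nu(tm1 := map Suc (nu tm1))"
  have pos: "\<forall>k\<in>set (nu f). 0 < k" for f using PPhi_partition[OF nu, of f] by (simp add: is_partition_def)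
  have "is_partition (lam0 f)" for f
    using PPhi_partition[OF nu, of f] by (auto simp: lam0_def is_partition_def sorted_wrt_map)
  moreover have "supp_p lam0 = supp_p nu" by (auto simp: lam0_def supp_p_def)
  ultimately have P0: "lam0 \<in> PPhi" using nu by (simp add: PPhi_def)
  have mod0: "modtype lam0 = nu"
    using pos[of tm1] by (auto simp: modtype_def lam0_def comp_def)
  obtain L0 where L0: "mset L0 = blocks lam0" using ex_mset by blast
  note good0 = blocks_good[OF P0 L0]
  define K where "K = block_matrix L0"
  have "pnorm lam0 = m"
    using pnorm_modtype[OF P0] mod0 by (simp add: m_def epart_def lam0_def)
  then have K: "K \<in> carrier_mat m m"
    using block_matrix_carrier[OF good0] pnorm_blocks[OF P0 L0] unfolding K_def by simp
  have "has_type K lam0"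
    using P0 L0 similar_mat_refl[OF K] unfolding has_type_iff K_def by blast
  then have Kt: "has_modtype K nu" using mod0 has_modtype_def by blast
  have "m \<le> n \<and> similar_mat g (diag_sum K (1\<^sub>m (n - m)))" if g: "g \<in> GL n" "has_modtype g nu" for n g
  proof -
    obtain lam where lam: "has_type g lam" "modtype lam = nu" using g has_modtype_def by blast
    have P: "lam \<in> PPhi" using lam has_type_PPhi by blast
    obtain L where L: "mset L = blocks lam" "similar_mat g (block_matrix L)"
      using lam has_type_iff by blast
    define r where "r = length (filter (\<lambda>k. k = 1) (lam tm1))"
    have posl: "\<forall>k\<in>set (lam tm1). 0 < k" using PPhi_partition[OF P] by (simp add: is_partition_def)
    have nut: "nu tm1 = filter (\<lambda>k. 0 < k) (map (\<lambda>k. k - 1) (lam tm1))"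
      using lam(2) by (auto simp: modtype_def)
    have nuf: "nu f = lam f" if "f \<noteq> tm1" for f using lam(2) that by (auto simp: modtype_def)
    have ms: "mset (lam tm1) = mset (map Suc (nu tm1)) + replicate_mset r 1"
      and len: "length (lam tm1) = length (nu tm1) + r"
      using mset_pred_parts[OF posl] unfolding nut r_def by simp_all
    have n: "n = m + r"
      using has_type_pnorm[OF lam(1) GL_carrier[OF g(1)]] pnorm_modtype[OF P] lam(2) len
      by (simp add: m_def epart_def)
    let ?L = "L0 @ replicate r (tm1, 1)"
    have good: "\<forall>(f, k)\<in>set ?L. f \<in> Phi \<and> 0 < k" using good0 tm1_Phi by auto
    have "mset L = mset ?L"
    proof (rule multiset_eqI)
      fix x :: "'a poly \<times> nat"
      obtain f k where x: "x = (f, k)" by (cases x)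
      have "count (mset L0) (f, k) = count (mset (lam0 f)) k"
        unfolding L0 by (rule count_blocks[OF PPhi_finite[OF P0]])
      moreover have "count (mset L) (f, k) = count (mset (lam f)) k"
        unfolding L(1) by (rule count_blocks[OF PPhi_finite[OF P]])
      ultimately show "count (mset L) x = count (mset ?L) x"
        unfolding x using ms nuf[of f] by (simp add: lam0_def)
    qed
    then have "similar_mat (block_matrix L) (block_matrix ?L)"
      by (rule similar_block_matrix_perm[OF blocks_good[OF P L(1)]])
    then have "similar_mat g (diag_sum K (1\<^sub>m r))"
      using similar_mat_trans[OF L(2)] unfolding block_matrix_append[OF good] block_matrix_replicate_tm1 K_def
      by blast
    then show ?thesis using n by simp
  qed
  then show ?thesis using that K Kt by blast
qed

section \<open>Factorizations of maximal norm\<close>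

definition mov_space :: "'a::comm_ring_1 mat \<Rightarrow> (nat \<Rightarrow> 'a) set" where
  "mov_space A = (\<lambda>x. mact A x - x) ` Fn (dim_row A)"

lemma add_subgroup_Fn: "add_subgroup (Fn n :: (nat \<Rightarrow> 'a::ab_group_add) set)"
  by (auto simp: add_subgroup_def Fn_def)

lemma add_subgroup_fix_space: "add_subgroup (fix_space A)"
  by (auto simp: add_subgroup_def fix_space_def Fn_def mact_diff)

lemma add_subgroup_mov_space: "add_subgroup (mov_space A)"
  unfolding add_subgroup_def
proof (intro conjI ballI)
  show "0 \<in> mov_space A" unfolding mov_space_def
    by (rule image_eqI[where x = 0]) (simp_all only: mact_zero, simp_all add: Fn_def)
  fix u v assume "u \<in> mov_space A" "v \<in> mov_space A"
  then obtain x y where xy: "x \<in> Fn (dim_row A)" "y \<in> Fn (dim_row A)"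
    "u = mact A x - x" "v = mact A y - y" unfolding mov_space_def by blast
  then have "u - v = mact A (x - y) - (x - y)" by (simp only: mact_diff) (simp add: fun_eq_iff)
  moreover have "x - y \<in> Fn (dim_row A)" using add_subgroup_Fn xy unfolding add_subgroup_def by blast
  ultimately show "u - v \<in> mov_space A" unfolding mov_space_def by blast
qed

lemma finite_fix_space: "finite (fix_space (A :: 'a::{field,finite} mat))"
  unfolding fix_space_def by (rule finite_subset[OF _ finite_Fn]) blast

lemma finite_mov_space: "finite (mov_space (A :: 'a::{field,finite} mat))"
  unfolding mov_space_def by (rule finite_imageI[OF finite_Fn])

lemma card_mov_space:
  fixes A :: "'a::{field,finite} mat"
  assumes A: "A \<in> carrier_mat n n" and mu: "has_modtype A mu"
  shows "card (mov_space A) = CARD('a) ^ pnorm mu"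
proof -
  have "card (Fn n :: (nat \<Rightarrow> 'a) set) = card {x \<in> Fn n. mact A x - x = 0} * card ((\<lambda>x. mact A x - x) ` Fn n)"
    by (rule card_kernel_image[OF finite_Fn add_subgroup_Fn]) (simp only: mact_diff, simp add: fun_eq_iff)
  moreover have "{x \<in> Fn n. mact A x - x = 0} = fix_space A"
    using A by (auto simp: fix_space_def fun_eq_iff)
  ultimately have eq: "card (fix_space A) * card (mov_space A) = CARD('a) ^ n"
    using A by (simp add: card_Fn mov_space_def)
  moreover have "CARD('a) ^ n > 0" by simp
  ultimately have "card (fix_space A) \<noteq> 0" by (cases "card (fix_space A)") simp_all
  moreover have "card (fix_space A) * card (mov_space A) = card (fix_space A) * CARD('a) ^ pnorm mu"
    using eq card_fix_space[OF A mu] by simp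
  ultimately show ?thesis by simp
qed

text \<open>From h k - 1 = (h - 1) k + (k - 1) the moved space of the product lies in the sum
  \<open>?M\<close>, whose cardinality is at most the product of the two. If the norms add up, both
  estimates are equalities. For the fixed spaces, the intersection has dimension at least n minus
  the two norms, which is then the dimension of the fixed space of the product.\<close>

lemma
  fixes h k :: "'a::{field,finite} mat"
  assumes hc: "h \<in> carrier_mat n n" and kc: "k \<in> carrier_mat n n"
    and h: "has_modtype h lam" and k: "has_modtype k mu" and hk: "has_modtype (h * k) nu"
  shows pnorm_mult: "pnorm nu \<le> pnorm lam + pnorm mu"
    and fix_space_mult: "pnorm nu = pnorm lam + pnorm mu \<Longrightarrow> fix_space (h * k) \<subseteq> fix_space h \<inter> fix_space k"
    and mov_space_mult: "pnorm nu = pnorm lam + pnorm mu \<Longrightarrow> mov_space h \<union> mov_space k \<subseteq> mov_space (h * k)"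
proof -
  let ?q = "CARD('a)"
  let ?M = "{x + y | x y. x \<in> mov_space h \<and> y \<in> mov_space k}"
  have hkc: "h * k \<in> carrier_mat n n" using hc kc by simp
  have mm: "mact (h * k) x = mact h (mact k x)" for x by (rule mact_mult[OF hc kc])
  have mov: "mov_space (h * k) \<subseteq> ?M"
  proof
    fix z assume "z \<in> mov_space (h * k)"
    then obtain x where x: "x \<in> Fn n" "z = mact (h * k) x - x" using hkc unfolding mov_space_def by auto
    have "z = (mact h (mact k x) - mact k x) + (mact k x - x)" unfolding x(2) mm by (simp add: fun_eq_iff)
    moreover have "mact h (mact k x) - mact k x \<in> mov_space h"
      unfolding mov_space_def using hc mact_in_Fn[OF kc, of x] by auto
    moreover have "mact k x - x \<in> mov_space k" unfolding mov_space_def using kc x(1) by auto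
    ultimately show "z \<in> ?M" by blast
  qed
  have finM: "finite ?M"
  proof -
    have "?M = (\<lambda>(x, y). x + y) ` (mov_space h \<times> mov_space k)" by auto
    then show ?thesis using finite_mov_space by (metis finite_SigmaI finite_imageI)
  qed
  have "card (mov_space h) * card (mov_space k) = card (mov_space h \<inter> mov_space k) * card ?M"
    by (rule card_sum_inter[OF finite_mov_space finite_mov_space add_subgroup_mov_space add_subgroup_mov_space])
  moreover have "card (mov_space h \<inter> mov_space k) \<ge> 1"
  proof -
    have "0 \<in> mov_space h \<inter> mov_space k" using add_subgroup_mov_space unfolding add_subgroup_def by blast
    then show ?thesis using finite_mov_space by (metis One_nat_def Suc_leI card_gt_0_iff empty_iff finite_Int)
  qed
  ultimately have "card ?M \<le> card (mov_space h) * card (mov_space k)" by (cases "card (mov_space h \<inter> mov_space k)") auto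
  then have cM: "card ?M \<le> ?q ^ (pnorm lam + pnorm mu)"
    using card_mov_space[OF hc h] card_mov_space[OF kc k] by (simp add: power_add)
  have "?q ^ pnorm nu \<le> ?q ^ (pnorm lam + pnorm mu)"
    using card_mono[OF finM mov] cM card_mov_space[OF hkc hk] by simp
  then show "pnorm nu \<le> pnorm lam + pnorm mu"
    by (rule power_le_imp_le_exp[rotated]) (use two_le_card_field[where 'a = 'a] in simp)
  assume eq: "pnorm nu = pnorm lam + pnorm mu"
  have "mov_space (h * k) = ?M"
    by (rule card_seteq[OF finM mov]) (use cM card_mov_space[OF hkc hk] eq in simp)
  moreover have "mov_space h \<union> mov_space k \<subseteq> ?M"
  proof -
    have "0 \<in> mov_space h" "0 \<in> mov_space k" using add_subgroup_mov_space unfolding add_subgroup_def by blast+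
    moreover have "x = x + 0" "x = 0 + x" for x :: "nat \<Rightarrow> 'a" by (simp_all only: add_0_left add_0_right)
    ultimately show ?thesis by blast
  qed
  ultimately show "mov_space h \<union> mov_space k \<subseteq> mov_space (h * k)" by simp
  let ?S = "{x + y | x y. x \<in> fix_space h \<and> y \<in> fix_space k}"
  have "?S \<subseteq> Fn n"
    using hc kc by (auto simp: fix_space_def Fn_def)
  from card_mono[OF finite_Fn this] have cS: "card ?S \<le> ?q ^ n" by (simp only: card_Fn)
  have int: "card (fix_space h) * card (fix_space k) = card (fix_space h \<inter> fix_space k) * card ?S"
    by (rule card_sum_inter[OF finite_fix_space finite_fix_space add_subgroup_fix_space add_subgroup_fix_space])
  have sub: "fix_space h \<inter> fix_space k \<subseteq> fix_space (h * k)"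
    using hc kc hkc unfolding fix_space_def by (auto simp: mm)
  \<comment> \<open>Both sides are q^(2n). Multiplying through by powers of q replaces the dimension
    formula with its subtractions.\<close>
  have "card (fix_space (h * k)) * ?q ^ pnorm nu * ?q ^ n
      = (card (fix_space h) * ?q ^ pnorm lam) * (card (fix_space k) * ?q ^ pnorm mu)"
    using card_fix_space[OF hc h] card_fix_space[OF kc k] card_fix_space[OF hkc hk] by simp
  also have "\<dots> = card (fix_space h \<inter> fix_space k) * card ?S * ?q ^ pnorm nu"
    unfolding int[symmetric] eq by (simp add: power_add)
  also have "\<dots> \<le> card (fix_space h \<inter> fix_space k) * ?q ^ n * ?q ^ pnorm nu"
    using cS by simp
  finally have "card (fix_space (h * k)) \<le> card (fix_space h \<inter> fix_space k)"
    by (simp add: ac_simps)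
  from card_seteq[OF finite_fix_space sub this] show "fix_space (h * k) \<subseteq> fix_space h \<inter> fix_space k" by simp
qed

lemma mact_diag_sum_one:
  assumes "K \<in> carrier_mat m m" "x \<in> Fn (m + r)"
  shows "mact (diag_sum K (1\<^sub>m r)) x = (\<lambda>i. if i < m then mact K x i else x i)"
proof -
  have x: "x = join m x (\<lambda>i. x (m + i))" by (auto simp: join_def)
  have "(\<lambda>i. x (m + i)) \<in> Fn r" using assms(2) by (auto simp: Fn_def)
  then have "mact (diag_sum K (1\<^sub>m r)) x = join m (mact K x) (\<lambda>i. x (m + i))"
    using mact_diag_sum[OF assms(1) one_carrier_mat, of r x "\<lambda>i. x (m + i)"] x mact_one by metis
  then show ?thesis by (auto simp: join_def)
qed

text \<open>The two inclusions control different entries of \<open>h\<close>. A unit vector with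
  index from \<open>m\<close> on is fixed by K \<oplus> 1, hence by \<open>h\<close>, which gives
  the last \<open>r\<close> columns. Vectors moved by K \<oplus> 1 vanish in the coordinates from
  \<open>m\<close> on, hence so do those moved by \<open>h\<close>, which gives the last
  \<open>r\<close> rows.\<close>

lemma diag_sum_one_form:
  fixes h K :: "'a::{field,finite} mat"
  assumes h: "h \<in> carrier_mat (m + r) (m + r)" and K: "K \<in> carrier_mat m m"
    and fx: "fix_space (diag_sum K (1\<^sub>m r)) \<subseteq> fix_space h"
    and mv: "mov_space h \<subseteq> mov_space (diag_sum K (1\<^sub>m r))"
  shows "\<exists>h0\<in>carrier_mat m m. h = diag_sum h0 (1\<^sub>m r)"
proof -
  let ?D = "diag_sum K (1\<^sub>m r)"
  define h0 where "h0 = mat m m (\<lambda>(i, j). h $$ (i, j))"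
  have h0: "h0 \<in> carrier_mat m m" by (simp add: h0_def)
  have D: "?D \<in> carrier_mat (m + r) (m + r)" by (rule diag_sum_carrier[OF K one_carrier_mat])
  have uF: "unit_fun j \<in> Fn (m + r)" if "j < m + r" for j
    using that by (auto simp: Fn_def unit_fun_def)
  have col: "h $$ (i, j) = (if i = j then 1 else 0)" if ij: "i < m + r" "j < m + r" "m \<le> j" for i j
  proof -
    have "mact K (unit_fun j) i = 0" if "i < m" for i
      using that ij K by (auto simp: mact_def unit_fun_def intro!: sum.neutral)
    then have "mact ?D (unit_fun j) = unit_fun j"
      using mact_diag_sum_one[OF K uF[OF ij(2)]] ij(3) by (auto simp: unit_fun_def fun_eq_iff)
    then have "unit_fun j \<in> fix_space ?D" using D uF[OF ij(2)] by (simp add: fix_space_def)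
    then have "mact h (unit_fun j) = unit_fun j" using fx by (auto simp: fix_space_def)
    then have "(\<lambda>i. if i < m + r then h $$ (i, j) else 0) = unit_fun j"
      using mact_unit_fun[OF h ij(2)] by simp
    from fun_cong[OF this, of i] show ?thesis using ij(1) by (simp add: unit_fun_def)
  qed
  have row: "h $$ (i, j) = (if i = j then 1 else 0)" if ij: "i < m + r" "j < m + r" "m \<le> i" for i j
  proof -
    have "mact h (unit_fun j) - unit_fun j \<in> mov_space h"
      using h uF[OF ij(2)] unfolding mov_space_def by auto
    then have "mact h (unit_fun j) - unit_fun j \<in> mov_space ?D" using mv by blast
    then obtain x where x: "x \<in> Fn (m + r)" "mact h (unit_fun j) - unit_fun j = mact ?D x - x"
      using D unfolding mov_space_def by auto
    have "mact h (unit_fun j) i - unit_fun j i = mact ?D x i - x i"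
      using fun_cong[OF x(2), of i] by simp
    also have "\<dots> = 0" using mact_diag_sum_one[OF K x(1)] ij(3) by simp
    finally show ?thesis using mact_unit_fun[OF h ij(2)] ij(1) by (simp add: unit_fun_def)
  qed
  have "h = diag_sum h0 (1\<^sub>m r)"
  proof (rule eq_matI)
    fix i j assume "i < dim_row (diag_sum h0 (1\<^sub>m r))" "j < dim_col (diag_sum h0 (1\<^sub>m r))"
    then have ij: "i < m + r" "j < m + r" by (simp_all add: h0_def diag_sum_def)
    then show "h $$ (i, j) = diag_sum h0 (1\<^sub>m r) $$ (i, j)"
      using col[of i j] row[of i j] unfolding diag_sum_index[OF h0 one_carrier_mat ij]
      by (auto simp: h0_def)
  qed (use h in \<open>simp_all add: h0_def diag_sum_def\<close>)
  then show ?thesis using h0 by blast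
qed

section \<open>Convolution on the general linear group\<close>

lemma GL_mult: "A \<in> GL n \<Longrightarrow> B \<in> GL n \<Longrightarrow> A * B \<in> GL n"
proof -
  assume A: "A \<in> GL n" and B: "B \<in> GL n"
  obtain A' where A': "A' \<in> carrier_mat n n" "A * A' = 1\<^sub>m n" using A by (rule GL_inverse)
  obtain B' where B': "B' \<in> carrier_mat n n" "B * B' = 1\<^sub>m n" using B by (rule GL_inverse)
  note c = GL_carrier[OF A] GL_carrier[OF B] A'(1) B'(1)
  have "A * B * (B' * A') = A * (B * (B' * A'))" using c by (intro assoc_mult_mat) auto
  also have "B * (B' * A') = B * B' * A'" using c by (intro assoc_mult_mat[symmetric]) auto
  finally have "A * B * (B' * A') = 1\<^sub>m n" using c A'(2) B'(2) by simp
  then show ?thesis using c by (intro GL_intro[of _ _ "B' * A'"]) auto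
qed

lemma GL_diag_sum_one_iff:
  assumes "A \<in> carrier_mat m m"
  shows "diag_sum A (1\<^sub>m r) \<in> GL (m + r) \<longleftrightarrow> A \<in> GL m"
proof
  assume "A \<in> GL m"
  then obtain B where B: "B \<in> carrier_mat m m" "A * B = 1\<^sub>m m" by (rule GL_inverse)
  then have "diag_sum A (1\<^sub>m r) * diag_sum B (1\<^sub>m r) = 1\<^sub>m (m + r)"
    by (simp add: diag_sum_mult[OF assms B(1) one_carrier_mat one_carrier_mat] diag_sum_one)
  then show "diag_sum A (1\<^sub>m r) \<in> GL (m + r)"
    by (rule GL_intro[OF diag_sum_carrier[OF assms one_carrier_mat] diag_sum_carrier[OF B(1) one_carrier_mat]])
next
  assume "diag_sum A (1\<^sub>m r) \<in> GL (m + r)"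
  then obtain B where B: "B \<in> carrier_mat (m + r) (m + r)" "diag_sum A (1\<^sub>m r) * B = 1\<^sub>m (m + r)"
    by (rule GL_inverse)
  \<comment> \<open>The upper left corner of the inverse; the first \<open>m\<close> rows of A
    \<oplus> 1 meet only this part of the rows of \<open>B\<close>.\<close>
  define B0 where "B0 = mat m m (\<lambda>(i, j). B $$ (i, j))"
  have D: "diag_sum A (1\<^sub>m r) \<in> carrier_mat (m + r) (m + r)" by (rule diag_sum_carrier[OF assms one_carrier_mat])
  have "A * B0 = 1\<^sub>m m"
  proof (rule eq_matI)
    fix i j assume "i < dim_row (1\<^sub>m m :: 'a mat)" "j < dim_col (1\<^sub>m m :: 'a mat)"
    then have ij: "i < m" "j < m" by simp_all
    have "(diag_sum A (1\<^sub>m r) * B) $$ (i, j) = (\<Sum>l<m + r. diag_sum A (1\<^sub>m r) $$ (i, l) * B $$ (l, j))"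
      using ij B(1) D by (simp add: scalar_prod_def atLeast0LessThan)
    also have "\<dots> = (\<Sum>l<m. A $$ (i, l) * B $$ (l, j))"
      unfolding sum_lessThan_add using ij by (simp add: diag_sum_index[OF assms one_carrier_mat])
    also have "\<dots> = (A * B0) $$ (i, j)"
      using ij assms by (simp add: B0_def scalar_prod_def atLeast0LessThan)
    finally show "(A * B0) $$ (i, j) = 1\<^sub>m m $$ (i, j)" using B(2) ij by simp
  qed (use assms in \<open>simp_all add: B0_def\<close>)
  then show "A \<in> GL m" using assms by (intro GL_intro[of _ _ B0]) (simp_all add: B0_def)
qed

lemma finite_GL: "finite (GL n :: 'a::{field,finite} mat set)"
proof -
  let ?I = "{..<n} \<times> {..<n}"
  have "GL n \<subseteq> (\<lambda>f. mat n n f) ` (?I \<rightarrow>\<^sub>E (UNIV :: 'a set))"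
  proof
    fix A :: "'a mat" assume "A \<in> GL n"
    then have "A = mat n n (restrict (\<lambda>ij. A $$ ij) ?I)" using GL_carrier[of A n] by (intro eq_matI) auto
    moreover have "restrict (\<lambda>ij. A $$ ij) ?I \<in> ?I \<rightarrow>\<^sub>E UNIV" by auto
    ultimately show "A \<in> (\<lambda>f. mat n n f) ` (?I \<rightarrow>\<^sub>E UNIV)" by blast
  qed
  moreover have "finite (?I \<rightarrow>\<^sub>E (UNIV :: 'a set))" by (intro finite_PiE) auto
  ultimately show ?thesis using finite_subset by blast
qed

definition factorizations :: "nat \<Rightarrow> 'a::{field,finite} mat \<Rightarrow> ('a mat \<times> 'a mat) set" where
  "factorizations n g = {(h, k). h \<in> GL n \<and> k \<in> GL n \<and> h * k = g}"

lemma finite_factorizations: "finite (factorizations n g)"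
  by (rule finite_subset[of _ "GL n \<times> GL n"]) (auto simp: factorizations_def finite_GL)

lemma conv_factorizations:
  "g \<in> GL n \<Longrightarrow> conv n x y g = (\<Sum>p\<in>factorizations n g. x (fst p) * y (snd p))"
  by (simp add: conv_def factorizations_def)

text \<open>Conjugation maps the factorizations of \<open>g\<close> bijectively to those of
  \<open>g'\<close> and preserves the modified types of both factors.\<close>

lemma conv_similar:
  assumes sim: "similar_mat g g'" and g: "g \<in> GL n" and g': "g' \<in> GL n"
  shows "conv n (Ksum n lam) (Ksum n mu) g = conv n (Ksum n lam) (Ksum n mu) g'"
proof -
  obtain P Q where PQ: "P \<in> carrier_mat n n" "Q \<in> carrier_mat n n" "P * Q = 1\<^sub>m n" "Q * P = 1\<^sub>m n"
    "g = P * g' * Q"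
    using similar_mat_intertwiner[OF sim GL_carrier[OF g]] by metis
  have PG: "P \<in> GL n" "Q \<in> GL n" using PQ GL_intro by blast+
  have canc: "P * (Q * X) = X" "Q * (P * X) = X" if "X \<in> carrier_mat n n" for X
    using that PQ by (simp_all flip: assoc_mult_mat[of _ n n _ n _ n])
  note as = assoc_mult_mat[of _ n n _ n _ n]
  define c where "c X = Q * X * P" for X
  define d where "d X = P * X * Q" for X
  have cd: "c (d X) = X" "d (c X) = X" if "X \<in> GL n" for X
    using GL_carrier[OF that] PQ unfolding c_def d_def by (simp_all add: as canc)
  have cG: "c X \<in> GL n" "d X \<in> GL n" if "X \<in> GL n" for X
    unfolding c_def d_def using that PG by (auto intro: GL_mult)
  have cm: "c X * c Y = c (X * Y)" "d X * d Y = d (X * Y)" if "X \<in> GL n" "Y \<in> GL n" for X Y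
    using GL_carrier[OF that(1)] GL_carrier[OF that(2)] PQ unfolding c_def d_def by (simp_all add: as canc)
  have cg: "c g = g'" "d g' = g" using cd[OF g'] PQ(5) d_def by auto
  then have cg': "c (a * b) = g'" if "g = a * b" for a b using that by simp
  have dg': "d (a * b) = g" if "g' = a * b" for a b using cg(2) that by simp
  have cs: "Ksum n l (c X) = Ksum n l X" if "X \<in> GL n" for X l
  proof -
    have "similar_mat X (c X)"
      using cd[OF that] GL_carrier[OF that] GL_carrier[OF cG(1)[OF that]] PQ unfolding d_def
      by (intro similar_matI[where P = P and Q = Q]) auto
    then show ?thesis using that cG has_modtype_similar unfolding Ksum_def by metis
  qed
  have "(\<Sum>p\<in>factorizations n g. Ksum n lam (fst p) * Ksum n mu (snd p))
      = (\<Sum>p\<in>factorizations n g'. Ksum n lam (fst p) * Ksum n mu (snd p))"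
  proof (rule sum.reindex_bij_betw[symmetric, THEN trans, symmetric, OF _ sum.cong[OF refl]])
    show "bij_betw (\<lambda>(h, k). (c h, c k)) (factorizations n g) (factorizations n g')"
      by (rule bij_betwI[where g = "\<lambda>(h, k). (d h, d k)"])
        (auto simp: factorizations_def cd cG cm cg' dg')
  qed (auto simp: factorizations_def cs)
  then show ?thesis using g g' by (simp add: conv_factorizations)
qed

text \<open>That enlarging creates no new modified type needs existence and uniqueness:
  \<open>h\<close> has some modified type, the enlarged matrix inherits it and can have no
  other.\<close>

lemma Ksum_diag_sum_one:
  assumes "h \<in> GL m"
  shows "Ksum (m + r) lam (diag_sum h (1\<^sub>m r)) = Ksum m lam h"
proof -
  have c: "h \<in> carrier_mat m m" using assms by (rule GL_carrier)
  obtain mu where "has_modtype h mu" using ex_modtype assms by blast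
  then have "has_modtype (diag_sum h (1\<^sub>m r)) lam \<longleftrightarrow> has_modtype h lam"
    using has_modtype_diag_sum_one[OF c] has_modtype_unique by metis
  then show ?thesis using assms c by (simp add: Ksum_def GL_diag_sum_one_iff)
qed

text \<open>The map \<open>?\<phi>\<close> embeds the factorizations of \<open>K\<close> into those
  of K \<oplus> 1. A nonzero term outside the image would have factors of types \<open>lam\<close>
  and \<open>mu\<close>, so the norm would be additive on it and \<open>diag_sum_one_form\<close>
  would put both factors into block form, hence into the image.\<close>

lemma conv_diag_sum_one:
  fixes K :: "'a::{field,finite} mat"
  assumes K: "K \<in> GL m" and nu: "has_modtype K nu" and eq: "pnorm nu = pnorm lam + pnorm mu"
  shows "conv (m + r) (Ksum (m + r) lam) (Ksum (m + r) mu) (diag_sum K (1\<^sub>m r))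
    = conv m (Ksum m lam) (Ksum m mu) K"
proof -
  let ?n = "m + r" and ?D = "\<lambda>h. diag_sum h (1\<^sub>m r :: 'a mat)"
  let ?\<phi> = "\<lambda>(h, k). (?D h, ?D k)"
  have Kc: "K \<in> carrier_mat m m" using K by (rule GL_carrier)
  have DK: "?D K \<in> GL ?n" using K GL_diag_sum_one_iff[OF Kc] by simp
  have nuD: "has_modtype (?D K) nu" by (rule has_modtype_diag_sum_one[OF Kc nu])
  have mult: "?D h * ?D k = ?D (h * k)" if "h \<in> carrier_mat m m" "k \<in> carrier_mat m m" for h k
    using diag_sum_mult[OF that one_carrier_mat one_carrier_mat] by simp
  have inj: "inj_on ?\<phi> (factorizations m K)"
    by (auto simp: inj_on_def factorizations_def dest!: GL_carrier dest: diag_sum_inj[OF _ _ one_carrier_mat])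
  have "(\<Sum>p\<in>factorizations ?n (?D K). Ksum ?n lam (fst p) * Ksum ?n mu (snd p))
      = (\<Sum>p\<in>?\<phi> ` factorizations m K. Ksum ?n lam (fst p) * Ksum ?n mu (snd p))"
  proof (rule sum.mono_neutral_right[OF finite_factorizations])
    show "?\<phi> ` factorizations m K \<subseteq> factorizations ?n (?D K)"
      by (auto simp: factorizations_def GL_carrier GL_diag_sum_one_iff mult)
    show "\<forall>p\<in>factorizations ?n (?D K) - ?\<phi> ` factorizations m K.
        Ksum ?n lam (fst p) * Ksum ?n mu (snd p) = 0"
    proof (rule ballI, rule ccontr)
      fix p assume p: "p \<in> factorizations ?n (?D K) - ?\<phi> ` factorizations m K"
        and nz: "Ksum ?n lam (fst p) * Ksum ?n mu (snd p) \<noteq> 0"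
      obtain h k where hk: "p = (h, k)" by (cases p)
      have G: "h \<in> GL ?n" "k \<in> GL ?n" "h * k = ?D K" using p hk by (auto simp: factorizations_def)
      note C = G(1,2)[THEN GL_carrier]
      have T: "has_modtype h lam" "has_modtype k mu"
        using nz hk by (auto simp: Ksum_def split: if_splits)
      note nu' = nuD[folded G(3)]
      have fx: "fix_space (?D K) \<subseteq> fix_space h \<inter> fix_space k"
        and mv: "mov_space h \<union> mov_space k \<subseteq> mov_space (?D K)"
        using fix_space_mult[OF C T nu' eq] mov_space_mult[OF C T nu' eq] G(3) by simp_all
      obtain h0 where h0: "h0 \<in> carrier_mat m m" "h = ?D h0"
        using diag_sum_one_form[OF C(1) Kc] fx mv by blast
      obtain k0 where k0: "k0 \<in> carrier_mat m m" "k = ?D k0"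
        using diag_sum_one_form[OF C(2) Kc] fx mv by blast
      have "?D (h0 * k0) = ?D K" using mult[OF h0(1) k0(1)] G(3) h0(2) k0(2) by simp
      then have "h0 * k0 = K"
        using diag_sum_inj[OF _ Kc one_carrier_mat] h0(1) k0(1) by (meson mult_carrier_mat)
      then have "(h0, k0) \<in> factorizations m K"
        using G h0 k0 by (simp add: factorizations_def GL_diag_sum_one_iff)
      then have "p \<in> ?\<phi> ` factorizations m K" using hk h0 k0 by force
      then show False using p by blast
    qed
  qed
  also have "\<dots> = (\<Sum>p\<in>factorizations m K. Ksum m lam (fst p) * Ksum m mu (snd p))"
    unfolding sum.reindex[OF inj]
    by (rule sum.cong) (auto simp: factorizations_def Ksum_diag_sum_one)
  finally show ?thesis using K DK by (simp add: conv_factorizations)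
qed

section \<open>The graded ring\<close>

lemma pnorm_bounds:
  assumes lam: "lam \<in> PPhi" and f: "lam f \<noteq> []"
  shows "degree f \<le> pnorm lam" "sum_list (lam f) \<le> pnorm lam" "length (lam f) \<le> pnorm lam"
proof -
  have fS: "f \<in> supp_p lam" using f by (simp add: supp_p_def)
  then have d: "degree f > 0" using lam Phi_props(4) by (auto simp: PPhi_def)
  have pos: "\<forall>k\<in>set (lam f). 0 < k" using PPhi_partition[OF lam, of f] by (simp add: is_partition_def)
  have l: "length xs \<le> sum_list xs" if "\<forall>k\<in>set xs. 0 < k" for xs :: "nat list"
    using that by (induction xs) auto
  have s: "0 < sum_list (lam f)" using l[OF pos] f by (cases "lam f") auto
  have le: "degree f * sum_list (lam f) \<le> pnorm lam"
    unfolding pnorm_def using fS PPhi_finite[OF lam]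
    by (intro member_le_sum[where f = "\<lambda>f. degree f * sum_list (lam f)"]) auto
  have "degree f * 1 \<le> degree f * sum_list (lam f)" using s by (intro mult_le_mono2) simp
  then show "degree f \<le> pnorm lam" using order_trans[OF _ le] by simp
  have "1 * sum_list (lam f) \<le> degree f * sum_list (lam f)" using d by (intro mult_le_mono1) simp
  then show "sum_list (lam f) \<le> pnorm lam" using order_trans[OF _ le] by simp
  then show "length (lam f) \<le> pnorm lam" using l[OF pos] by simp
qed

text \<open>Over a finite field there are finitely many polynomials of bounded degree, and the
  partitions attached to them are bounded as well. This gives the sums in \<open>Kfilt\<close> and
  \<open>grmap\<close> their meaning, since \<open>sum\<close> over an infinite set is 0.\<close>

lemma finite_PPhi_pnorm_le: "finite {lam \<in> (PPhi :: ('a::{field,finite} poly \<Rightarrow> nat list) set). pnorm lam \<le> m}"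
proof -
  let ?A = "{p::'a poly. \<forall>i\<ge>Suc m. coeff p i = 0}"
  let ?B = "{xs. set xs \<subseteq> {..m} \<and> length xs \<le> m}"
  have "finite ?A" by (rule card_ge_0_finite) (simp add: card_poly_degree_less)
  moreover have "finite ?B" by (rule finite_lists_length_le) simp
  ultimately have "finite {lam. \<forall>f. (f \<in> ?A \<longrightarrow> lam f \<in> ?B) \<and> (f \<notin> ?A \<longrightarrow> lam f = [])}"
    by (rule finite_set_of_finite_funs)
  moreover have "{lam \<in> PPhi. pnorm lam \<le> m}
      \<subseteq> {lam. \<forall>f. (f \<in> ?A \<longrightarrow> lam f \<in> ?B) \<and> (f \<notin> ?A \<longrightarrow> lam f = [])}"
  proof (rule subsetI, rule CollectI, rule allI)
    fix lam :: "'a poly \<Rightarrow> nat list" and f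
    assume "lam \<in> {lam \<in> PPhi. pnorm lam \<le> m}"
    then have lam: "lam \<in> PPhi" "pnorm lam \<le> m" by simp_all
    show "(f \<in> ?A \<longrightarrow> lam f \<in> ?B) \<and> (f \<notin> ?A \<longrightarrow> lam f = [])"
    proof (cases "lam f = []")
      case False
      note b = pnorm_bounds[OF lam(1) False]
      have "coeff f i = 0" if "i \<ge> Suc m" for i using b(1) lam(2) that by (intro coeff_eq_0) simp
      moreover have "k \<le> m" if "k \<in> set (lam f)" for k
        using member_le_sum_list[OF that] b(2) lam(2) by simp
      moreover have "length (lam f) \<le> m" using b(3) lam(2) by simp
      ultimately show ?thesis by auto
    qed simp
  qed
  ultimately show ?thesis by (rule finite_subset[rotated])
qed

text \<open>On \<open>GL n\<close> the choice is forced by \<open>has_modtype_unique\<close>.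
  \<open>Ksum n mu\<close> becomes the indicator of a fibre, and a combination of such terms
  collapses to a single value, as in \<open>sum_Ksum\<close>.\<close>

definition mtype :: "'a::{field,finite} mat \<Rightarrow> 'a poly \<Rightarrow> nat list" where
  "mtype g = (SOME mu. has_modtype g mu)"

lemma has_modtype_mtype: "g \<in> GL n \<Longrightarrow> has_modtype g (mtype g)"
  unfolding mtype_def using someI_ex[OF ex_modtype] .

lemma has_modtype_iff: "g \<in> GL n \<Longrightarrow> has_modtype g mu \<longleftrightarrow> mu = mtype g"
  using has_modtype_mtype has_modtype_unique by metis

lemma mtype_PPhi: "g \<in> GL n \<Longrightarrow> mtype g \<in> PPhi"
  using has_modtype_mtype has_modtype_PPhi by metis

lemma Ksum_mtype: "Ksum n mu g = (if g \<in> GL n \<and> mu = mtype g then 1 else 0)"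
  unfolding Ksum_def using has_modtype_iff by metis

lemma sum_Ksum:
  assumes "finite S"
  shows "(\<Sum>lam\<in>S. c lam * Ksum n lam g) = (if g \<in> GL n \<and> mtype g \<in> S then c (mtype g) else 0)"
proof (cases "g \<in> GL n")
  case True
  then have "(\<Sum>lam\<in>S. c lam * Ksum n lam g) = (\<Sum>lam\<in>S. if lam = mtype g then c lam else 0)"
    by (intro sum.cong) (auto simp: Ksum_mtype)
  then show ?thesis using assms True by simp
qed (simp add: Ksum_mtype)

text \<open>Indicators of disjoint fibres combine to an arbitrary function of the modified type.
  Membership in a filtration step thus becomes a pointwise condition, the form in which every later
  membership is proved.\<close>

lemma Kfilt_iff:
  "x \<in> Kfilt n i \<longleftrightarrow> (\<exists>c. \<forall>g. x g = (if g \<in> GL n \<and> int (pnorm (mtype g)) \<le> i then c (mtype g) else 0))"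
proof -
  let ?S = "{lam \<in> PPhi. int (pnorm lam) \<le> i}"
  have fin: "finite ?S"
    by (rule finite_subset[OF _ finite_PPhi_pnorm_le[of "nat i"]]) auto
  show ?thesis
    unfolding Kfilt_def sum_Ksum[OF fin] using mtype_PPhi by (auto simp: fun_eq_iff cong: conj_cong)
qed

lemma grmap_eq: "grmap n x i g = (if g \<in> GL n \<and> pnorm (mtype g) = i then x (mtype g) else 0)"
proof -
  have fin: "finite {lam \<in> PPhi. pnorm lam = i}"
    by (rule finite_subset[OF _ finite_PPhi_pnorm_le[of i]]) auto
  show ?thesis unfolding grmap_def sum_Ksum[OF fin] using mtype_PPhi by auto
qed

text \<open>\<open>strc\<close> evaluates at a chosen element of the modified type. Any other one in
  \<open>GL n\<close> is similar to it, both being similar to the same K \<oplus> 1.\<close>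

lemma conv_eq_strc:
  assumes g: "g \<in> GL n"
  shows "conv n (Ksum n lam) (Ksum n mu) g = strc n (mtype g) lam mu"
proof -
  let ?nu = "mtype g"
  define g' where "g' = (SOME g. g \<in> GL n \<and> has_modtype g ?nu)"
  have gt: "has_modtype g ?nu" using g by (rule has_modtype_mtype)
  then have g': "g' \<in> GL n" "has_modtype g' ?nu"
    unfolding g'_def using g someI_ex[of "\<lambda>g. g \<in> GL n \<and> has_modtype g ?nu"] by blast+
  obtain K where K: "\<And>n g. g \<in> GL n \<Longrightarrow> has_modtype g ?nu \<Longrightarrow>
      similar_mat g (diag_sum K (1\<^sub>m (n - (pnorm ?nu + length (epart ?nu)))))"
    using stable_representative[OF mtype_PPhi[OF g]] by metis
  have "similar_mat g g'"
    using similar_mat_trans[OF K[OF g gt] similar_mat_sym[OF K[OF g']]] .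
  then have "conv n (Ksum n lam) (Ksum n mu) g = conv n (Ksum n lam) (Ksum n mu) g'"
    using g g'(1) by (rule conv_similar)
  then show ?thesis unfolding strc_def g'_def using g gt by auto
qed

lemma conv_nonzero_factors:
  assumes "conv n x y g \<noteq> 0"
  obtains h k where "h \<in> GL n" "k \<in> GL n" "h * k = g" "x h \<noteq> 0" "y k \<noteq> 0"
proof -
  have "g \<in> GL n" using assms by (auto simp: conv_def split: if_splits)
  then have "(\<Sum>p\<in>factorizations n g. x (fst p) * y (snd p)) \<noteq> 0"
    using assms by (simp add: conv_factorizations)
  then obtain p where "p \<in> factorizations n g" "x (fst p) * y (snd p) \<noteq> 0"
    by (rule sum.not_neutral_contains_not_neutral)
  then show ?thesis using that by (auto simp: factorizations_def)
qed

lemma strc_high: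
  assumes g: "g \<in> GL n" and lt: "pnorm lam + pnorm mu < pnorm (mtype g)"
  shows "strc n (mtype g) lam mu = 0"
proof (rule ccontr)
  assume "strc n (mtype g) lam mu \<noteq> 0"
  then have "conv n (Ksum n lam) (Ksum n mu) g \<noteq> 0" using conv_eq_strc[OF g] by simp
  then obtain h k where hk: "h \<in> GL n" "k \<in> GL n" "h * k = g" "Ksum n lam h \<noteq> 0" "Ksum n mu k \<noteq> 0"
    by (rule conv_nonzero_factors)
  then have "has_modtype h lam" "has_modtype k mu" by (auto simp: Ksum_def split: if_splits)
  then have "pnorm (mtype g) \<le> pnorm lam + pnorm mu"
    using pnorm_mult[OF GL_carrier[OF hk(1)] GL_carrier[OF hk(2)]] has_modtype_mtype[OF g] hk(3) by blast
  then show False using lt by simp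
qed

text \<open>\<open>conv_similar\<close> moves the coefficient from \<open>g\<close> to K \<oplus> 1,
  and \<open>conv_diag_sum_one\<close> moves it on to \<open>K\<close>, whose size is the one at
  which \<open>astab\<close> is read.\<close>

lemma strc_eq_astab:
  assumes g: "g \<in> GL n" and eq: "pnorm (mtype g) = pnorm lam + pnorm mu"
  shows "strc n (mtype g) lam mu = astab (mtype g) lam mu"
proof -
  let ?nu = "mtype g"
  let ?m = "pnorm ?nu + length (epart ?nu)"
  have gt: "has_modtype g ?nu" using g by (rule has_modtype_mtype)
  obtain K where K: "K \<in> carrier_mat ?m ?m" "has_modtype K ?nu"
    "\<And>n g. g \<in> GL n \<Longrightarrow> has_modtype g ?nu \<Longrightarrow> ?m \<le> n \<and> similar_mat g (diag_sum K (1\<^sub>m (n - ?m)))"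
    using stable_representative[OF mtype_PPhi[OF g]] by metis
  define r where "r = n - ?m"
  have n: "n = ?m + r" and sim: "similar_mat g (diag_sum K (1\<^sub>m r))"
    using K(3)[OF g gt] by (simp_all add: r_def)
  have DG: "diag_sum K (1\<^sub>m r) \<in> GL n"
  proof -
    obtain P Q where PQ: "P \<in> carrier_mat n n" "Q \<in> carrier_mat n n" "P * Q = 1\<^sub>m n" "Q * P = 1\<^sub>m n"
      "Q * g = diag_sum K (1\<^sub>m r) * Q"
      using similar_mat_intertwiner[OF sim GL_carrier[OF g]] by metis
    have D: "diag_sum K (1\<^sub>m r) \<in> carrier_mat n n"
      using diag_sum_carrier[OF K(1) one_carrier_mat, of r] n by simp
    have "diag_sum K (1\<^sub>m r) = diag_sum K (1\<^sub>m r) * (Q * P)" using PQ D by simp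
    also have "\<dots> = diag_sum K (1\<^sub>m r) * Q * P"
      using PQ D by (intro assoc_mult_mat[symmetric]) auto
    finally have "diag_sum K (1\<^sub>m r) = Q * g * P" using PQ(5) by simp
    then show ?thesis using PQ g GL_intro GL_mult by metis
  qed
  then have KG: "K \<in> GL ?m" using GL_diag_sum_one_iff[OF K(1), of r] n by simp
  have "strc n ?nu lam mu = conv n (Ksum n lam) (Ksum n mu) g" using conv_eq_strc[OF g] by simp
  also have "\<dots> = conv n (Ksum n lam) (Ksum n mu) (diag_sum K (1\<^sub>m r))"
    by (rule conv_similar[OF sim g DG])
  also have "\<dots> = conv ?m (Ksum ?m lam) (Ksum ?m mu) K"
    using conv_diag_sum_one[OF KG K(2) eq, of r] n by simp
  also have "\<dots> = strc ?m (mtype K) lam mu" by (rule conv_eq_strc[OF KG])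
  also have "mtype K = ?nu" using has_modtype_iff[OF KG] K(2) by simp
  finally show ?thesis by (simp add: astab_def)
qed

lemma pnorm_mtype_le:
  assumes "g \<in> GL n"
  shows "pnorm (mtype g) \<le> n"
proof -
  have "pnorm (mtype g) + length (epart (mtype g)) \<le> n"
    by (rule stable_representative[OF mtype_PPhi[OF assms]])
      (use assms has_modtype_mtype[OF assms] in blast)
  then show ?thesis by simp
qed

lemma conv_outside: "g \<notin> GL n \<Longrightarrow> conv n x y g = 0"
  by (simp add: conv_def)

lemma conv_sum_sum:
  "conv n (\<lambda>g. \<Sum>a\<in>A. u a * f a g) (\<lambda>g. \<Sum>b\<in>B. v b * h b g) g
    = (\<Sum>a\<in>A. \<Sum>b\<in>B. u a * v b * conv n (f a) (h b) g)"
proof (cases "g \<in> GL n")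
  case True
  let ?F = "factorizations n g"
  have "conv n (\<lambda>g. \<Sum>a\<in>A. u a * f a g) (\<lambda>g. \<Sum>b\<in>B. v b * h b g) g
      = (\<Sum>p\<in>?F. \<Sum>a\<in>A. \<Sum>b\<in>B. u a * v b * (f a (fst p) * h b (snd p)))"
    unfolding conv_factorizations[OF True] sum_product by (simp add: ac_simps)
  also have "\<dots> = (\<Sum>a\<in>A. \<Sum>b\<in>B. \<Sum>p\<in>?F. u a * v b * (f a (fst p) * h b (snd p)))"
    by (subst sum.swap, rule sum.cong[OF refl], rule sum.swap)
  finally show ?thesis by (simp add: conv_factorizations[OF True] sum_distrib_left)
qed (simp add: conv_outside)

text \<open>This is the exact value before passing to the quotient. It carries \<open>strc n\<close>
  rather than \<open>astab\<close>, because the product also has terms at classes of norm below i.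
  The sum over j collapses, as each \<open>lam\<close> lies in one degree only.\<close>

lemma gr_mul_grmap:
  assumes x: "x \<in> Gq" and y: "y \<in> Gq" and g: "g \<in> GL n"
  shows "gr_mul n (grmap n x) (grmap n y) i g
    = (\<Sum>lam\<in>{lam. x lam \<noteq> 0}. \<Sum>mu\<in>{mu. y mu \<noteq> 0}.
        if i = pnorm lam + pnorm mu then x lam * y mu * strc n (mtype g) lam mu else 0)"
proof -
  let ?X = "{lam. x lam \<noteq> 0}" and ?Y = "{mu. y mu \<noteq> 0}"
  let ?t = "\<lambda>lam mu. x lam * y mu * strc n (mtype g) lam mu"
  have fin: "finite ?X" "finite ?Y" using x y by (simp_all add: Gq_def)
  have gm: "grmap n z j = (\<lambda>g. \<Sum>lam\<in>{lam. z lam \<noteq> 0 \<and> pnorm lam = j}. z lam * Ksum n lam g)"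
    if "z \<in> Gq" for z j
    unfolding grmap_def
  proof (intro ext sum.mono_neutral_right)
    show "finite {lam \<in> PPhi. pnorm lam = j}"
      by (rule finite_subset[OF _ finite_PPhi_pnorm_le[of j]]) auto
    show "{lam. z lam \<noteq> 0 \<and> pnorm lam = j} \<subseteq> {lam \<in> PPhi. pnorm lam = j}"
      using that by (auto simp: Gq_def)
  qed auto
  have "gr_mul n (grmap n x) (grmap n y) i g
      = (\<Sum>j\<le>i. \<Sum>lam\<in>{lam. x lam \<noteq> 0 \<and> pnorm lam = j}. \<Sum>mu\<in>{mu. y mu \<noteq> 0 \<and> pnorm mu = i - j}. ?t lam mu)"
    unfolding gr_mul_def gm[OF x] gm[OF y] conv_sum_sum conv_eq_strc[OF g] ..
  also have "\<dots> = (\<Sum>j\<le>i. \<Sum>lam\<in>?X. if pnorm lam = j then \<Sum>mu\<in>?Y. if pnorm mu = i - j then ?t lam mu else 0 else 0)"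
    using fin by (simp add: sum.inter_filter[symmetric])
  also have "\<dots> = (\<Sum>lam\<in>?X. \<Sum>j\<le>i. if pnorm lam = j then \<Sum>mu\<in>?Y. if pnorm mu = i - j then ?t lam mu else 0 else 0)"
    by (rule sum.swap)
  also have "\<dots> = (\<Sum>lam\<in>?X. \<Sum>mu\<in>?Y. if i = pnorm lam + pnorm mu then ?t lam mu else 0)"
  proof (rule sum.cong[OF refl])
    fix lam
    have "(\<Sum>j\<le>i. if pnorm lam = j then \<Sum>mu\<in>?Y. if pnorm mu = i - j then ?t lam mu else 0 else 0)
        = (if pnorm lam \<le> i then \<Sum>mu\<in>?Y. if pnorm mu = i - pnorm lam then ?t lam mu else 0 else 0)"
      by (simp add: sum.delta')
    also have "\<dots> = (\<Sum>mu\<in>?Y. if i = pnorm lam + pnorm mu then ?t lam mu else 0)"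
    proof (cases "pnorm lam \<le> i")
      case True
      then have "pnorm mu = i - pnorm lam \<longleftrightarrow> i = pnorm lam + pnorm mu" for mu :: "'a poly \<Rightarrow> nat list"
        by auto
      then show ?thesis using True by simp
    next
      case False
      then show ?thesis by (auto intro!: sum.neutral[symmetric])
    qed
    finally show "(\<Sum>j\<le>i. if pnorm lam = j then \<Sum>mu\<in>?Y. if pnorm mu = i - j then ?t lam mu else 0 else 0)
        = (\<Sum>mu\<in>?Y. if i = pnorm lam + pnorm mu then ?t lam mu else 0)" .
  qed
  finally show ?thesis .
qed

lemma gr_mul_outside: "g \<notin> GL n \<Longrightarrow> gr_mul n r s i g = 0"
  by (simp add: gr_mul_def conv_outside)

lemma Kfilt_zero: "(\<lambda>g. 0) \<in> Kfilt n i"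
  unfolding Kfilt_iff by (rule exI[where x = "\<lambda>_. 0"]) simp

text \<open>Compared by the norm of the modified type of \<open>g\<close>: above the sum of the
  norms everything vanishes by \<open>strc_high\<close>, at equality \<open>strc_eq_astab\<close>
  cancels both terms, and below it the remaining coefficient \<open>strc\<close> is itself the
  witness for the lower filtration step.\<close>

lemma conv_Ksum_top:
  "(\<lambda>g. conv n (Ksum n lam) (Ksum n mu) g
      - (\<Sum>nu\<in>{nu\<in>PPhi. pnorm nu = pnorm lam + pnorm mu}. astab nu lam mu * Ksum n nu g))
    \<in> Kfilt n (int (pnorm lam + pnorm mu) - 1)"
  unfolding Kfilt_iff
proof (intro exI[where x = "\<lambda>nu. strc n nu lam mu"] allI)
  fix g
  let ?S = "{nu\<in>PPhi. pnorm nu = pnorm lam + pnorm mu}"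
  have fin: "finite ?S" by (rule finite_subset[OF _ finite_PPhi_pnorm_le[of "pnorm lam + pnorm mu"]]) auto
  show "conv n (Ksum n lam) (Ksum n mu) g - (\<Sum>nu\<in>?S. astab nu lam mu * Ksum n nu g)
    = (if g \<in> GL n \<and> int (pnorm (mtype g)) \<le> int (pnorm lam + pnorm mu) - 1 then strc n (mtype g) lam mu else 0)"
  proof (cases "g \<in> GL n")
    case True
    consider "pnorm (mtype g) < pnorm lam + pnorm mu" | "pnorm (mtype g) = pnorm lam + pnorm mu"
      | "pnorm (mtype g) > pnorm lam + pnorm mu" by linarith
    then show ?thesis
      unfolding sum_Ksum[OF fin] conv_eq_strc[OF True]
      by cases (use True mtype_PPhi[OF True] strc_eq_astab[OF True] strc_high[OF True] in auto)
  qed (simp add: conv_outside sum_Ksum[OF fin])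
qed

lemma gr_elem_grmap: "gr_elem n (grmap n x)"
  unfolding gr_elem_def Kfilt_iff
proof
  fix i
  show "\<exists>c. \<forall>g. grmap n x i g = (if g \<in> GL n \<and> int (pnorm (mtype g)) \<le> int i then c (mtype g) else 0)"
    by (rule exI[where x = "\<lambda>nu. if pnorm nu = i then x nu else 0"]) (auto simp: grmap_eq)
qed

lemma gr_eq_of_eq: "(\<And>i g. r i g = s i g) \<Longrightarrow> gr_eq n r s"
  by (simp add: gr_eq_def Kfilt_zero)

lemma grmap_add: "gr_eq n (grmap n (Gq_add x y)) (gr_add (grmap n x) (grmap n y))"
  by (rule gr_eq_of_eq) (simp add: gr_add_def Gq_add_def grmap_eq)

lemma grmap_mul:
  assumes x: "x \<in> Gq" and y: "y \<in> Gq"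
  shows "gr_eq n (grmap n (Gq_mul x y)) (gr_mul n (grmap n x) (grmap n y))"
  unfolding gr_eq_def Kfilt_iff
proof
  fix i
  \<comment> \<open>At modified types of elements of \<open>GL n\<close>, this coefficient vanishes
    for norm above i and agrees with \<open>Gq_mul\<close> for norm i. For smaller norm
    \<open>grmap\<close> is zero in degree i, so the negative of \<open>C\<close> is the witness for
    step i - 1.\<close>
  define C where "C nu = (\<Sum>lam\<in>{lam. x lam \<noteq> 0}. \<Sum>mu\<in>{mu. y mu \<noteq> 0}.
        if i = pnorm lam + pnorm mu then x lam * y mu * strc n nu lam mu else 0)" for nu
  have "grmap n (Gq_mul x y) i g - gr_mul n (grmap n x) (grmap n y) i g
    = (if g \<in> GL n \<and> int (pnorm (mtype g)) \<le> int i - 1 then - C (mtype g) else 0)" for g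
  proof (cases "g \<in> GL n")
    case True
    note gm = gr_mul_grmap[OF x y True, of i, folded C_def]
    consider "pnorm (mtype g) < i" | "pnorm (mtype g) = i" | "pnorm (mtype g) > i" by linarith
    then show ?thesis
    proof cases
      case 1
      then show ?thesis using True gm by (simp add: grmap_eq)
    next
      case 2
      have "C (mtype g) = Gq_mul x y (mtype g)"
        unfolding C_def Gq_mul_def using mtype_PPhi[OF True] strc_eq_astab[OF True] 2
        by (auto intro!: sum.cong)
      then show ?thesis using True gm 2 by (simp add: grmap_eq)
    next
      case 3
      have "C (mtype g) = 0"
        unfolding C_def using strc_high[OF True] 3 by (auto intro!: sum.neutral)
      then show ?thesis using True gm 3 by (simp add: grmap_eq)
    qed
  qed (simp add: grmap_eq gr_mul_outside)
  then show "\<exists>c. \<forall>g. grmap n (Gq_mul x y) i g - gr_mul n (grmap n x) (grmap n y) i g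
    = (if g \<in> GL n \<and> int (pnorm (mtype g)) \<le> int i - 1 then c (mtype g) else 0)"
    by (intro exI[where x = "\<lambda>nu. - C nu"]) simp
qed

lemma grmap_one: "gr_eq n (grmap n Gq_one) (gr_one n)"
proof (rule gr_eq_of_eq)
  have "pnorm (emptyp :: 'a poly \<Rightarrow> nat list) = 0" by (simp add: pnorm_def supp_p_def emptyp_def)
  then show "grmap n Gq_one i g = gr_one n i g" for i and g :: "'a mat"
    by (auto simp: grmap_eq gr_one_def Gq_one_def Ksum_mtype)
qed

lemma grmap_surj:
  assumes "gr_elem n r"
  shows "\<exists>x\<in>Gq. gr_eq n (grmap n x) r"
proof -
  have "\<forall>i. \<exists>c. \<forall>g. r i g = (if g \<in> GL n \<and> int (pnorm (mtype g)) \<le> int i then c (mtype g) else 0)"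
    using assms unfolding gr_elem_def Kfilt_iff .
  then obtain c where c: "\<And>i g. r i g = (if g \<in> GL n \<and> pnorm (mtype g) \<le> i then c i (mtype g) else 0)"
    by (metis of_nat_le_iff)
  \<comment> \<open>Modulo step i - 1 only the coefficients of \<open>r i\<close> at norm exactly i
    count, so the value at \<open>lam\<close> is taken from component \<open>pnorm lam\<close>. The
    cut at \<open>n\<close> makes the support finite and loses nothing, as norms on
    \<open>GL n\<close> are at most \<open>n\<close>.\<close>
  define x where "x lam = (if lam \<in> PPhi \<and> pnorm lam \<le> n then c (pnorm lam) lam else 0)" for lam
  have "finite {lam. x lam \<noteq> 0}"
    by (rule finite_subset[OF _ finite_PPhi_pnorm_le[of n]]) (auto simp: x_def)
  then have "x \<in> Gq" by (auto simp: Gq_def x_def)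
  moreover have "gr_eq n (grmap n x) r"
    unfolding gr_eq_def Kfilt_iff
  proof
    fix i
    \<comment> \<open>At norm i the two terms cancel; below it the first is zero, which leaves minus
      the coefficients of \<open>r i\<close>.\<close>
    show "\<exists>d. \<forall>g. grmap n x i g - r i g
        = (if g \<in> GL n \<and> int (pnorm (mtype g)) \<le> int i - 1 then d (mtype g) else 0)"
      by (rule exI[where x = "\<lambda>nu. - c i nu"])
        (use mtype_PPhi pnorm_mtype_le in \<open>auto simp: grmap_eq c x_def\<close>)
  qed
  ultimately show ?thesis by blast
qed

theorem theorem3p5:
  fixes n :: nat
  shows "(\<forall>lam\<in>(PPhi :: ('a::{field,finite} poly \<Rightarrow> nat list) set). \<forall>mu\<in>PPhi.
            (\<lambda>g. conv n (Ksum n lam) (Ksum n mu) g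
                  - (\<Sum>nu\<in>{nu\<in>PPhi. pnorm nu = pnorm lam + pnorm mu}. astab nu lam mu * Ksum n nu g))
            \<in> Kfilt n (int (pnorm lam + pnorm mu) - 1))
       \<and> (\<forall>x\<in>(Gq :: (('a poly \<Rightarrow> nat list) \<Rightarrow> int) set). gr_elem n (grmap n x))
       \<and> (\<forall>x\<in>(Gq :: (('a poly \<Rightarrow> nat list) \<Rightarrow> int) set). \<forall>y\<in>Gq.
            gr_eq n (grmap n (Gq_add x y)) (gr_add (grmap n x) (grmap n y)))
       \<and> (\<forall>x\<in>(Gq :: (('a poly \<Rightarrow> nat list) \<Rightarrow> int) set). \<forall>y\<in>Gq.
            gr_eq n (grmap n (Gq_mul x y)) (gr_mul n (grmap n x) (grmap n y)))
       \<and> gr_eq n (grmap n (Gq_one :: ('a poly \<Rightarrow> nat list) \<Rightarrow> int)) (gr_one n)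
       \<and> (\<forall>r. gr_elem n (r :: nat \<Rightarrow> 'a grpring) \<longrightarrow>
            (\<exists>x\<in>(Gq :: (('a poly \<Rightarrow> nat list) \<Rightarrow> int) set). gr_eq n (grmap n x) r))"
  by (intro conjI ballI allI impI)
    (assumption | rule conv_Ksum_top gr_elem_grmap grmap_add grmap_mul grmap_one grmap_surj)+

end
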